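(* Let $\pi:\widetilde{\Gamma}\to\Gamma$ be a dilated double cover of metric graphs, with $\Gamma$ connected. Let $m_d(\widetilde{\Gamma}/\Gamma)$, $n_d(\widetilde{\Gamma}/\Gamma)$ and $d(\widetilde{\Gamma}/\Gamma)$ be respectively the numbers of edges, vertices, and connected components of the dilation subgraph $\Gamma_{\mathrm{dil}}$. Then the volume of the tropical Prym variety of $\pi$ is given by \[ \mathrm{Vol}^2(\mathrm{Prym}(\widetilde{\Gamma}/\Gamma))=2^{m_d(\widetilde{\Gamma}/\Gamma)-n_d(\widetilde{\Gamma}/\Gamma)+d(\widetilde{\Gamma}/\Gamma)}\,\frac{\mathrm{Vol}^2(\mathrm{Jac}(\widetilde{\Gamma}))}{\mathrm{Vol}^2(\mathrm{Jac}(\Gamma))}. \]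
   Context: **Graphs.** A graph $G$ has a finite non-empty vertex set $V(G)$, a finite set $H(G)$ of half-edges with a root map $r:H(G)\to V(G)$ and a fixed-point-free involution on $H(G)$ whose orbits $e=\{h,h'\}$ are the edges; $E(G)$ is the set of edges. Loops and multiple edges are allowed. The genus of a connected graph is $g(G)=b_1(G)=\#E(G)-\#V(G)+1$ (there are no vertex weights). A metric graph $\Gamma$ is a graph together with a positive length $\ell(e)$ for each edge $e$; a choice of underlying graph (model) is always fixed, and we write $V(\Gamma),E(\Gamma)$, etc. **Double covers.** A double cover $\pi:\widetilde{\Gamma}\to\Gamma$ consists of maps $V(\widetilde{\Gamma})\to V(\Gamma)$ and $H(\widetilde{\Gamma})\to H(\Gamma)$ commuting with the root maps and the edge involutions, and a degree function $d_\pi:V(\widetilde{\Gamma})\cup E(\widetilde{\Gamma})\to\mathbb{Z}_{>0}$ (the degree of a half-edge is that of its edge) such that: (i) for every $\widetilde{v}\in V(\widetilde{\Gamma})$ and every half-edge $h$ rooted at $\pi(\widetilde{v})$, $d_\pi(\widetilde{v})$ is the sum of $d_\pi(\widetilde{h})$ over the half-edges $\widetilde{h}$ rooted at $\widetilde{v}$ with $\pi(\widetilde{h})=h$; (ii) the degrees of the preimages of each vertex and each half-edge of $\Gamma$ sum to $2$; (iii) $\ell(\pi(\widetilde{e}))=d_\pi(\widetilde{e})\,\ell(\widetilde{e})$ for all $\widetilde{e}\in E(\widetilde{\Gamma})$. A vertex or edge of $\Gamma$ is dilated if it has a single preimage (of degree $2$), and undilated if it has two preimages (each of degree $1$). The dilated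 vertices and edges form the dilation subgraph $\Gamma_{\mathrm{dil}}\subset\Gamma$. The cover is dilated if $\Gamma_{\mathrm{dil}}\neq\emptyset$; when $\Gamma$ is connected, $\widetilde{\Gamma}$ is then connected too. **Jacobians.** Fix orientations compatible with $\pi$. $H_1(\Gamma,\mathbb{Z})\subset\mathbb{Z}^{E(\Gamma)}$ is the simplicial homology, with edge length pairing $\left[\sum a_e e,\sum b_e e\right]_\Gamma=\sum a_e b_e\ell(e)$; similarly for $\widetilde{\Gamma}$. The Jacobian $\mathrm{Jac}(\Gamma)$ is the real torus $\mathrm{Hom}(H_1(\Gamma,\mathbb{Z}),\mathbb{R})/H_1(\Gamma,\mathbb{Z})$ (embedding via the pairing), principally polarized by the identity of $H_1(\Gamma,\mathbb{Z})$, and its volume is given by $\mathrm{Vol}^2(\mathrm{Jac}(\Gamma))=\det\big([\gamma_i,\gamma_j]_\Gamma\big)$ for any $\mathbb{Z}$-basis $(\gamma_i)$ of $H_1(\Gamma,\mathbb{Z})$ (equal to $1$ if $g(\Gamma)=0$); similarly for $\widetilde{\Gamma}$. **The Prym variety.** The maps $\pi_*:H_1(\widetilde{\Gamma},\mathbb{Z})\to H_1(\Gamma,\mathbb{Z})$ and $\pi^*:H_1(\Gamma,\mathbb{Z})\to H_1(\widetilde{\Gamma},\mathbb{Z})$ are induced by $\pi_*(\widetilde{e})=\pi(\widetilde{e})$, and by $\pi^*(e)=2\widetilde{e}$ if $e$ is dilated with preimage $\widetilde{e}$, $\pi^*(e)=\widetilde{e}^++\widetilde{e}^-$ if $e$ is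 undilated with preimages $\widetilde{e}^\pm$. Let $h=g(\widetilde{\Gamma})-g(\Gamma)$, let $K'=\ker\pi_*$, and let $K$ be the quotient of $\mathrm{coker}\,\pi^*$ by its torsion subgroup; both are free abelian of rank $h$. The pairing $[\cdot,\cdot]_{\widetilde{\Gamma}}$ induces a well-defined non-degenerate pairing $[\cdot,\cdot]_P:K\times K'\to\mathbb{R}$. The tropical Prym variety $\mathrm{Prym}(\widetilde{\Gamma}/\Gamma)$ is the real torus $\mathrm{Hom}(K,\mathbb{R})/K'$ with this integral structure and with a principal polarization, i.e. an isomorphism $\zeta:K'\to K$ such that $(\lambda,\mu)_P=[\zeta(\lambda),\mu]_P$ is symmetric and positive definite on $K'$. Its volume is defined by $\mathrm{Vol}^2=\det\big((\lambda_i,\lambda_j)_P\big)$ for any basis $\lambda_1,\ldots,\lambda_h$ of $K'$. Since $\zeta$ is an isomorphism of lattices, this number does not depend on $\zeta$ and equals \[ \mathrm{Vol}^2(\mathrm{Prym}(\widetilde{\Gamma}/\Gamma))=\left|\det\big([\kappa_i,\lambda_j]_P\big)_{1\le i,j\le h}\right| \] for any bases $\kappa_1,\ldots,\kappa_h$ of $K$ and $\lambda_1,\ldots,\lambda_h$ of $K'$; this formula is to be taken as the definition of $\mathrm{Vol}^2(\mathrm{Prym}(\widetilde{\Gamma}/\Gamma))$ (it equals $1$ if $h=0$). *)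

theory Defs
  imports
    Complex_Main
    "HOL-Algebra.Free_Abelian_Groups"
    "Jordan_Normal_Form.Determinant"
begin

section \<open>Metric graphs\<close>

text \<open>
  Edges are the orbits \<open>{h, hinv h}\<close> of the involution \<open>hinv\<close> on the half-edges.
  The field \<open>elen\<close> is the edge length; its values off the set of edges are irrelevant.
\<close>

record ('v, 'h) mgraph =
  verts :: "'v set"
  halfs :: "'h set"
  hroot :: "'h \<Rightarrow> 'v"
  hinv :: "'h \<Rightarrow> 'h"
  elen :: "'h set \<Rightarrow> real"

definition edge_of :: "('v, 'h) mgraph \<Rightarrow> 'h \<Rightarrow> 'h set" where
  "edge_of G h = {h, hinv G h}"

definition edges :: "('v, 'h) mgraph \<Rightarrow> 'h set set" where
  "edges G = edge_of G ` halfs G"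

definition metric_graph :: "('v, 'h) mgraph \<Rightarrow> bool" where
  "metric_graph G \<longleftrightarrow>
     finite (verts G) \<and> verts G \<noteq> {} \<and> finite (halfs G) \<and>
     (\<forall>h\<in>halfs G. hroot G h \<in> verts G \<and> hinv G h \<in> halfs G \<and>
        hinv G (hinv G h) = h \<and> hinv G h \<noteq> h) \<and>
     (\<forall>e\<in>edges G. elen G e > 0)"

definition connection :: "('v, 'h) mgraph \<Rightarrow> ('v \<times> 'v) set" where
  "connection G =
     {(hroot G h, hroot G (hinv G h)) | h. h \<in> halfs G}\<^sup>* \<inter> (verts G \<times> verts G)"

definition components :: "('v, 'h) mgraph \<Rightarrow> 'v set set" where
  "components G = verts G // connection G"

definition connected_graph :: "('v, 'h) mgraph \<Rightarrow> bool" where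
  "connected_graph G \<longleftrightarrow> (\<forall>u\<in>verts G. \<forall>v\<in>verts G. (u, v) \<in> connection G)"

section \<open>Double covers\<close>

record ('w, 'k, 'v, 'h) cover =
  vmap :: "'w \<Rightarrow> 'v"
  hmap :: "'k \<Rightarrow> 'h"
  vdeg :: "'w \<Rightarrow> nat"
  edeg :: "'k set \<Rightarrow> nat"

text \<open>The cover maps an edge \<open>e\<close>, being a set of half-edges, to the image \<open>hmap p ` e\<close>.\<close>

definition double_cover ::
  "('w, 'k) mgraph \<Rightarrow> ('v, 'h) mgraph \<Rightarrow> ('w, 'k, 'v, 'h) cover \<Rightarrow> bool" where
  "double_cover Gt G p \<longleftrightarrow>
     metric_graph Gt \<and> metric_graph G \<and>
     vmap p \<in> verts Gt \<rightarrow> verts G \<and>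
     hmap p \<in> halfs Gt \<rightarrow> halfs G \<and>
     (\<forall>k\<in>halfs Gt. hroot G (hmap p k) = vmap p (hroot Gt k) \<and>
                    hinv G (hmap p k) = hmap p (hinv Gt k)) \<and>
     (\<forall>w\<in>verts Gt. vdeg p w > 0) \<and>
     (\<forall>e\<in>edges Gt. edeg p e > 0) \<and>
     (\<forall>w\<in>verts Gt. \<forall>h\<in>halfs G. hroot G h = vmap p w \<longrightarrow>
        vdeg p w = (\<Sum>k | k \<in> halfs Gt \<and> hroot Gt k = w \<and> hmap p k = h. edeg p (edge_of Gt k))) \<and>
     (\<forall>v\<in>verts G. (\<Sum>w | w \<in> verts Gt \<and> vmap p w = v. vdeg p w) = 2) \<and>
     (\<forall>h\<in>halfs G. (\<Sum>k | k \<in> halfs Gt \<and> hmap p k = h. edeg p (edge_of Gt k)) = 2) \<and>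
     (\<forall>e\<in>edges Gt. elen G (hmap p ` e) = real (edeg p e) * elen Gt e)"

definition vertex_preimages ::
  "('w, 'k) mgraph \<Rightarrow> ('w, 'k, 'v, 'h) cover \<Rightarrow> 'v \<Rightarrow> 'w set" where
  "vertex_preimages Gt p v = {w \<in> verts Gt. vmap p w = v}"

definition edge_preimages ::
  "('w, 'k) mgraph \<Rightarrow> ('w, 'k, 'v, 'h) cover \<Rightarrow> 'h set \<Rightarrow> 'k set set" where
  "edge_preimages Gt p e = {f \<in> edges Gt. hmap p ` f = e}"

definition dilated_vertex ::
  "('w, 'k) mgraph \<Rightarrow> ('w, 'k, 'v, 'h) cover \<Rightarrow> 'v \<Rightarrow> bool" where
  "dilated_vertex Gt p v \<longleftrightarrow> card (vertex_preimages Gt p v) = 1"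

definition dilated_edge ::
  "('w, 'k) mgraph \<Rightarrow> ('w, 'k, 'v, 'h) cover \<Rightarrow> 'h set \<Rightarrow> bool" where
  "dilated_edge Gt p e \<longleftrightarrow> card (edge_preimages Gt p e) = 1"

text \<open>The dilation subgraph may be empty, in which case it is not a \<open>metric_graph\<close>.\<close>

definition dilation_subgraph ::
  "('w, 'k) mgraph \<Rightarrow> ('v, 'h) mgraph \<Rightarrow> ('w, 'k, 'v, 'h) cover \<Rightarrow> ('v, 'h) mgraph" where
  "dilation_subgraph Gt G p =
     G\<lparr>verts := {v \<in> verts G. dilated_vertex Gt p v},
       halfs := {h \<in> halfs G. dilated_edge Gt p (edge_of G h)}\<rparr>"

definition dilated_cover ::
  "('w, 'k) mgraph \<Rightarrow> ('v, 'h) mgraph \<Rightarrow> ('w, 'k, 'v, 'h) cover \<Rightarrow> bool" where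
  "dilated_cover Gt G p \<longleftrightarrow>
     verts (dilation_subgraph Gt G p) \<noteq> {} \<or> edges (dilation_subgraph Gt G p) \<noteq> {}"

section \<open>Orientations and homology\<close>

text \<open>
  An orientation selects one half-edge of each edge, the one at the source of the edge.
\<close>

definition orientation :: "('v, 'h) mgraph \<Rightarrow> 'h set \<Rightarrow> bool" where
  "orientation G A \<longleftrightarrow> A \<subseteq> halfs G \<and> (\<forall>h\<in>halfs G. h \<in> A \<longleftrightarrow> hinv G h \<notin> A)"

definition compatible_orientations ::
  "('w, 'k) mgraph \<Rightarrow> ('w, 'k, 'v, 'h) cover \<Rightarrow> 'k set \<Rightarrow> 'h set \<Rightarrow> bool" where
  "compatible_orientations Gt p At A \<longleftrightarrow> (\<forall>k\<in>halfs Gt. k \<in> At \<longleftrightarrow> hmap p k \<in> A)"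

definition source :: "('v, 'h) mgraph \<Rightarrow> 'h set \<Rightarrow> 'h set \<Rightarrow> 'v" where
  "source G A e = hroot G (THE h. h \<in> e \<and> h \<in> A)"

definition target :: "('v, 'h) mgraph \<Rightarrow> 'h set \<Rightarrow> 'h set \<Rightarrow> 'v" where
  "target G A e = hroot G (THE h. h \<in> e \<and> h \<notin> A)"

definition boundary ::
  "('v, 'h) mgraph \<Rightarrow> 'h set \<Rightarrow> ('h set \<Rightarrow>\<^sub>0 int) \<Rightarrow> ('v \<Rightarrow>\<^sub>0 int)" where
  "boundary G A = frag_extend (\<lambda>e. frag_of (target G A e) - frag_of (source G A e))"

definition H1 :: "('v, 'h) mgraph \<Rightarrow> 'h set \<Rightarrow> ('h set \<Rightarrow>\<^sub>0 int) monoid" where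
  "H1 G A = (free_Abelian_group (edges G))
     \<lparr>carrier := kernel (free_Abelian_group (edges G)) (free_Abelian_group (verts G)) (boundary G A)\<rparr>"

definition length_pairing ::
  "('v, 'h) mgraph \<Rightarrow> ('h set \<Rightarrow>\<^sub>0 int) \<Rightarrow> ('h set \<Rightarrow>\<^sub>0 int) \<Rightarrow> real" where
  "length_pairing G a b =
     (\<Sum>e\<in>edges G. of_int (Poly_Mapping.lookup a e) * of_int (Poly_Mapping.lookup b e) * elen G e)"

section \<open>Bases of free abelian groups and the volume of the Jacobian\<close>

text \<open>
  \<open>zbasis L n b\<close>: the elements \<open>b 0, \<dots>, b (n - 1)\<close> form a basis over the integers of the abelian
  group \<open>L\<close> (written multiplicatively in the library).
\<close>

definition zbasis :: "('a, 'm) monoid_scheme \<Rightarrow> nat \<Rightarrow> (nat \<Rightarrow> 'a) \<Rightarrow> bool" where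
  "zbasis L n b \<longleftrightarrow> b \<in> {..<n} \<rightarrow> carrier L \<and>
     (\<forall>x\<in>carrier L. \<exists>!c. c \<in> {..<n} \<rightarrow>\<^sub>E (UNIV :: int set) \<and>
        x = (\<Otimes>\<^bsub>L\<^esub>i\<in>{..<n}. b i [^]\<^bsub>L\<^esub> c i))"

text \<open>
  The squared volumes below are the common value of a determinant over all choices of bases.
  The determinant of the empty matrix is 1.
\<close>

definition vol2_Jac :: "('v, 'h) mgraph \<Rightarrow> 'h set \<Rightarrow> real" where
  "vol2_Jac G A = (THE D. \<exists>n \<gamma>. zbasis (H1 G A) n \<gamma> \<and>
     D = det (mat n n (\<lambda>(i, j). length_pairing G (\<gamma> i) (\<gamma> j))))"

section \<open>The Prym variety\<close>

definition push_forward ::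
  "('w, 'k, 'v, 'h) cover \<Rightarrow> ('k set \<Rightarrow>\<^sub>0 int) \<Rightarrow> ('h set \<Rightarrow>\<^sub>0 int)" where
  "push_forward p = frag_extend (\<lambda>f. frag_of (hmap p ` f))"

definition pull_back ::
  "('w, 'k) mgraph \<Rightarrow> ('w, 'k, 'v, 'h) cover \<Rightarrow> ('h set \<Rightarrow>\<^sub>0 int) \<Rightarrow> ('k set \<Rightarrow>\<^sub>0 int)" where
  "pull_back Gt p = frag_extend (\<lambda>e.
     if dilated_edge Gt p e then frag_cmul 2 (\<Sum>f\<in>edge_preimages Gt p e. frag_of f)
     else (\<Sum>f\<in>edge_preimages Gt p e. frag_of f))"

definition torsion :: "('a, 'm) monoid_scheme \<Rightarrow> 'a set" where
  "torsion L = {x \<in> carrier L. \<exists>n::nat. n > 0 \<and> x [^]\<^bsub>L\<^esub> n = \<one>\<^bsub>L\<^esub>}"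

definition coker ::
  "('a, 'm) monoid_scheme \<Rightarrow> ('b, 'n) monoid_scheme \<Rightarrow> ('a \<Rightarrow> 'b) \<Rightarrow> 'b set monoid" where
  "coker L M f = M Mod (f ` carrier L)"

definition prym_K' ::
  "('w, 'k) mgraph \<Rightarrow> ('v, 'h) mgraph \<Rightarrow> ('w, 'k, 'v, 'h) cover \<Rightarrow> 'k set \<Rightarrow> 'h set \<Rightarrow>
     ('k set \<Rightarrow>\<^sub>0 int) monoid" where
  "prym_K' Gt G p At A =
     (H1 Gt At)\<lparr>carrier := kernel (H1 Gt At) (H1 G A) (push_forward p)\<rparr>"

definition prym_K ::
  "('w, 'k) mgraph \<Rightarrow> ('v, 'h) mgraph \<Rightarrow> ('w, 'k, 'v, 'h) cover \<Rightarrow> 'k set \<Rightarrow> 'h set \<Rightarrow>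
     ('k set \<Rightarrow>\<^sub>0 int) set set monoid" where
  "prym_K Gt G p At A =
     (let C = coker (H1 G A) (H1 Gt At) (pull_back Gt p) in C Mod torsion C)"

text \<open>
  An element \<open>\<kappa>\<close> of \<open>prym_K\<close> is a coset of cosets, so \<open>\<Union>\<kappa>\<close> is the set of cycles that
  represent it. The pairing does not depend on the representative.
\<close>

definition prym_pairing ::
  "('w, 'k) mgraph \<Rightarrow> ('k set \<Rightarrow>\<^sub>0 int) set set \<Rightarrow> ('k set \<Rightarrow>\<^sub>0 int) \<Rightarrow> real" where
  "prym_pairing Gt \<kappa> \<mu> = (THE r. \<exists>x\<in>\<Union>\<kappa>. r = length_pairing Gt x \<mu>)"

definition vol2_Prym ::
  "('w, 'k) mgraph \<Rightarrow> ('v, 'h) mgraph \<Rightarrow> ('w, 'k, 'v, 'h) cover \<Rightarrow> 'k set \<Rightarrow> 'h set \<Rightarrow> real" where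
  "vol2_Prym Gt G p At A = (THE D. \<exists>n \<kappa> \<mu>.
     zbasis (prym_K Gt G p At A) n \<kappa> \<and> zbasis (prym_K' Gt G p At A) n \<mu> \<and>
     D = \<bar>det (mat n n (\<lambda>(i, j). prym_pairing Gt (\<kappa> i) (\<mu> j)))\<bar>)"

end

theory Submission
  imports Defs
begin

text \<open>
  Write \<open>K'\<close> for the kernel of \<open>\<pi>\<^sub>*\<close> and \<open>P\<close> for the saturation of the image of \<open>\<pi>\<^sup>*\<close>, both inside the
  cycles of the cover. As \<open>\<pi>\<^sub>*\<close> and \<open>\<pi>\<^sup>*\<close> are adjoint for the length pairings, \<open>P\<close> is orthogonal to \<open>K'\<close>.
  Lifting paths to the unique vertex over a dilated vertex shows that \<open>\<pi>\<^sub>*\<close> is surjective. Hence the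
  cycles of the cover have a basis \<open>(\<kappa>, p)\<close>, with \<open>p\<close> a basis of \<open>P\<close> and \<open>\<kappa>\<close> lifting a basis of the
  quotient by \<open>P\<close>, and a basis \<open>(\<mu>, \<sigma>)\<close>, with \<open>\<mu>\<close> a basis of \<open>K'\<close> and \<open>\<sigma>\<close> lifting a basis \<open>\<gamma>\<close> of the
  cycles of the base. The matrix of the pairing between these two bases is block triangular, so that
  \<open>Vol\<^sup>2(Jac)\<close> of the cover is \<open>Vol\<^sup>2(Prym)\<close> times \<open>\<bar>det [p, \<sigma>]\<bar>\<close>. If \<open>\<gamma>\<close> extends a basis
  \<open>\<gamma>\<^sub>1, \<dots>, \<gamma>\<^sub>r\<close> of the cycles of the dilation subgraph, then \<open>p\<close> may be taken to be
  \<open>\<pi>\<^sup>*(\<gamma>\<^sub>i) / 2\<close> for \<open>i \<le> r\<close> and \<open>\<pi>\<^sup>*(\<gamma>\<^sub>i)\<close> for \<open>i > r\<close>, and adjointness gives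
  \<open>det [p, \<sigma>] = 2\<^sup>-\<^sup>r det [\<gamma>, \<gamma>]\<close>. Finally \<open>r\<close> is the first Betti number of the dilation subgraph.
\<close>

section \<open>Bases of subgroups of free abelian groups\<close>

text \<open>The power of 2 comes from a parity. Pull-backs have even coefficients over dilated
  edges, so the pull-back of a cycle of the dilation subgraph can be halved. Conversely, if
  \<open>pull y\<close> is divisible by 2, then \<open>y\<close> has even coefficients on the
  undilated edges, where the degree is 1. The obstacle is that half of the part of \<open>y\<close>
  on these edges is a chain \<open>z\<close>, not a cycle. Twice the boundary of \<open>z\<close>
  bounds inside the dilation subgraph; as H_0 of that subgraph is free, the boundary of
  \<open>z\<close> itself bounds there. Correcting \<open>z\<close> accordingly writes
  \<open>y\<close> as twice a cycle plus a cycle of the dilation subgraph, so no halves beyond those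
  in the proposed basis occur. Dilation of the cover is what makes \<open>push\<close> surjective:
  for a connected unramified double cover its image would have index 2. The volumes are definite
  descriptions ranging over all bases, and \<open>K\<close> consists of cosets of cosets. Bases of
  quotients are therefore handled through representatives, and every determinant identity is proved
  for arbitrary bases, up to a sign.\<close>

interpretation frag: Modules.module "frag_cmul :: int \<Rightarrow> ('a \<Rightarrow>\<^sub>0 int) \<Rightarrow> 'a \<Rightarrow>\<^sub>0 int"
  by unfold_locales
    (auto simp: frag_cmul_distrib frag_cmul_distrib2 plus_poly_mapping.rep_eq intro!: poly_mapping_eqI)

declare frag.scale_minus_left [simp del]  \<comment> \<open>loops with \<open>minus_frag_cmul\<close>\<close>

abbreviation frag_hom :: "(('a \<Rightarrow>\<^sub>0 int) \<Rightarrow> ('b \<Rightarrow>\<^sub>0 int)) \<Rightarrow> bool" where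
  "frag_hom \<equiv> module_hom frag_cmul frag_cmul"

abbreviation frag_form :: "(('a \<Rightarrow>\<^sub>0 int) \<Rightarrow> real) \<Rightarrow> bool" where
  "frag_form \<equiv> module_hom frag_cmul (\<lambda>c x. of_int c * x)"

lemma frag_form_iff:
  "frag_form f \<longleftrightarrow> (\<forall>x y. f (x + y) = f x + f y) \<and> (\<forall>c x. f (frag_cmul c x) = of_int c * f x)"
proof -
  have "Modules.module (\<lambda>c x. of_int c * x :: real)"
    by unfold_locales (auto simp: algebra_simps)
  then show ?thesis
    using frag.module_axioms by (auto simp: module_hom_iff)
qed

lemma frag_hom_extend [intro, simp]: "frag_hom (frag_extend f)"
  by (simp add: module_hom_iff frag.module_axioms frag_extend_add frag_extend_cmul)

definition lin_comb :: "nat \<Rightarrow> (nat \<Rightarrow> int) \<Rightarrow> (nat \<Rightarrow> 'a \<Rightarrow>\<^sub>0 int) \<Rightarrow> 'a \<Rightarrow>\<^sub>0 int" where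
  "lin_comb n c b = (\<Sum>i<n. frag_cmul (c i) (b i))"

text \<open>For \<open>P\<close> inside \<open>M\<close>, this says that the classes of the
  \<open>b i\<close> form a basis of \<open>M / P\<close>. Working with representatives avoids
  forming the quotient; \<open>P = {0}\<close> gives bases of \<open>M\<close> itself.\<close>

definition rel_basis :: "('a \<Rightarrow>\<^sub>0 int) set \<Rightarrow> ('a \<Rightarrow>\<^sub>0 int) set \<Rightarrow> nat \<Rightarrow> (nat \<Rightarrow> 'a \<Rightarrow>\<^sub>0 int) \<Rightarrow> bool" where
  "rel_basis P M n b \<longleftrightarrow> (\<forall>i<n. b i \<in> M) \<and> (\<forall>x\<in>M. \<exists>c. x - lin_comb n c b \<in> P) \<and>
     (\<forall>c. lin_comb n c b \<in> P \<longrightarrow> (\<forall>i<n. c i = 0))"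

lemma rel_basisD:
  assumes "rel_basis P M n b"
  shows "i < n \<Longrightarrow> b i \<in> M" and "x \<in> M \<Longrightarrow> \<exists>c. x - lin_comb n c b \<in> P"
    and "lin_comb n c b \<in> P \<Longrightarrow> i < n \<Longrightarrow> c i = 0"
  using assms by (auto simp: rel_basis_def)

lemma lin_comb_mem:
  assumes "frag.subspace M" "\<And>i. i < n \<Longrightarrow> b i \<in> M"
  shows "lin_comb n c b \<in> M"
  using assms unfolding lin_comb_def by (intro frag.subspace_sum frag.subspace_scale) auto

lemma lin_comb_diff: "lin_comb n (\<lambda>i. c i - d i) b = lin_comb n c b - lin_comb n d b"
  by (simp add: lin_comb_def sum_subtractf frag_cmul_diff_distrib)

lemma lin_comb_scale: "lin_comb n (\<lambda>i. k * c i) b = frag_cmul k (lin_comb n c b)"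
  by (simp add: lin_comb_def frag_cmul_sum)

lemma lin_comb_cong:
  "(\<And>i. i < n \<Longrightarrow> c i = c' i) \<Longrightarrow> (\<And>i. i < n \<Longrightarrow> b i = b' i) \<Longrightarrow> lin_comb n c b = lin_comb n c' b'"
  by (simp add: lin_comb_def)

lemma lin_comb_delta: "i < n \<Longrightarrow> lin_comb n (\<lambda>j. if j = i then 1 else 0) b = b i"
  unfolding lin_comb_def by (subst sum.remove[of _ i]) auto

lemma frag_hom_lin_comb:
  assumes "frag_hom f"
  shows "f (lin_comb n c b) = lin_comb n c (\<lambda>i. f (b i))"
  using assms by (simp add: lin_comb_def module_hom.sum module_hom.scale)

lemma frag_form_lin_comb:
  assumes "frag_form f"
  shows "f (lin_comb n c b) = (\<Sum>i<n. of_int (c i) * f (b i))"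
  using assms by (simp add: lin_comb_def module_hom.sum module_hom.scale)

lemma lin_comb_append:
  "lin_comb (n + m) c (\<lambda>i. if i < n then b i else b' (i - n)) =
     lin_comb n c b + lin_comb m (\<lambda>i. c (n + i)) b'"
  by (induction m) (auto simp: lin_comb_def intro!: sum.cong)

lemma rel_basis_cong:
  assumes "\<And>i. i < n \<Longrightarrow> b i = b' i"
  shows "rel_basis P M n b \<longleftrightarrow> rel_basis P M n b'"
proof -
  have *: "lin_comb n c b = lin_comb n c b'" for c using assms by (intro lin_comb_cong) auto
  have "(\<forall>i<n. b i \<in> M) \<longleftrightarrow> (\<forall>i<n. b' i \<in> M)" using assms by auto
  then show ?thesis by (simp only: rel_basis_def *)
qed

text \<open>Subtracting a combination of the \<open>b i\<close> moves an element of \<open>M\<close>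
  into \<open>P\<close>, where the \<open>p i\<close> take over. Both orders of concatenation are
  recorded because the pairing matrix in \<open>prym_det\<close> is block triangular only if the
  lifts come first on one side and last on the other.\<close>

lemma rel_basis_trans:
  assumes P: "rel_basis Q P n p" and M: "rel_basis P M m b"
    and sub: "frag.subspace P" "frag.subspace M" "P \<subseteq> M" "Q \<subseteq> P"
  shows "rel_basis Q M (n + m) (\<lambda>i. if i < n then p i else b (i - n))"
    and "rel_basis Q M (m + n) (\<lambda>i. if i < m then b i else p (i - m))"
proof -
  have split: "\<exists>c d. x - (lin_comb n c p + lin_comb m d b) \<in> Q" if x: "x \<in> M" for x
  proof -
    obtain d where d: "x - lin_comb m d b \<in> P" using rel_basisD(2)[OF M x] by blast
    then obtain c where "x - lin_comb m d b - lin_comb n c p \<in> Q"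
      using rel_basisD(2)[OF P] by blast
    then have "x - (lin_comb n c p + lin_comb m d b) \<in> Q" by (simp add: algebra_simps)
    then show ?thesis by blast
  qed
  have indep: "(\<forall>i<n. c i = 0) \<and> (\<forall>i<m. d i = 0)" if "lin_comb n c p + lin_comb m d b \<in> Q" for c d
  proof -
    have pP: "lin_comb n c p \<in> P" using lin_comb_mem[OF sub(1)] rel_basisD(1)[OF P] by blast
    have "lin_comb n c p + lin_comb m d b - lin_comb n c p \<in> P"
      using that sub(4) by (intro frag.subspace_diff[OF sub(1)] pP) auto
    then have "lin_comb m d b \<in> P" by simp
    then have d: "\<forall>i<m. d i = 0" using rel_basisD(3)[OF M] by blast
    then have "lin_comb m d b = 0" by (simp add: lin_comb_def)
    then show ?thesis using d that rel_basisD(3)[OF P] by auto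
  qed
  have pM: "p i \<in> M" if "i < n" for i using rel_basisD(1)[OF P that] sub by auto
  show "rel_basis Q M (n + m) (\<lambda>i. if i < n then p i else b (i - n))"
    unfolding rel_basis_def lin_comb_append[of n m _ p b]
  proof (intro conjI ballI allI impI)
    fix x assume "x \<in> M"
    then obtain c d where cd: "x - (lin_comb n c p + lin_comb m d b) \<in> Q" using split by blast
    define e where "e = (\<lambda>i. if i < n then c i else d (i - n))"
    have "lin_comb n e p = lin_comb n c p" "lin_comb m (\<lambda>i. e (n + i)) b = lin_comb m d b"
      by (auto simp: e_def intro: lin_comb_cong)
    with cd have "x - (lin_comb n e p + lin_comb m (\<lambda>i. e (n + i)) b) \<in> Q"
      by simp
    then show "\<exists>c. x - (lin_comb n c p + lin_comb m (\<lambda>i. c (n + i)) b) \<in> Q"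
      by - (rule exI[of _ e], assumption)
  next
    fix c i assume "lin_comb n c p + lin_comb m (\<lambda>i. c (n + i)) b \<in> Q" and i: "i < n + m"
    then have 0: "\<forall>i<n. c i = 0" "\<forall>i<m. c (n + i) = 0" using indep by blast+
    show "c i = 0"
    proof (cases "i < n")
      case False
      then have "c (n + (i - n)) = 0" using 0(2) i by (intro mp[OF spec[OF 0(2)]]) simp
      then show ?thesis using False by simp
    qed (use 0 in simp)
  qed (use pM rel_basisD(1)[OF M] in auto)
  show "rel_basis Q M (m + n) (\<lambda>i. if i < m then b i else p (i - m))"
    unfolding rel_basis_def lin_comb_append[of m n _ b p]
  proof (intro conjI ballI allI impI)
    fix x assume "x \<in> M"
    then obtain c d where cd: "x - (lin_comb n c p + lin_comb m d b) \<in> Q" using split by blast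
    define e where "e = (\<lambda>i. if i < m then d i else c (i - m))"
    have "lin_comb m e b = lin_comb m d b" "lin_comb n (\<lambda>i. e (m + i)) p = lin_comb n c p"
      by (auto simp: e_def intro: lin_comb_cong)
    with cd have "x - (lin_comb m e b + lin_comb n (\<lambda>i. e (m + i)) p) \<in> Q"
      by (simp add: add.commute)
    then show "\<exists>c. x - (lin_comb m c b + lin_comb n (\<lambda>i. c (m + i)) p) \<in> Q"
      by - (rule exI[of _ e], assumption)
  next
    fix c i assume "lin_comb m c b + lin_comb n (\<lambda>i. c (m + i)) p \<in> Q" and i: "i < m + n"
    then have "lin_comb n (\<lambda>i. c (m + i)) p + lin_comb m c b \<in> Q" by (simp only: add.commute)
    then have 0: "\<forall>i<m. c i = 0" "\<forall>i<n. c (m + i) = 0" using indep by blast+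
    show "c i = 0"
    proof (cases "i < m")
      case False
      then have "c (m + (i - m)) = 0" using 0(2) i by (intro mp[OF spec[OF 0(2)]]) simp
      then show ?thesis using False by simp
    qed (use 0 in simp)
  qed (use pM rel_basisD(1)[OF M] in auto)
qed

lemma rel_basis_hom:
  assumes f: "frag_hom f" and b: "\<And>i. i < n \<Longrightarrow> b i \<in> M"
    and P: "\<And>x. x \<in> M \<Longrightarrow> f x = 0 \<longleftrightarrow> x \<in> P" and M: "frag.subspace M"
  shows "rel_basis {0} (f ` M) n (\<lambda>i. f (b i)) \<longleftrightarrow> rel_basis P M n b"
proof -
  have *: "f x - lin_comb n c (\<lambda>i. f (b i)) = f (x - lin_comb n c b)" for x c
    by (simp add: frag_hom_lin_comb[OF f] module_hom.diff[OF f])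
  have mem: "x - lin_comb n c b \<in> M" "lin_comb n c b \<in> M" if "x \<in> M" for x c
    using lin_comb_mem[OF M b] frag.subspace_diff[OF M that] by auto
  have 1: "x - lin_comb n c b \<in> P \<longleftrightarrow> f x - lin_comb n c (\<lambda>i. f (b i)) = 0" if "x \<in> M" for x c
    unfolding * using P[OF mem(1)[OF that]] by simp
  have 2: "lin_comb n c b \<in> P \<longleftrightarrow> lin_comb n c (\<lambda>i. f (b i)) = 0" for c
    using P[OF mem(2)[OF frag.subspace_0[OF M]]] frag_hom_lin_comb[OF f] by metis
  have 3: "(\<forall>x\<in>f ` M. \<exists>c. x - lin_comb n c (\<lambda>i. f (b i)) \<in> {0}) \<longleftrightarrow>
      (\<forall>x\<in>M. \<exists>c. x - lin_comb n c b \<in> P)"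
    using 1 by simp
  have 4: "\<forall>i<n. f (b i) \<in> f ` M" "\<forall>i<n. b i \<in> M" using b by auto
  show ?thesis
    unfolding rel_basis_def singleton_iff 2 3[unfolded singleton_iff] using 4 by argo
qed

text \<open>The way in which quotients acquire bases: exhibit \<open>P\<close> as the kernel of a
  map to a free group and lift a basis of the image.\<close>

lemma exists_rel_basis_hom:
  assumes f: "frag_hom f" and P: "\<And>x. x \<in> M \<Longrightarrow> f x = 0 \<longleftrightarrow> x \<in> P" and M: "frag.subspace M"
    and ex: "rel_basis {0} (f ` M) n d"
  obtains b where "rel_basis P M n b" "\<And>i. i < n \<Longrightarrow> f (b i) = d i"
proof -
  define b where "b i = inv_into M f (d i)" for i
  have b: "b i \<in> M" "f (b i) = d i" if "i < n" for i
    using rel_basisD(1)[OF ex that] by (simp_all add: b_def inv_into_into f_inv_into_f)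
  have "rel_basis {0} (f ` M) n (\<lambda>i. f (b i))"
    using ex rel_basis_cong[of n "\<lambda>i. f (b i)" d "{0}" "f ` M", OF b(2)] by simp
  then show thesis using b(2) that[of b] rel_basis_hom[of f n b M P, OF f b(1) P M] by simp
qed

section \<open>Change of basis: invariance of the rank and of determinants up to sign\<close>

lemma rel_basis_coords:
  assumes "rel_basis P M n b" and "\<And>i. i < m \<Longrightarrow> b' i \<in> M"
  shows "\<exists>U. \<forall>i<m. b' i - lin_comb n (U i) b \<in> P"
proof -
  define U where "U i = (SOME c. b' i - lin_comb n c b \<in> P)" for i
  have "b' i - lin_comb n (U i) b \<in> P" if "i < m" for i
    unfolding U_def by (rule someI_ex[OF rel_basisD(2)[OF assms(1) assms(2)[OF that]]])
  then show ?thesis by (intro exI[of _ U]) simp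
qed

lemma lin_comb_subst:
  assumes P: "frag.subspace P" and U: "\<And>i. i < m \<Longrightarrow> b' i - lin_comb n (U i) b \<in> P"
  shows "lin_comb m c b' - lin_comb n (\<lambda>j. \<Sum>i<m. c i * U i j) b \<in> P"
proof -
  have "lin_comb n (\<lambda>j. \<Sum>i<m. c i * U i j) b = (\<Sum>i<m. frag_cmul (c i) (lin_comb n (U i) b))"
    by (simp add: lin_comb_def frag.scale_sum_left frag_cmul_sum) (rule sum.swap)
  then have "lin_comb m c b' - lin_comb n (\<lambda>j. \<Sum>i<m. c i * U i j) b =
      (\<Sum>i<m. frag_cmul (c i) (b' i - lin_comb n (U i) b))"
    by (simp add: lin_comb_def sum_subtractf frag.scale_right_diff_distrib)
  then show ?thesis
    using U P by (auto intro!: frag.subspace_sum frag.subspace_scale)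
qed

text \<open>Expanding \<open>b' i\<close> in the \<open>b j\<close> and these again in the
  \<open>b' k\<close> must return \<open>b' i\<close> modulo \<open>P\<close>; uniqueness of
  coordinates makes the product of the two transition matrices the identity.\<close>

lemma rel_basis_inverse_coords:
  assumes P: "frag.subspace P" and b': "rel_basis P M m b'"
    and U: "\<And>i. i < m \<Longrightarrow> b' i - lin_comb n (U i) b \<in> P"
    and V: "\<And>j. j < n \<Longrightarrow> b j - lin_comb m (V j) b' \<in> P"
    and ik: "i < m" "k < m"
  shows "(\<Sum>j<n. U i j * V j k) = (if k = i then 1 else 0)"
proof -
  let ?d = "\<lambda>k. if k = i then 1 else 0 :: int"
  have "b' i - lin_comb n (U i) b + (lin_comb n (U i) b - lin_comb m (\<lambda>k. \<Sum>j<n. U i j * V j k) b') \<in> P"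
    using U ik by (intro frag.subspace_add[OF P] lin_comb_subst[OF P V]) auto
  then have "lin_comb m (\<lambda>k. ?d k - (\<Sum>j<n. U i j * V j k)) b' \<in> P"
    by (simp add: lin_comb_diff lin_comb_delta ik)
  from rel_basisD(3)[OF b' this ik(2)] show ?thesis by simp
qed

text \<open>If \<open>n < m\<close>, zero columns added to \<open>U\<close> and zero rows added to
  \<open>V\<close> give square matrices over a field with \<open>A * B = 1\<close>. Then
  \<open>B * A = 1\<close> as well, although row \<open>n\<close> of \<open>B\<close>
  vanishes.\<close>

lemma int_mat_right_inverse_le:
  fixes U V :: "nat \<Rightarrow> nat \<Rightarrow> int"
  assumes "\<And>i k. i < m \<Longrightarrow> k < m \<Longrightarrow> (\<Sum>j<n. U i j * V j k) = (if k = i then 1 else 0)"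
  shows "m \<le> n"
proof (rule ccontr)
  assume "\<not> m \<le> n"
  then have nm: "n < m" by simp
  define A :: "rat mat" where "A = mat m m (\<lambda>(i, j). if j < n then of_int (U i j) else 0)"
  define B :: "rat mat" where "B = mat m m (\<lambda>(j, k). if j < n then of_int (V j k) else 0)"
  have AB: "A * B = 1\<^sub>m m"
  proof (rule eq_matI)
    fix i k assume "i < dim_row (1\<^sub>m m :: rat mat)" "k < dim_col (1\<^sub>m m :: rat mat)"
    then have ik: "i < m" "k < m" by auto
    have "(A * B) $$ (i, k) =
        (\<Sum>j<m. (if j < n then of_int (U i j) else 0) * (if j < n then of_int (V j k) else 0))"
      using ik by (auto simp: A_def B_def scalar_prod_def lessThan_atLeast0)
    also have "\<dots> = (\<Sum>j<n. of_int (U i j) * of_int (V j k))"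
      using nm by (intro sum.mono_neutral_cong_right) auto
    also have "\<dots> = of_int (\<Sum>j<n. U i j * V j k)" by simp
    also have "\<dots> = 1\<^sub>m m $$ (i, k)" using ik by (subst assms) auto
    finally show "(A * B) $$ (i, k) = 1\<^sub>m m $$ (i, k)" .
  qed (auto simp: A_def B_def)
  have "B * A = 1\<^sub>m m"
    by (rule mat_mult_left_right_inverse[OF _ _ AB]) (auto simp: A_def B_def)
  moreover have "(B * A) $$ (n, n) = 0"
    using nm by (auto simp: A_def B_def scalar_prod_def)
  ultimately show False using nm by simp
qed

lemma rel_basis_card_unique:
  assumes P: "frag.subspace P" and b: "rel_basis P M n b" and b': "rel_basis P M m b'"
  shows "n = m"
proof -
  from rel_basis_coords[OF b rel_basisD(1)[OF b']]
  obtain U where "\<forall>i<m. b' i - lin_comb n (U i) b \<in> P" ..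
  note U = this[rule_format]
  from rel_basis_coords[OF b' rel_basisD(1)[OF b]]
  obtain V where "\<forall>i<n. b i - lin_comb m (V i) b' \<in> P" ..
  note V = this[rule_format]
  have "m \<le> n" by (rule int_mat_right_inverse_le[OF rel_basis_inverse_coords[OF P b' U V]])
  moreover have "n \<le> m" by (rule int_mat_right_inverse_le[OF rel_basis_inverse_coords[OF P b V U]])
  ultimately show ?thesis by simp
qed

text \<open>\<open>s\<close> is the determinant of the transition matrix, a unit of the integers. It
  is quantified before the forms \<open>g\<close>, so one sign serves for all of them and cancels
  when both arguments of a bilinear form change basis. Vanishing on \<open>P\<close> lets the forms
  descend to \<open>M / P\<close>.\<close>

lemma det_form_basis_change:
  assumes P: "frag.subspace P" and b: "rel_basis P M n b" and b': "rel_basis P M n b'"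
  shows "\<exists>s :: real. s * s = 1 \<and> (\<forall>g. (\<forall>j<n. frag_form (g j) \<and> (\<forall>x\<in>P. g j x = 0)) \<longrightarrow>
       det (mat n n (\<lambda>(i, j). g j (b' i))) = s * det (mat n n (\<lambda>(i, j). g j (b i))))"
proof -
  from rel_basis_coords[OF b rel_basisD(1)[OF b']]
  obtain U where "\<forall>i<n. b' i - lin_comb n (U i) b \<in> P" ..
  note U = this[rule_format]
  from rel_basis_coords[OF b' rel_basisD(1)[OF b]]
  obtain V where "\<forall>i<n. b i - lin_comb n (V i) b' \<in> P" ..
  note V = this[rule_format]
  define A where "A = mat n n (\<lambda>(i, j). U i j)"
  define B where "B = mat n n (\<lambda>(i, j). V i j)"
  have "A * B = 1\<^sub>m n"
    using rel_basis_inverse_coords[OF P b' U V]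
    by (intro eq_matI) (auto simp: A_def B_def scalar_prod_def lessThan_atLeast0)
  then have "det A * det B = 1"
    using det_mult[of A n B] by (simp add: A_def B_def)
  then have "det A * det A = 1"
    using zmult_eq_1_iff[of "det A" "det B"] by auto
  then have "real_of_int (det A) * real_of_int (det A) = 1"
    by (metis of_int_1 of_int_mult)
  moreover have "det (mat n n (\<lambda>(i, j). g j (b' i))) = of_int (det A) * det (mat n n (\<lambda>(i, j). g j (b i)))"
    if gg: "\<forall>j<n. frag_form (g j) \<and> (\<forall>x\<in>P. g j x = 0)" for g
  proof -
    have g0: "g j x = 0" if "j < n" "x \<in> P" for j x using gg that by auto
    have g: "frag_form (g j)" if "j < n" for j using gg that by auto
    have "g j (b' i) = (\<Sum>k<n. of_int (U i k) * g j (b k))" if "i < n" "j < n" for i j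
    proof -
      have "g j (b' i) - g j (lin_comb n (U i) b) = 0"
        using g0[OF that(2) U[OF that(1)]] by (simp add: module_hom.diff[OF g[OF that(2)]])
      then show ?thesis by (simp add: frag_form_lin_comb[OF g[OF that(2)]])
    qed
    then have "mat n n (\<lambda>(i, j). g j (b' i)) = map_mat of_int A * mat n n (\<lambda>(i, j). g j (b i))"
      by (intro eq_matI) (auto simp: A_def scalar_prod_def lessThan_atLeast0)
    also have "det \<dots> = det (map_mat of_int A) * det (mat n n (\<lambda>(i, j). g j (b i)))"
      by (rule det_mult[of _ n]) (auto simp: A_def)
    finally show ?thesis by (simp add: of_int_hom.hom_det)
  qed
  ultimately show ?thesis by (intro exI[of _ "real_of_int (det A)"]) simp
qed

section \<open>Existence of bases for subgroups of finitely generated free abelian groups\<close>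

lemma rel_basis_keys:
  assumes "finite S"
  obtains b where "rel_basis {0} {x. Poly_Mapping.keys x \<subseteq> S} (card S) b"
proof -
  obtain h where h: "bij_betw h {..<card S} S"
    using ex_bij_betw_nat_finite[OF assms] by (auto simp: lessThan_atLeast0)
  define b where "b i = frag_of (h i)" for i
  have look: "Poly_Mapping.lookup (lin_comb (card S) c b) (h i) = c i" if "i < card S" for c i
  proof -
    have "Poly_Mapping.lookup (frag_cmul (c j) (b j)) (h i) = (if i = j then c j else 0)" if "j < card S" for j
      using h that \<open>i < card S\<close> by (auto simp: bij_betw_def inj_on_def b_def)
    then have "Poly_Mapping.lookup (lin_comb (card S) c b) (h i) = (\<Sum>j<card S. if i = j then c j else 0)"
      unfolding lin_comb_def Poly_Mapping.lookup_sum by (intro sum.cong) auto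
    then show ?thesis using that by simp
  qed
  have "rel_basis {0} {x. Poly_Mapping.keys x \<subseteq> S} (card S) b"
    unfolding rel_basis_def
  proof (intro conjI ballI allI impI)
    fix i assume "i < card S"
    then show "b i \<in> {x. Poly_Mapping.keys x \<subseteq> S}"
      using h by (auto simp: b_def bij_betw_def)
  next
    fix x :: "'a \<Rightarrow>\<^sub>0 int" assume x: "x \<in> {x. Poly_Mapping.keys x \<subseteq> S}"
    let ?c = "\<lambda>i. Poly_Mapping.lookup x (h i)"
    have "x = lin_comb (card S) ?c b"
    proof (rule poly_mapping_eqI)
      fix e
      show "Poly_Mapping.lookup x e = Poly_Mapping.lookup (lin_comb (card S) ?c b) e"
      proof (cases "e \<in> S")
        case True
        then obtain i where "i < card S" "e = h i" using h by (auto simp: bij_betw_def)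
        then show ?thesis by (simp add: look)
      next
        case False
        then have "Poly_Mapping.lookup x e = 0" using x by (auto simp: in_keys_iff)
        moreover have "h i \<noteq> e" if "i < card S" for i
          using h that False by (auto simp: bij_betw_def)
        then have "Poly_Mapping.lookup (lin_comb (card S) ?c b) e = 0"
          unfolding lin_comb_def b_def Poly_Mapping.lookup_sum by (intro sum.neutral) auto
        ultimately show ?thesis by simp
      qed
    qed
    then show "\<exists>c. x - lin_comb (card S) c b \<in> {0}"
      by (intro exI[of _ ?c]) simp
  next
    fix c i assume "lin_comb (card S) c b \<in> {0}" "i < card S"
    then show "c i = 0" using look[of i c] by simp
  qed
  then show thesis by (rule that)
qed

text \<open>Independence over the reals, since positive definiteness of a Gram matrix is tested on
  real coefficient vectors.\<close>

definition real_indep :: "nat \<Rightarrow> (nat \<Rightarrow> 'a \<Rightarrow>\<^sub>0 int) \<Rightarrow> bool" where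
  "real_indep n b \<longleftrightarrow> (\<forall>v :: nat \<Rightarrow> real.
     (\<forall>e. (\<Sum>i<n. v i * of_int (Poly_Mapping.lookup (b i) e)) = 0) \<longrightarrow> (\<forall>i<n. v i = 0))"

text \<open>The coefficients at \<open>e\<close> of the elements of \<open>M\<close> form a nonzero
  ideal of the integers; division with remainder by its least positive element shows that this
  element generates it.\<close>

lemma exists_min_pos_coeff:
  assumes M: "frag.subspace M" and x: "x \<in> M" "Poly_Mapping.lookup x e \<noteq> 0"
  obtains m where "m \<in> M" "Poly_Mapping.lookup m e > 0"
    "\<And>y. y \<in> M \<Longrightarrow> Poly_Mapping.lookup m e dvd Poly_Mapping.lookup y e"
proof -
  define Q where "Q k \<longleftrightarrow> k > 0 \<and> (\<exists>y\<in>M. Poly_Mapping.lookup y e = int k)" for k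
  have "Q (nat \<bar>Poly_Mapping.lookup x e\<bar>)"
  proof (cases "Poly_Mapping.lookup x e > 0")
    case True
    then show ?thesis using x by (auto simp: Q_def)
  next
    case False
    then show ?thesis using x frag.subspace_neg[OF M x(1)] by (auto simp: Q_def intro!: bexI[of _ "- x"])
  qed
  then have "Q (Least Q)" by (rule LeastI[of Q])
  then have L: "Least Q > 0 \<and> (\<exists>y\<in>M. Poly_Mapping.lookup y e = int (Least Q))" by (subst (asm) Q_def)
  then obtain m where m: "m \<in> M" "Poly_Mapping.lookup m e = int (Least Q)" by (elim conjE bexE)
  note m = m conjunct1[OF L]
  have "int (Least Q) dvd Poly_Mapping.lookup y e" if "y \<in> M" for y
  proof (rule ccontr)
    let ?d = "int (Least Q)" let ?y = "Poly_Mapping.lookup y e"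
    assume ndvd: "\<not> ?d dvd ?y"
    have "?y mod ?d \<noteq> 0" using ndvd mod_0_imp_dvd[of ?y ?d] by blast
    moreover have "?y mod ?d \<ge> 0" using m(3) by (intro pos_mod_sign) simp
    ultimately have pos: "?y mod ?d > 0" by linarith
    have "y - frag_cmul (?y div ?d) m \<in> M"
      by (intro frag.subspace_diff[OF M] frag.subspace_scale[OF M] that m)
    moreover have "Poly_Mapping.lookup (y - frag_cmul (?y div ?d) m) e = ?y mod ?d"
      by (simp add: Poly_Mapping.lookup_minus m minus_div_mult_eq_mod)
    ultimately have "Q (nat (?y mod ?d))" using pos by (auto simp: Q_def)
    then have "Least Q \<le> nat (?y mod ?d)" by (rule Least_le[of Q])
    moreover have "?y mod ?d < ?d" using m(3) by simp
    ultimately show False using pos by linarith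
  qed
  then show thesis using m by (intro that[of m]) auto
qed

text \<open>Evaluation at one coordinate \<open>e\<close> splits \<open>M\<close> into its kernel
  \<open>N\<close>, supported on fewer coordinates, and an infinite cyclic quotient generated by the
  class of \<open>m\<close>. The basis obtained is triangular with respect to the coordinates, which
  yields independence over the reals along the way.\<close>

lemma exists_basis:
  assumes "finite S" "frag.subspace M" "\<And>x. x \<in> M \<Longrightarrow> Poly_Mapping.keys x \<subseteq> S"
  shows "\<exists>n b. rel_basis {0} M n b \<and> real_indep n b"
  using assms
proof (induction S arbitrary: M rule: finite_induct)
  case empty
  then have "M = {0}" using frag.subspace_0 by auto
  then have "rel_basis {0} M 0 (\<lambda>_. 0) \<and> real_indep 0 (\<lambda>_. 0)"
    by (auto simp: rel_basis_def real_indep_def lin_comb_def)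
  then show ?case by (intro exI)
next
  case (insert e S)
  note M = \<open>frag.subspace M\<close>
  define N where "N = {x \<in> M. Poly_Mapping.lookup x e = 0}"
  have N: "frag.subspace N"
    unfolding N_def using M
    by (intro frag.subspaceI)
      (auto simp: frag.subspace_0 frag.subspace_add frag.subspace_scale Poly_Mapping.lookup_add)
  have "Poly_Mapping.keys x \<subseteq> S" if "x \<in> N" for x
    using insert.prems(2)[of x] that by (auto simp: N_def in_keys_iff)
  from insert.IH[OF N this] obtain n b where b: "rel_basis {0} N n b" "real_indep n b" by auto
  show ?case
  proof (cases "N = M")
    case True
    then show ?thesis using b by auto
  next
    case False
    then obtain x where "x \<in> M" "Poly_Mapping.lookup x e \<noteq> 0" by (auto simp: N_def)
    from exists_min_pos_coeff[OF M this] obtain m where m: "m \<in> M" "Poly_Mapping.lookup m e > 0"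
      and dvd: "\<And>y. y \<in> M \<Longrightarrow> Poly_Mapping.lookup m e dvd Poly_Mapping.lookup y e" by auto
    have 1: "lin_comb 1 c (\<lambda>_. m) = frag_cmul (c 0) m" for c by (simp add: lin_comb_def)
    have "rel_basis N M 1 (\<lambda>_. m)"
      unfolding rel_basis_def 1
    proof (intro conjI ballI allI impI)
      fix y assume y: "y \<in> M"
      from dvd[OF y] obtain k where "Poly_Mapping.lookup y e = Poly_Mapping.lookup m e * k" ..
      then have "y - frag_cmul k m \<in> N"
        unfolding N_def using y m M
        by (auto simp: Poly_Mapping.lookup_minus intro!: frag.subspace_diff frag.subspace_scale)
      then show "\<exists>c. y - frag_cmul (c 0) m \<in> N" by (intro exI[of _ "\<lambda>_. k"])
    next
      fix c :: "nat \<Rightarrow> int" and i :: nat assume "frag_cmul (c 0) m \<in> N" "i < 1"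
      then show "c i = 0" using m by (auto simp: N_def)
    qed (use m in auto)
    from rel_basis_trans(1)[OF b(1) this N M]
    have "rel_basis {0} M (n + 1) (\<lambda>i. if i < n then b i else m)"
      using frag.subspace_0[OF N] by (auto simp: N_def)
    moreover have "real_indep (n + 1) (\<lambda>i. if i < n then b i else m)"
      unfolding real_indep_def
    proof (intro allI impI)
      fix v :: "nat \<Rightarrow> real" and i
      assume v: "\<forall>e. (\<Sum>i<n + 1. v i * of_int (Poly_Mapping.lookup (if i < n then b i else m) e)) = 0"
        and i: "i < n + 1"
      have v': "(\<Sum>i<n. v i * of_int (Poly_Mapping.lookup (b i) f)) + v n * of_int (Poly_Mapping.lookup m f) = 0" for f
        using v[rule_format, of f] by simp
      have "Poly_Mapping.lookup (b i) e = 0" if "i < n" for i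
        using rel_basisD(1)[OF b(1) that] by (simp add: N_def)
      \<comment> \<open>At the coordinate \<open>e\<close> only the new element \<open>m\<close>
        contributes.\<close>
      then have "v n = 0" using v'[of e] m by simp
      then have "\<forall>i<n. v i = 0" using v' b(2) by (simp add: real_indep_def)
      then show "v i = 0" using \<open>v n = 0\<close> i by (auto simp: less_Suc_eq)
    qed
    ultimately show ?thesis by blast
  qed
qed

section \<open>Gram determinants\<close>

text \<open>A nonzero vector in the kernel of the matrix would be a zero of the quadratic
  form.\<close>

lemma det_nonzero_of_pos_def:
  fixes G :: "nat \<Rightarrow> nat \<Rightarrow> real"
  assumes "\<And>v. \<exists>i<n. v i \<noteq> 0 \<Longrightarrow> (\<Sum>i<n. \<Sum>j<n. v i * G i j * v j) > 0"
  shows "det (mat n n (\<lambda>(i, j). G i j)) \<noteq> 0"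
proof
  assume "det (mat n n (\<lambda>(i, j). G i j)) = 0"
  then obtain v where v: "v \<in> carrier_vec n" "v \<noteq> 0\<^sub>v n" "mat n n (\<lambda>(i, j). G i j) *\<^sub>v v = 0\<^sub>v n"
    using det_0_iff_vec_prod_zero_field[of "mat n n (\<lambda>(i, j). G i j)" n] by auto
  have "(\<Sum>j<n. G i j * v $ j) = 0" if "i < n" for i
  proof -
    have "(mat n n (\<lambda>(i, j). G i j) *\<^sub>v v) $ i = 0" using v(3) that by simp
    then show ?thesis using that v(1) by (simp add: scalar_prod_def lessThan_atLeast0)
  qed
  then have "(\<Sum>i<n. v $ i * (\<Sum>j<n. G i j * v $ j)) = 0" by simp
  then have "(\<Sum>i<n. \<Sum>j<n. v $ i * G i j * v $ j) = 0"
    by (simp add: sum_distrib_left mult.assoc)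
  moreover have "\<exists>i<n. v $ i \<noteq> 0" using v(1,2) by (auto simp: vec_eq_iff)
  ultimately show False using assms[of "\<lambda>i. v $ i"] by simp
qed

text \<open>The determinant does not vanish on the segment from the identity to \<open>G\<close>.\<close>

lemma det_pos_of_pos_def:
  fixes G :: "nat \<Rightarrow> nat \<Rightarrow> real"
  assumes G: "\<And>v. \<exists>i<n. v i \<noteq> 0 \<Longrightarrow> (\<Sum>i<n. \<Sum>j<n. v i * G i j * v j) > 0"
  shows "det (mat n n (\<lambda>(i, j). G i j)) > 0"
proof (rule ccontr)
  define F where "F t i j = t * G i j + (1 - t) * (if i = j then 1 else 0)" for t :: real and i j :: nat
  define D where "D t = det (mat n n (\<lambda>(i, j). F t i j))" for t
  have "D t \<noteq> 0" if t: "0 \<le> t" "t \<le> 1" for t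
    unfolding D_def
  proof (rule det_nonzero_of_pos_def)
    fix v :: "nat \<Rightarrow> real" assume v: "\<exists>i<n. v i \<noteq> 0"
    have "(\<Sum>i<n. \<Sum>j<n. v i * F t i j * v j) =
        t * (\<Sum>i<n. \<Sum>j<n. v i * G i j * v j) + (1 - t) * (\<Sum>i<n. \<Sum>j<n. v i * (if i = j then 1 else 0) * v j)"
      by (simp add: F_def algebra_simps sum.distrib sum_distrib_left sum_subtractf)
    also have "(\<Sum>i<n. \<Sum>j<n. v i * (if i = j then 1 else 0) * v j) = (\<Sum>i<n. v i * v i)"
      by (intro sum.cong refl) (simp add: if_distrib[of "\<lambda>x. _ * x"] if_distrib[of "\<lambda>x. x * _"] cong: if_cong)
    also have "t * (\<Sum>i<n. \<Sum>j<n. v i * G i j * v j) + (1 - t) * (\<Sum>i<n. v i * v i) > 0"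
    proof (cases "t = 1")
      case False
      have "(\<Sum>i<n. v i * v i) > 0"
        using v by (auto intro!: sum_pos2 simp: zero_less_mult_iff)
      then have "(1 - t) * (\<Sum>i<n. v i * v i) > 0" using False t by simp
      moreover have "t * (\<Sum>i<n. \<Sum>j<n. v i * G i j * v j) \<ge> 0" using t G[OF v] by simp
      ultimately show ?thesis by linarith
    qed (use G[OF v] in simp)
    finally show "(\<Sum>i<n. \<Sum>j<n. v i * F t i j * v j) > 0" .
  qed
  moreover have "continuous_on {0..1} D"
    unfolding D_def det_def'[OF mat_carrier] F_def
    by (auto intro!: continuous_intros)
  moreover have "D 0 = 1"
  proof -
    have "mat n n (\<lambda>(i, j). F 0 i j) = 1\<^sub>m n" by (rule eq_matI) (auto simp: F_def)
    then show ?thesis by (simp add: D_def)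
  qed
  moreover assume "\<not> det (mat n n (\<lambda>(i, j). G i j)) > 0"
  then have "D 1 \<le> 0" by (simp add: D_def F_def)
  ultimately show False using IVT2'[of D 1 0 0] by auto
qed

text \<open>The quadratic form at \<open>v\<close> is the sum of \<open>l e * (s e)^2\<close>, where
  \<open>s\<close> is the real chain with coordinates \<open>v\<close> in the family
  \<open>b\<close>; independence over the reals makes \<open>s\<close> nonzero.\<close>

lemma gram_det_pos:
  assumes E: "finite E" "\<And>e. e \<in> E \<Longrightarrow> l e > (0 :: real)"
    and b: "\<And>i. i < n \<Longrightarrow> Poly_Mapping.keys (b i) \<subseteq> E" "real_indep n b"
  shows "det (mat n n (\<lambda>(i, j). \<Sum>e\<in>E. of_int (Poly_Mapping.lookup (b i) e) *
    of_int (Poly_Mapping.lookup (b j) e) * l e)) > 0"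
proof (rule det_pos_of_pos_def)
  fix v :: "nat \<Rightarrow> real" assume v: "\<exists>i<n. v i \<noteq> 0"
  let ?b = "\<lambda>i e. of_int (Poly_Mapping.lookup (b i) e) :: real"
  define s where "s e = (\<Sum>i<n. v i * ?b i e)" for e
  have "(\<Sum>i<n. \<Sum>j<n. v i * (\<Sum>e\<in>E. ?b i e * ?b j e * l e) * v j) =
      (\<Sum>i<n. \<Sum>j<n. \<Sum>e\<in>E. l e * ((v i * ?b i e) * (v j * ?b j e)))"
    by (simp add: sum_distrib_left sum_distrib_right mult_ac)
  also have "\<dots> = (\<Sum>i<n. \<Sum>e\<in>E. \<Sum>j<n. l e * ((v i * ?b i e) * (v j * ?b j e)))"
    by (intro sum.cong refl sum.swap)
  also have "\<dots> = (\<Sum>e\<in>E. \<Sum>i<n. \<Sum>j<n. l e * ((v i * ?b i e) * (v j * ?b j e)))"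
    by (rule sum.swap)
  also have "\<dots> = (\<Sum>e\<in>E. l e * (s e * s e))"
    unfolding s_def sum_product by (simp add: sum_distrib_left)
  finally have eq: "(\<Sum>i<n. \<Sum>j<n. v i * (\<Sum>e\<in>E. ?b i e * ?b j e * l e) * v j) = (\<Sum>e\<in>E. l e * (s e * s e))" .
  obtain e where e: "s e \<noteq> 0"
    using b(2) v unfolding real_indep_def s_def by blast
  have "e \<in> E"
  proof (rule ccontr)
    assume "e \<notin> E"
    then have "Poly_Mapping.lookup (b i) e = 0" if "i < n" for i
      using b(1)[OF that] by (auto simp: in_keys_iff)
    then show False using e by (simp add: s_def)
  qed
  have "(\<Sum>e\<in>E. l e * (s e * s e)) > 0"
  proof (rule sum_pos2[OF E(1) \<open>e \<in> E\<close>])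
    show "l e * (s e * s e) > 0" using E(2)[OF \<open>e \<in> E\<close>] e by (auto simp: zero_less_mult_iff linorder_neq_iff)
    show "l f * (s f * s f) \<ge> 0" if "f \<in> E" for f using E(2)[OF that] by simp
  qed
  then show "(\<Sum>i<n. \<Sum>j<n. v i * (\<Sum>e\<in>E. ?b i e * ?b j e * l e) * v j) > 0" by (simp only: eq)
qed

lemma det_transposed_mat: "det (mat n n (\<lambda>(i, j). f j i)) = det (mat n n (\<lambda>(i, j). f i j))"
proof -
  have "mat n n (\<lambda>(i, j). f j i) = transpose_mat (mat n n (\<lambda>(i, j). f i j))"
    by (rule eq_matI) auto
  then show ?thesis by (simp add: det_transpose[OF mat_carrier])
qed

text \<open>Rows and columns are changed separately, against an arbitrary family \<open>z\<close> on
  the other side, and each change costs the same sign. Symmetry of \<open>B\<close> supplies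
  linearity in the first argument.\<close>

lemma gram_det_basis_change:
  assumes B: "\<And>x. frag_form (B x)" "\<And>x y. B x y = B y x"
    and b: "rel_basis {0} M n b" and x: "rel_basis {0} M n x"
  obtains s :: real where "s * s = 1"
    "\<And>z. det (mat n n (\<lambda>(i, j). B (x i) (z j))) = s * det (mat n n (\<lambda>(i, j). B (b i) (z j)))"
    "\<And>z. det (mat n n (\<lambda>(i, j). B (z i) (x j))) = s * det (mat n n (\<lambda>(i, j). B (z i) (b j)))"
proof -
  from det_form_basis_change[OF frag.subspace_single_0 b x]
  obtain s :: real where s: "s * s = 1"
    and s': "\<forall>g. (\<forall>j<n. frag_form (g j) \<and> (\<forall>x\<in>{0}. g j x = 0)) \<longrightarrow>
       det (mat n n (\<lambda>(i, j). g j (x i))) = s * det (mat n n (\<lambda>(i, j). g j (b i)))" by auto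
  have 1: "det (mat n n (\<lambda>(i, j). B (z j) (x i))) = s * det (mat n n (\<lambda>(i, j). B (z j) (b i)))" for z
    by (rule s'[rule_format, of "\<lambda>j. B (z j)"]) (simp add: B(1) module_hom.zero[OF B(1)])
  have 2: "det (mat n n (\<lambda>(i, j). B (z i) (x j))) = s * det (mat n n (\<lambda>(i, j). B (z i) (b j)))" for z
    using 1[of z] unfolding det_transposed_mat[of n "\<lambda>i j. B (z i) (x j)"]
      det_transposed_mat[of n "\<lambda>i j. B (z i) (b j)"] .
  have 3: "det (mat n n (\<lambda>(i, j). B (x i) (z j))) = s * det (mat n n (\<lambda>(i, j). B (b i) (z j)))" for z
    using 1[of z] unfolding B(2)[of "z _" "x _"] B(2)[of "z _" "b _"] .
  show thesis by (rule that[OF s 3 2])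
qed

lemma gram_det_unique:
  assumes B: "\<And>x. frag_form (B x)" "\<And>x y. B x y = B y x"
    and b: "rel_basis {0} M n b" and x: "rel_basis {0} M m x"
  shows "det (mat m m (\<lambda>(i, j). B (x i) (x j))) = det (mat n n (\<lambda>(i, j). B (b i) (b j)))"
proof -
  have m: "m = n" using rel_basis_card_unique[OF frag.subspace_single_0 x b] .
  obtain s where "s * s = 1"
    "\<And>z. det (mat n n (\<lambda>(i, j). B (x i) (z j))) = s * det (mat n n (\<lambda>(i, j). B (b i) (z j)))"
    "\<And>z. det (mat n n (\<lambda>(i, j). B (z i) (x j))) = s * det (mat n n (\<lambda>(i, j). B (z i) (b j)))"
    by (rule gram_det_basis_change[where B = B, OF B b x[unfolded m]]) (rule that)
  then show ?thesis by (simp add: m flip: mult.assoc)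
qed

text \<open>Two independent changes of basis contribute two unrelated signs, so only the absolute
  value survives. This permits evaluating a Jacobian volume with different bases for the rows and
  the columns.\<close>

lemma gram_det_abs:
  assumes B: "\<And>x. frag_form (B x)" "\<And>x y. B x y = B y x"
    and b: "rel_basis {0} M n b" and x: "rel_basis {0} M n x" and y: "rel_basis {0} M n y"
  shows "\<bar>det (mat n n (\<lambda>(i, j). B (x i) (y j)))\<bar> = \<bar>det (mat n n (\<lambda>(i, j). B (b i) (b j)))\<bar>"
proof -
  have abs: "\<bar>s\<bar> = 1" if "s * s = 1" for s :: real using that by (metis abs_1 real_sqrt_abs2 real_sqrt_one)
  obtain s where s: "s * s = 1"
    "\<And>z. det (mat n n (\<lambda>(i, j). B (x i) (z j))) = s * det (mat n n (\<lambda>(i, j). B (b i) (z j)))"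
    by (rule gram_det_basis_change[where B = B, OF B b x]) (rule that)
  obtain t where t: "t * t = 1"
    "\<And>z. det (mat n n (\<lambda>(i, j). B (z i) (y j))) = t * det (mat n n (\<lambda>(i, j). B (z i) (b j)))"
    by (rule gram_det_basis_change[where B = B, OF B b y]) (rule that)
  show ?thesis by (simp add: s(2) t(2) abs_mult abs[OF s(1)] abs[OF t(1)])
qed

section \<open>Bases of quotient groups\<close>

lemma comm_group_frag:
  fixes N :: "('a \<Rightarrow>\<^sub>0 int) monoid"
  assumes N: "frag.subspace (carrier N)" "monoid.mult N = (+)" "one N = 0"
  shows "comm_group N"
proof (rule comm_groupI)
  fix x assume x: "x \<in> carrier N"
  show "\<exists>y\<in>carrier N. y \<otimes>\<^bsub>N\<^esub> x = \<one>\<^bsub>N\<^esub>"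
    using frag.subspace_neg[OF N(1) x] by (intro bexI[of _ "- x"]) (simp_all add: N)
qed (auto simp: N frag.subspace_0 frag.subspace_add add_ac)

lemma nat_pow_frag:
  fixes N :: "('a \<Rightarrow>\<^sub>0 int) monoid"
  assumes N: "monoid.mult N = (+)" "one N = 0"
  shows "x [^]\<^bsub>N\<^esub> (n :: nat) = frag_cmul (int n) x"
  by (induction n) (simp_all add: N nat_pow_def frag_cmul_distrib add.commute)

lemma inv_frag:
  fixes N :: "('a \<Rightarrow>\<^sub>0 int) monoid"
  assumes N: "frag.subspace (carrier N)" "monoid.mult N = (+)" "one N = 0" and x: "x \<in> carrier N"
  shows "inv\<^bsub>N\<^esub> x = - x"
proof -
  interpret comm_group N by (rule comm_group_frag[OF N])
  show ?thesis
    using frag.subspace_neg[OF N(1) x] x by (intro inv_equality) (simp_all add: N)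
qed

lemma int_pow_frag:
  fixes N :: "('a \<Rightarrow>\<^sub>0 int) monoid"
  assumes N: "frag.subspace (carrier N)" "monoid.mult N = (+)" "one N = 0" and x: "x \<in> carrier N"
  shows "x [^]\<^bsub>N\<^esub> (c :: int) = frag_cmul c x"
proof -
  have *: "inv\<^bsub>N\<^esub> (frag_cmul k x) = frag_cmul (- k) x" for k
    using inv_frag[OF N frag.subspace_scale[OF N(1) x]] by (simp only: minus_frag_cmul)
  show ?thesis
    by (subst int_pow_def2) (cases "c < 0", simp_all only: nat_pow_frag[OF N(2,3)] * if_True if_False, simp_all)
qed

lemma subgroup_frag:
  fixes N :: "('a \<Rightarrow>\<^sub>0 int) monoid"
  assumes N: "frag.subspace (carrier N)" "monoid.mult N = (+)" "one N = 0"
    and S: "frag.subspace S" "S \<subseteq> carrier N"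
  shows "subgroup S N"
proof -
  interpret comm_group N by (rule comm_group_frag[OF N])
  show ?thesis
  proof (rule subgroupI)
    show "S \<noteq> {}" using frag.subspace_0[OF S(1)] by auto
    show "inv\<^bsub>N\<^esub> x \<in> S" if "x \<in> S" for x
      using inv_frag[OF N subsetD[OF S(2) that]] frag.subspace_neg[OF S(1) that] by (simp only:)
    show "x \<otimes>\<^bsub>N\<^esub> y \<in> S" if "x \<in> S" "y \<in> S" for x y
      using frag.subspace_add[OF S(1) that] by (simp add: N)
  qed (rule S(2))
qed

lemma hom_frag_eq_iff:
  fixes N :: "('a \<Rightarrow>\<^sub>0 int) monoid" and K :: "'b monoid"
  assumes N: "frag.subspace (carrier N)" "monoid.mult N = (+)" "one N = 0"
    and K: "group K" and q: "q \<in> hom N K" and xy: "x \<in> carrier N" "y \<in> carrier N"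
  shows "q x = q y \<longleftrightarrow> q (x - y) = \<one>\<^bsub>K\<^esub>"
proof -
  interpret N: comm_group N by (rule comm_group_frag[OF N])
  interpret K: group K by (rule K)
  interpret q: group_hom N K q using q by unfold_locales
  have d: "x - y \<in> carrier N" using frag.subspace_diff[OF N(1)] xy by auto
  have "q x = q (x - y) \<otimes>\<^bsub>K\<^esub> q y"
    using q.hom_mult[OF d xy(2)] by (simp add: N)
  then show ?thesis using xy d by (simp add: K.r_cancel_one)
qed

text \<open>Bridge from the group-theoretic notion to representatives: \<open>q\<close> identifies
  \<open>K\<close> with the quotient of \<open>N\<close> by \<open>P\<close>, and the
  \<open>b i\<close> lift the \<open>\<kappa> i\<close>.\<close>

lemma zbasis_iff_rel_basis:
  fixes N :: "('a \<Rightarrow>\<^sub>0 int) monoid" and K :: "'b monoid"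
  assumes N: "frag.subspace (carrier N)" "monoid.mult N = (+)" "one N = 0"
    and K: "comm_group K" and q: "q \<in> hom N K" "q ` carrier N = carrier K"
    and P: "\<And>x. x \<in> carrier N \<Longrightarrow> q x = \<one>\<^bsub>K\<^esub> \<longleftrightarrow> x \<in> P"
    and b: "\<And>i. i < n \<Longrightarrow> b i \<in> carrier N" "\<And>i. i < n \<Longrightarrow> q (b i) = \<kappa> i"
  shows "zbasis K n \<kappa> \<longleftrightarrow> rel_basis P (carrier N) n b"
proof -
  interpret N: comm_group N by (rule comm_group_frag[OF N])
  interpret K: comm_group K by (rule K)
  interpret q: group_hom N K q using q by unfold_locales
  have mem: "lin_comb m c b \<in> carrier N" if "m \<le> n" for c m
    using lin_comb_mem[OF N(1)] b(1) that by auto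
  have \<kappa>': "\<kappa> i \<in> carrier K" if "i < n" for i
    unfolding b(2)[OF that, symmetric] by (rule q.hom_closed[OF b(1)[OF that]])
  have qlin: "q (lin_comb m c b) = (\<Otimes>\<^bsub>K\<^esub>i\<in>{..<m}. \<kappa> i [^]\<^bsub>K\<^esub> c i)" if "m \<le> n" for c m
    using that
  proof (induction m)
    case 0
    then show ?case using q.hom_one by (simp add: lin_comb_def N)
  next
    case (Suc m)
    have "lin_comb (Suc m) c b = b m [^]\<^bsub>N\<^esub> c m \<otimes>\<^bsub>N\<^esub> lin_comb m c b"
      using Suc.prems b(1)[of m] by (simp add: lin_comb_def N int_pow_frag[OF N] add.commute)
    then have "q (lin_comb (Suc m) c b) = \<kappa> m [^]\<^bsub>K\<^esub> c m \<otimes>\<^bsub>K\<^esub> q (lin_comb m c b)"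
      using Suc.prems b[of m] mem[of m c] by (simp add: q.hom_int_pow)
    then show ?case
      using Suc \<kappa>' by (simp add: lessThan_Suc Pi_def)
  qed
  have diff: "q x = q y \<longleftrightarrow> x - y \<in> P" if "x \<in> carrier N" "y \<in> carrier N" for x y
    using hom_frag_eq_iff[OF N K.is_group q(1) that] P[OF frag.subspace_diff[OF N(1) that]] by simp
  have \<kappa>: "\<kappa> \<in> {..<n} \<rightarrow> carrier K" using \<kappa>' by auto
  show ?thesis
  proof
    assume "zbasis K n \<kappa>"
    then have z: "\<forall>y\<in>carrier K. \<exists>!c. c \<in> {..<n} \<rightarrow>\<^sub>E (UNIV :: int set) \<and> y = q (lin_comb n c b)"
      unfolding zbasis_def qlin[OF order_refl, symmetric] by (rule conjunct2)
    show "rel_basis P (carrier N) n b"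
      unfolding rel_basis_def
    proof (intro conjI ballI allI impI)
      fix x assume x: "x \<in> carrier N"
      then have "q x \<in> carrier K" by simp
      from bspec[OF z this] obtain c where "q x = q (lin_comb n c b)" by (elim ex1E conjE)
      then show "\<exists>c. x - lin_comb n c b \<in> P" using diff[OF x mem] by auto
    next
      fix c i assume c: "lin_comb n c b \<in> P" and i: "i < n"
      \<comment> \<open>\<open>zbasis\<close> has unique coordinates only among extensional
        functions, so \<open>c\<close> and the zero function are restricted before they are
        compared.\<close>
      let ?c = "restrict c {..<n}" let ?z = "restrict (\<lambda>_. 0) {..<n} :: nat \<Rightarrow> int"
      have eq: "lin_comb n ?c b = lin_comb n c b" "lin_comb n ?z b = 0"
        by (simp_all add: lin_comb_def)
      have q1: "q (lin_comb n ?c b) = \<one>\<^bsub>K\<^esub>" using P[OF mem] c eq by simp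
      have q2: "q (lin_comb n ?z b) = \<one>\<^bsub>K\<^esub>" using eq q.hom_one N by simp
      have "\<exists>!c. c \<in> {..<n} \<rightarrow>\<^sub>E (UNIV :: int set) \<and> \<one>\<^bsub>K\<^esub> = q (lin_comb n c b)"
        by (rule bspec[OF z K.one_closed])
      then obtain d where d: "\<forall>c. c \<in> {..<n} \<rightarrow>\<^sub>E (UNIV :: int set) \<and> \<one>\<^bsub>K\<^esub> = q (lin_comb n c b) \<longrightarrow> c = d"
        by (elim ex1E)
      have "?c = d" by (rule d[rule_format]) (use q1 in simp)
      moreover have "?z = d" by (rule d[rule_format]) (use q2 in simp)
      ultimately have "?c = ?z" by simp
      then have "?c i = ?z i" by simp
      then show "c i = 0" using i by simp
    qed (use b in auto)
  next
    assume r: "rel_basis P (carrier N) n b"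
    show "zbasis K n \<kappa>"
      unfolding zbasis_def qlin[OF order_refl, symmetric]
    proof (intro conjI ballI \<kappa>)
      fix y assume "y \<in> carrier K"
      then obtain x where x: "x \<in> carrier N" "y = q x" using q(2) by auto
      obtain c where c: "x - lin_comb n c b \<in> P" using rel_basisD(2)[OF r x(1)] ..
      show "\<exists>!c. c \<in> {..<n} \<rightarrow>\<^sub>E (UNIV :: int set) \<and> y = q (lin_comb n c b)"
      proof (rule ex1I[of _ "restrict c {..<n}"])
        have "lin_comb n (restrict c {..<n}) b = lin_comb n c b" by (simp add: lin_comb_def)
        then show "restrict c {..<n} \<in> {..<n} \<rightarrow>\<^sub>E UNIV \<and> y = q (lin_comb n (restrict c {..<n}) b)"
          using c x diff[OF x(1) mem] by simp
      next
        fix d assume d: "d \<in> {..<n} \<rightarrow>\<^sub>E (UNIV :: int set) \<and> y = q (lin_comb n d b)"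
        then have "q x = q (lin_comb n d b)" using x(2) by simp
        moreover have "q x = q (lin_comb n c b)" using diff[OF x(1) mem[OF order_refl]] c by simp
        ultimately have "q (lin_comb n d b) = q (lin_comb n c b)" by simp
        then have "lin_comb n (\<lambda>i. d i - c i) b \<in> P" using diff[OF mem mem] by (simp add: lin_comb_diff)
        then have "d i = c i" if "i < n" for i using rel_basisD(3)[OF r _ that] by fastforce
        then show "d = restrict c {..<n}"
          using d by (intro extensionalityI[of _ "{..<n}"]) (auto simp: PiE_def)
      qed
    qed
  qed
qed

lemma zbasis_frag_iff:
  fixes N :: "('a \<Rightarrow>\<^sub>0 int) monoid"
  assumes N: "frag.subspace (carrier N)" "monoid.mult N = (+)" "one N = 0"
  shows "zbasis N n b \<longleftrightarrow> rel_basis {0} (carrier N) n b"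
proof (cases "\<forall>i<n. b i \<in> carrier N")
  case True
  then show ?thesis
    by (intro zbasis_iff_rel_basis[OF N comm_group_frag[OF N], of "\<lambda>x. x"]) (auto simp: hom_def N)
next
  case False
  then show ?thesis by (auto simp: zbasis_def rel_basis_def)
qed

section \<open>The torsion-free part of a quotient group\<close>

lemma (in comm_group) subgroup_torsion: "subgroup (torsion G) G"
proof (rule subgroupI)
  show "torsion G \<subseteq> carrier G" by (auto simp: torsion_def)
  have "\<one> \<in> torsion G" unfolding torsion_def by (auto intro!: exI[of _ 1])
  then show "torsion G \<noteq> {}" by auto
next
  fix x assume "x \<in> torsion G"
  then show "inv x \<in> torsion G" unfolding torsion_def by (auto simp: nat_pow_inv)
next
  fix x y assume "x \<in> torsion G" "y \<in> torsion G"
  then obtain n m :: nat where x: "x \<in> carrier G" "n > 0" "x [^] n = \<one>"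
    and y: "y \<in> carrier G" "m > 0" "y [^] m = \<one>"
    unfolding torsion_def mem_Collect_eq by (elim conjE exE)
  have "x [^] (n * m) = \<one>" by (subst nat_pow_pow[symmetric, OF x(1)]) (simp add: x(3))
  moreover have "y [^] (n * m) = \<one>"
    by (subst mult.commute, subst nat_pow_pow[symmetric, OF y(1)]) (simp add: y(3))
  ultimately have "(x \<otimes> y) [^] (n * m) = \<one>" using x y by (simp add: nat_pow_distrib)
  then have "\<exists>k::nat. k > 0 \<and> (x \<otimes> y) [^] k = \<one>" using x y by (intro exI[of _ "n * m"]) simp
  then show "x \<otimes> y \<in> torsion G" using x y by (simp add: torsion_def)
qed

context
  fixes N :: "'a monoid" and S :: "'a set"
  assumes N: "comm_group N" and S: "subgroup S N"
begin

text \<open>The composite of the two projections, spelled out as a coset of cosets so that its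
  values lie literally in the carrier used by \<open>prym_K\<close>.\<close>

definition tf_proj :: "'a \<Rightarrow> 'a set set" where
  "tf_proj x = torsion (N Mod S) #>\<^bsub>N Mod S\<^esub> (S #>\<^bsub>N\<^esub> x)"

text \<open>The iterated quotient is replaced by a surjection whose kernel is the saturation of
  \<open>S\<close>. The last item identifies \<open>\<Union>\<kappa>\<close> with the fibre over
  \<open>\<kappa>\<close>, the set from which \<open>prym_pairing\<close> takes
  representatives.\<close>

lemma tf_quotient:
  shows "comm_group (N Mod S Mod torsion (N Mod S))"
    and "tf_proj \<in> hom N (N Mod S Mod torsion (N Mod S))"
    and "tf_proj ` carrier N = carrier (N Mod S Mod torsion (N Mod S))"
    and "x \<in> carrier N \<Longrightarrow> tf_proj x = \<one>\<^bsub>N Mod S Mod torsion (N Mod S)\<^esub> \<longleftrightarrow> (\<exists>n::nat. n > 0 \<and> x [^]\<^bsub>N\<^esub> n \<in> S)"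
    and "\<kappa> \<in> carrier (N Mod S Mod torsion (N Mod S)) \<Longrightarrow> x \<in> \<Union>\<kappa> \<longleftrightarrow> x \<in> carrier N \<and> tf_proj x = \<kappa>"
proof -
  interpret N: comm_group N by (rule N)
  interpret S: normal S N using S N.subgroup_imp_normal by blast
  define C where "C = N Mod S"
  interpret C: comm_group C unfolding C_def by (rule N.abelian_FactGroup[OF S])
  note T = C.subgroup_torsion
  interpret T: normal "torsion C" C using T C.subgroup_imp_normal by blast
  have hC: "(\<lambda>x. S #>\<^bsub>N\<^esub> x) \<in> hom N C" unfolding C_def by (rule S.r_coset_hom_Mod)
  have carrC: "carrier C = (\<lambda>x. S #>\<^bsub>N\<^esub> x) ` carrier N" by (simp add: C_def carrier_FactGroup)
  have oneC: "\<one>\<^bsub>C\<^esub> = S" by (simp add: C_def)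
  have inC: "S #>\<^bsub>N\<^esub> x \<in> carrier C" if "x \<in> carrier N" for x using that by (simp add: carrC)
  show "comm_group (N Mod S Mod torsion (N Mod S))"
    using C.abelian_FactGroup[OF T] by (simp add: C_def)
  show "tf_proj \<in> hom N (N Mod S Mod torsion (N Mod S))"
    using hom_compose[OF hC T.r_coset_hom_Mod] by (simp add: C_def tf_proj_def[abs_def] comp_def)
  show im: "tf_proj ` carrier N = carrier (N Mod S Mod torsion (N Mod S))"
    by (simp add: tf_proj_def[abs_def] carrier_FactGroup image_image)
  show "tf_proj x = \<one>\<^bsub>N Mod S Mod torsion (N Mod S)\<^esub> \<longleftrightarrow> (\<exists>n::nat. n > 0 \<and> x [^]\<^bsub>N\<^esub> n \<in> S)"
    if x: "x \<in> carrier N" for x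
  proof -
    have pow: "(S #>\<^bsub>N\<^esub> x) [^]\<^bsub>C\<^esub> n = S \<longleftrightarrow> x [^]\<^bsub>N\<^esub> n \<in> S" for n :: nat
    proof -
      have cl: "x [^]\<^bsub>N\<^esub> n \<in> carrier N" using x by simp
      have "(S #>\<^bsub>N\<^esub> x) [^]\<^bsub>C\<^esub> n = S #>\<^bsub>N\<^esub> (x [^]\<^bsub>N\<^esub> n)"
        by (rule hom_nat_pow[OF hC x N.is_group C.is_group, symmetric])
      then show ?thesis
        using N.coset_join1[OF _ cl S] N.coset_join2[OF cl S] by argo
    qed
    have "tf_proj x = \<one>\<^bsub>N Mod S Mod torsion (N Mod S)\<^esub> \<longleftrightarrow> S #>\<^bsub>N\<^esub> x \<in> torsion C"
      using C.coset_join1[OF _ inC[OF x] T] C.coset_join2[OF inC[OF x] T] by (auto simp: C_def tf_proj_def)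
    also have "\<dots> \<longleftrightarrow> (\<exists>n::nat. n > 0 \<and> (S #>\<^bsub>N\<^esub> x) [^]\<^bsub>C\<^esub> n = S)"
      unfolding torsion_def mem_Collect_eq oneC using inC[OF x] by (simp only: simp_thms)
    also have "\<dots> \<longleftrightarrow> (\<exists>n::nat. n > 0 \<and> x [^]\<^bsub>N\<^esub> n \<in> S)"
      by (simp only: pow)
    finally show ?thesis .
  qed
  show "x \<in> \<Union>\<kappa> \<longleftrightarrow> x \<in> carrier N \<and> tf_proj x = \<kappa>"
    if \<kappa>: "\<kappa> \<in> carrier (N Mod S Mod torsion (N Mod S))" for \<kappa> x
  proof
    assume "x \<in> carrier N \<and> tf_proj x = \<kappa>"
    then have x: "x \<in> carrier N" "tf_proj x = \<kappa>" by auto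
    have "x \<in> S #>\<^bsub>N\<^esub> x" by (rule N.rcos_self[OF x(1) S])
    moreover have "S #>\<^bsub>N\<^esub> x \<in> tf_proj x"
      unfolding tf_proj_def using C.rcos_self[OF inC[OF x(1)] T] by (simp add: C_def)
    ultimately show "x \<in> \<Union>\<kappa>" using x by blast
  next
    assume "x \<in> \<Union>\<kappa>"
    then obtain c' where c': "x \<in> c'" "c' \<in> \<kappa>" by blast
    have "\<kappa> \<in> tf_proj ` carrier N" using \<kappa> im by simp
    then obtain y where y: "y \<in> carrier N" "\<kappa> = torsion C #>\<^bsub>C\<^esub> (S #>\<^bsub>N\<^esub> y)"
      unfolding tf_proj_def C_def by (elim imageE)
    have "c' \<in> carrier C"
      using c'(2) C.r_coset_subset_G[OF T.subset inC[OF y(1)]] y(2) by blast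
    then obtain z where z: "z \<in> carrier N" "c' = S #>\<^bsub>N\<^esub> z" by (auto simp: carrC)
    have x: "x \<in> carrier N" using c' z N.r_coset_subset_G[OF S.subset z(1)] by blast
    have "S #>\<^bsub>N\<^esub> x = c'" using N.repr_independence[OF _ z(1) S] c' z by simp
    moreover have "torsion C #>\<^bsub>C\<^esub> c' = \<kappa>"
      using C.repr_independence[OF _ inC[OF y(1)] T] c' y by simp
    ultimately show "x \<in> carrier N \<and> tf_proj x = \<kappa>" using x by (simp add: tf_proj_def C_def)
  qed
qed

end

section \<open>Homology of oriented graphs\<close>

abbreviation frag_on :: "'a set \<Rightarrow> ('a \<Rightarrow>\<^sub>0 int) set" where
  "frag_on S \<equiv> {x. Poly_Mapping.keys x \<subseteq> S}"

lemma subspace_frag_on: "frag.subspace (frag_on S)"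
  by (rule frag.subspaceI) (auto dest: subsetD[OF keys_add])

lemma frag_extend_in_subspace:
  assumes "frag.subspace M" "Poly_Mapping.keys x \<subseteq> S" "\<And>a. a \<in> S \<Longrightarrow> f a \<in> M"
  shows "frag_extend f x \<in> M"
  unfolding frag_extend_def using assms
  by (intro frag.subspace_sum frag.subspace_scale) auto

lemma frag_hom_eqI:
  assumes f: "frag_hom f" and g: "frag_hom g" and x: "Poly_Mapping.keys x \<subseteq> S"
    and eq: "\<And>a. a \<in> S \<Longrightarrow> f (frag_of a) = g (frag_of a)"
  shows "f x = g x"
  using x
  by (induction x rule: frag_induction)
    (simp_all add: module_hom.zero[OF f] module_hom.zero[OF g] module_hom.diff[OF f] module_hom.diff[OF g] eq)

lemma frag_hom_compose: "frag_hom f \<Longrightarrow> frag_hom g \<Longrightarrow> frag_hom (\<lambda>x. g (f x))"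
  using module_hom_compose[of frag_cmul frag_cmul f frag_cmul g] by (simp add: comp_def)

lemma frag_hom_sub: "frag_hom f \<Longrightarrow> frag_hom g \<Longrightarrow> frag_hom (\<lambda>x. f x - g x)"
  by (simp add: module_hom_iff frag.scale_right_diff_distrib)

lemma frag_hom_zero: "frag_hom (\<lambda>x. 0)"
  by (simp add: module_hom_iff frag.module_axioms)

text \<open>
  Weaker than a metric graph with an orientation, so as to cover the dilation subgraph: there may be
  no vertices, and \<open>A\<close> may contain half-edges outside of \<open>halfs G\<close>.
\<close>

locale oriented_graph =
  fixes G :: "('v, 'h) mgraph" and A :: "'h set"
  assumes finite_verts: "finite (verts G)" and finite_halfs: "finite (halfs G)"
    and root_in: "h \<in> halfs G \<Longrightarrow> hroot G h \<in> verts G"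
    and inv_in: "h \<in> halfs G \<Longrightarrow> hinv G h \<in> halfs G"
    and inv_inv: "h \<in> halfs G \<Longrightarrow> hinv G (hinv G h) = h"
    and orient: "h \<in> halfs G \<Longrightarrow> h \<in> A \<longleftrightarrow> hinv G h \<notin> A"
begin

abbreviation "bd \<equiv> boundary G A"

text \<open>The edge of \<open>h\<close> traversed away from the root of \<open>h\<close>. The sign
  compensates for the orientation, so that \<open>bd_dart\<close> holds for both half-edges of an
  edge and chains can follow paths.\<close>

definition dart :: "'h \<Rightarrow> 'h set \<Rightarrow>\<^sub>0 int" where
  "dart h = frag_cmul (if h \<in> A then 1 else -1) (frag_of (edge_of G h))"

lemma finite_edges: "finite (edges G)"
  by (simp add: edges_def finite_halfs)

lemma edge_of_inv: "h \<in> halfs G \<Longrightarrow> edge_of G (hinv G h) = edge_of G h"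
  by (auto simp: edge_of_def inv_inv)

lemma edge_of_in: "h \<in> halfs G \<Longrightarrow> edge_of G h \<in> edges G"
  by (auto simp: edges_def)

lemma edgeE:
  assumes "e \<in> edges G"
  obtains h where "h \<in> halfs G" "h \<in> A" "e = edge_of G h"
proof -
  obtain h where h: "h \<in> halfs G" "e = edge_of G h" using assms by (auto simp: edges_def)
  show thesis
  proof (cases "h \<in> A")
    case True
    then show ?thesis using h that by blast
  next
    case False
    then show ?thesis using h orient[OF h(1)] by (intro that[of "hinv G h"]) (auto simp: inv_in edge_of_inv)
  qed
qed

lemma source_edge_of: "h \<in> halfs G \<Longrightarrow> h \<in> A \<Longrightarrow> source G A (edge_of G h) = hroot G h"
  unfolding source_def edge_of_def using orient[of h]
  by (intro arg_cong[of _ _ "hroot G"] the_equality) auto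

lemma target_edge_of: "h \<in> halfs G \<Longrightarrow> h \<in> A \<Longrightarrow> target G A (edge_of G h) = hroot G (hinv G h)"
  unfolding target_def edge_of_def using orient[of h]
  by (intro arg_cong[of _ _ "hroot G"] the_equality) auto

lemma frag_hom_bd: "frag_hom bd"
  by (simp add: boundary_def[abs_def])

lemma bd_dart:
  assumes h: "h \<in> halfs G"
  shows "bd (dart h) = frag_of (hroot G (hinv G h)) - frag_of (hroot G h)"
proof (cases "h \<in> A")
  case True
  then show ?thesis using h by (simp add: dart_def boundary_def source_edge_of target_edge_of)
next
  case False
  have 1: "edge_of G h = edge_of G (hinv G h)" using edge_of_inv[OF h] by simp
  have 2: "hinv G h \<in> halfs G" "hinv G h \<in> A" using False orient[OF h] inv_in[OF h] by auto
  have "bd (dart h) = - bd (frag_of (edge_of G h))"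
    using False by (simp add: dart_def module_hom.neg[OF frag_hom_bd])
  also have "\<dots> = frag_of (hroot G (hinv G h)) - frag_of (hroot G h)"
    unfolding 1 using 2 h by (simp add: boundary_def source_edge_of target_edge_of inv_inv)
  finally show ?thesis .
qed

lemma keys_dart: "h \<in> halfs G \<Longrightarrow> Poly_Mapping.keys (dart h) \<subseteq> edges G"
  by (auto simp: dart_def edge_of_in)

lemma bd_in: 
  assumes "Poly_Mapping.keys x \<subseteq> edges G"
  shows "Poly_Mapping.keys (bd x) \<subseteq> verts G"
proof -
  have "bd x \<in> frag_on (verts G)"
    unfolding boundary_def
  proof (rule frag_extend_in_subspace[OF subspace_frag_on assms])
    fix e assume "e \<in> edges G"
    then obtain h where h: "h \<in> halfs G" "h \<in> A" "e = edge_of G h" by (rule edgeE)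
    have "frag_of (hroot G (hinv G h)) - frag_of (hroot G h) \<in> frag_on (verts G)"
      using h by (intro frag.subspace_diff[OF subspace_frag_on]) (auto simp: root_in inv_in)
    then show "frag_of (target G A e) - frag_of (source G A e) \<in> frag_on (verts G)"
      using h by (simp only: source_edge_of target_edge_of)
  qed
  then show ?thesis by simp
qed

abbreviation "cycles \<equiv> {x. Poly_Mapping.keys x \<subseteq> edges G \<and> bd x = 0}"

lemma subspace_cycles: "frag.subspace cycles"
proof -
  have "cycles = frag_on (edges G) \<inter> {x. bd x = 0}" by auto
  then show ?thesis
    using frag.subspace_inter[OF subspace_frag_on module_hom.subspace_kernel[OF frag_hom_bd]] by simp
qed

lemma carrier_H1: "carrier (H1 G A) = cycles"
  by (auto simp: H1_def kernel_def)

lemma mult_H1: "monoid.mult (H1 G A) = (+)"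
  by (simp add: H1_def free_Abelian_group_def)

lemma one_H1: "one (H1 G A) = 0"
  by (simp add: H1_def)

lemma H1_group:
  shows "frag.subspace (carrier (H1 G A))" "monoid.mult (H1 G A) = (+)" "one (H1 G A) = 0"
  using subspace_cycles by (simp_all only: carrier_H1 mult_H1 one_H1)

lemma zbasis_H1_iff: "zbasis (H1 G A) n b \<longleftrightarrow> rel_basis {0} cycles n b"
  using zbasis_frag_iff[OF H1_group] by (simp only: carrier_H1)

section \<open>Connected components, exactness at the vertices and the Betti number\<close>

definition steps :: "('v \<times> 'v) set" where
  "steps = {(hroot G h, hroot G (hinv G h)) | h. h \<in> halfs G}"

lemma sym_steps: "sym steps"
proof (rule symI)
  fix u v assume "(u, v) \<in> steps"
  then obtain h where "h \<in> halfs G" "u = hroot G h" "v = hroot G (hinv G h)" by (auto simp: steps_def)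
  then show "(v, u) \<in> steps"
    unfolding steps_def by (auto simp: inv_in inv_inv intro!: exI[of _ "hinv G h"])
qed

lemma connection_eq: "connection G = steps\<^sup>* \<inter> verts G \<times> verts G"
  by (simp add: connection_def steps_def)

lemma equiv_connection: "equiv (verts G) (connection G)"
  unfolding connection_eq
proof (rule equivI)
  show "sym (steps\<^sup>* \<inter> verts G \<times> verts G)"
    using sym_rtrancl[OF sym_steps] by (auto simp: sym_def)
  show "trans (steps\<^sup>* \<inter> verts G \<times> verts G)"
    by (rule transI) (auto intro: rtrancl_trans)
qed (auto simp: refl_on_def)

lemma path_chain:
  assumes "(u, v) \<in> connection G"
  shows "\<exists>x. Poly_Mapping.keys x \<subseteq> edges G \<and> bd x = frag_of v - frag_of u"
proof -
  have "(u, v) \<in> steps\<^sup>*" using assms by (simp add: connection_eq)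
  then show ?thesis
  proof (induction rule: rtrancl_induct)
    case base
    then show ?case by (intro exI[of _ 0]) (simp add: module_hom.zero[OF frag_hom_bd])
  next
    case (step v w)
    then obtain x where x: "Poly_Mapping.keys x \<subseteq> edges G" "bd x = frag_of v - frag_of u" by auto
    obtain h where h: "h \<in> halfs G" "v = hroot G h" "w = hroot G (hinv G h)"
      using step.hyps(2) by (auto simp: steps_def)
    have "x + dart h \<in> frag_on (edges G)"
      using x keys_dart[OF h(1)] by (intro frag.subspace_add[OF subspace_frag_on]) auto
    moreover have "bd (x + dart h) = frag_of w - frag_of u"
      using x bd_dart[OF h(1)] h by (simp add: module_hom.add[OF frag_hom_bd])
    ultimately show ?case by (intro exI[of _ "x + dart h"]) simp
  qed
qed

definition comp_of :: "'v \<Rightarrow> 'v set" where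
  "comp_of v = connection G `` {v}"

text \<open>The projection of 0-chains onto H_0, realised as the free abelian group on the
  components.\<close>

definition aug :: "('v \<Rightarrow>\<^sub>0 int) \<Rightarrow> ('v set \<Rightarrow>\<^sub>0 int)" where
  "aug = frag_extend (frag_of \<circ> comp_of)"

lemma components_eq: "components G = comp_of ` verts G"
  by (auto simp: components_def quotient_def comp_of_def)

lemma frag_hom_aug: "frag_hom aug"
  by (simp add: aug_def)

lemma aug_bd:
  assumes "Poly_Mapping.keys x \<subseteq> edges G"
  shows "aug (bd x) = 0"
proof (rule frag_hom_eqI[OF frag_hom_compose[OF frag_hom_bd frag_hom_aug] frag_hom_zero assms])
  fix e assume "e \<in> edges G"
  then obtain h where h: "h \<in> halfs G" "h \<in> A" "e = edge_of G h" by (rule edgeE)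
  have "(hroot G h, hroot G (hinv G h)) \<in> connection G"
    using h by (auto simp: connection_eq steps_def root_in inv_in)
  then have "comp_of (hroot G h) = comp_of (hroot G (hinv G h))"
    unfolding comp_of_def by (rule equiv_class_eq[OF equiv_connection])
  then show "aug (bd (frag_of e)) = 0"
    using h by (simp add: boundary_def source_edge_of target_edge_of aug_def frag_extend_diff)
qed

text \<open>A representative \<open>r\<close> of each component and a path chain \<open>f v\<close>
  from it to each vertex give a contracting homotopy: the boundary of \<open>f\<close> applied to
  \<open>w\<close> is \<open>w\<close> minus the sum of representatives prescribed by
  \<open>aug w\<close>.\<close>

lemma aug_eq_0_imp_bd:
  assumes w: "Poly_Mapping.keys w \<subseteq> verts G" and 0: "aug w = 0"
  shows "\<exists>x. Poly_Mapping.keys x \<subseteq> edges G \<and> bd x = w"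
proof -
  define r where "r c = (SOME v. v \<in> c)" for c :: "'v set"
  define f where "f v = (SOME x. Poly_Mapping.keys x \<subseteq> edges G \<and> bd x = frag_of v - frag_of (r (comp_of v)))" for v
  have f: "Poly_Mapping.keys (f v) \<subseteq> edges G \<and> bd (f v) = frag_of v - frag_of (r (comp_of v))"
    if v: "v \<in> verts G" for v
  proof -
    have "v \<in> comp_of v"
      unfolding comp_of_def by (rule equiv_class_self[OF equiv_connection v])
    then have "r (comp_of v) \<in> comp_of v" unfolding r_def by (rule someI)
    then have "(r (comp_of v), v) \<in> connection G"
      using equiv_connection by (auto simp: comp_of_def equiv_def dest: symD)
    then show ?thesis unfolding f_def by (rule someI_ex[OF path_chain])
  qed
  have "frag_extend f w \<in> frag_on (edges G)"
    using f by (intro frag_extend_in_subspace[OF subspace_frag_on w]) auto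
  moreover have "bd (frag_extend f w) = w"
  proof -
    have "bd (frag_extend f w) = w - frag_extend (frag_of \<circ> r) (aug w)"
      by (rule frag_hom_eqI[OF frag_hom_compose[OF frag_hom_extend frag_hom_bd]
            frag_hom_sub[OF frag.module_hom_ident frag_hom_compose[OF frag_hom_aug frag_hom_extend]] w])
        (simp add: f aug_def)
    then show ?thesis by (simp add: 0)
  qed
  ultimately show ?thesis by auto
qed

text \<open>\<open>aug\<close> embeds the cokernel of \<open>bd\<close> on 0-chains into a free
  group, which has no 2-torsion.\<close>

lemma bd_halve:
  assumes "Poly_Mapping.keys x \<subseteq> edges G" "bd x = frag_cmul 2 w"
  shows "\<exists>y. Poly_Mapping.keys y \<subseteq> edges G \<and> bd y = w"
proof (rule aug_eq_0_imp_bd)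
  have "Poly_Mapping.keys (frag_cmul 2 w) \<subseteq> verts G" using bd_in[OF assms(1)] assms(2) by simp
  then show "Poly_Mapping.keys w \<subseteq> verts G" by auto
  have "frag_cmul 2 (aug w) = 0"
    using aug_bd[OF assms(1)] assms(2) by (simp add: module_hom.scale[OF frag_hom_aug])
  then show "aug w = 0" by simp
qed

text \<open>The boundary group \<open>N\<close> has rank \<open>k\<close>. The chains on edges are
  an extension of \<open>N\<close> by the cycles, the chains on vertices an extension of the free
  group on components by \<open>N\<close>; eliminating \<open>k\<close> from the two rank formulas
  gives the claim.\<close>

lemma betti:
  assumes "rel_basis {0} cycles r b"
  shows "r + card (verts G) = card (edges G) + card (components G)"
proof -
  define N where "N = bd ` frag_on (edges G)"
  have N: "frag.subspace N" unfolding N_def by (rule module_hom.subspace_image[OF frag_hom_bd subspace_frag_on])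
  have NV: "Poly_Mapping.keys w \<subseteq> verts G" if "w \<in> N" for w using that bd_in by (auto simp: N_def)
  from exists_basis[OF finite_verts N NV] obtain k d where d: "rel_basis {0} N k d" by auto
  have ker_bd: "bd x = 0 \<longleftrightarrow> x \<in> cycles" if "x \<in> frag_on (edges G)" for x using that by auto
  obtain c where c: "rel_basis cycles (frag_on (edges G)) k c"
    by (rule exists_rel_basis_hom[OF frag_hom_bd ker_bd subspace_frag_on d[unfolded N_def]]) (assumption | rule that)+
  obtain bE where bE: "rel_basis {0} (frag_on (edges G)) (card (edges G)) bE"
    by (rule rel_basis_keys[OF finite_edges])
  have "rel_basis {0} (frag_on (edges G)) (r + k) (\<lambda>i. if i < r then b i else c (i - r))"
    by (rule rel_basis_trans(1)[OF assms c subspace_cycles subspace_frag_on])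
      (auto simp: module_hom.zero[OF frag_hom_bd])
  from rel_basis_card_unique[OF frag.subspace_single_0 bE this] have E: "card (edges G) = r + k" .
  have "finite (components G)" by (simp add: components_eq finite_verts)
  then obtain bC where bC: "rel_basis {0} (frag_on (components G)) (card (components G)) bC"
    by (rule rel_basis_keys)
  have im: "aug ` frag_on (verts G) = frag_on (components G)"
  proof
    show "aug ` frag_on (verts G) \<subseteq> frag_on (components G)"
    proof
      fix y assume "y \<in> aug ` frag_on (verts G)"
      then obtain x where x: "Poly_Mapping.keys x \<subseteq> verts G" "y = aug x" by auto
      have "aug x \<in> frag_on (components G)" unfolding aug_def
        by (rule frag_extend_in_subspace[OF subspace_frag_on x(1)]) (auto simp: components_eq)
      then show "y \<in> frag_on (components G)" by (simp only: x(2))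
    qed
    show "frag_on (components G) \<subseteq> aug ` frag_on (verts G)"
    proof
      fix y :: "'v set \<Rightarrow>\<^sub>0 int" assume "y \<in> frag_on (components G)"
      then have y: "Poly_Mapping.keys y \<subseteq> components G" by simp
      define r where "r = inv_into (verts G) comp_of"
      have r: "r c \<in> verts G" "comp_of (r c) = c" if "c \<in> components G" for c
        using that by (simp_all add: r_def components_eq inv_into_into f_inv_into_f)
      have "frag_extend (frag_of \<circ> r) y \<in> frag_on (verts G)"
        by (rule frag_extend_in_subspace[OF subspace_frag_on y]) (simp add: r)
      moreover have "y = aug (frag_extend (frag_of \<circ> r) y)"
        by (rule frag_hom_eqI[OF frag.module_hom_ident frag_hom_compose[OF frag_hom_extend frag_hom_aug] y])
          (simp add: aug_def r)
      ultimately show "y \<in> aug ` frag_on (verts G)" by (rule rev_image_eqI)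
    qed
  qed
  have ker_aug: "aug w = 0 \<longleftrightarrow> w \<in> N" if "w \<in> frag_on (verts G)" for w
  proof
    assume "aug w = 0"
    with aug_eq_0_imp_bd[of w] that obtain x where "Poly_Mapping.keys x \<subseteq> edges G" "bd x = w" by auto
    then show "w \<in> N" by (auto simp: N_def)
  next
    assume "w \<in> N"
    then show "aug w = 0" using aug_bd by (auto simp: N_def)
  qed
  obtain c' where c': "rel_basis N (frag_on (verts G)) (card (components G)) c'"
    by (rule exists_rel_basis_hom[OF frag_hom_aug ker_aug subspace_frag_on bC[folded im]]) (assumption | rule that)+
  obtain bV where bV: "rel_basis {0} (frag_on (verts G)) (card (verts G)) bV"
    by (rule rel_basis_keys[OF finite_verts])
  have "rel_basis {0} (frag_on (verts G)) (k + card (components G)) (\<lambda>i. if i < k then d i else c' (i - k))"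
    by (rule rel_basis_trans(1)[OF d c' N subspace_frag_on]) (use NV frag.subspace_0[OF N] in auto)
  from rel_basis_card_unique[OF frag.subspace_single_0 bV this] E show ?thesis by simp
qed

end

section \<open>Double covers\<close>

lemma frag_form_length_pairing: "frag_form (length_pairing G x)"
  unfolding frag_form_iff length_pairing_def
  by (simp add: Poly_Mapping.lookup_add algebra_simps sum.distrib sum_distrib_left)

lemma length_pairing_commute: "length_pairing G x y = length_pairing G y x"
  by (simp add: length_pairing_def mult.commute)

lemma frag_form_eqI:
  assumes f: "frag_form f" and g: "frag_form g" and x: "Poly_Mapping.keys x \<subseteq> S"
    and eq: "\<And>a. a \<in> S \<Longrightarrow> f (frag_of a) = g (frag_of a)"
  shows "f x = g x"
  using x
  by (induction x rule: frag_induction)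
    (simp_all add: module_hom.zero[OF f] module_hom.zero[OF g] module_hom.diff[OF f] module_hom.diff[OF g] eq)

lemma frag_form_compose: "frag_hom f \<Longrightarrow> frag_form g \<Longrightarrow> frag_form (\<lambda>x. g (f x))"
  by (simp add: frag_form_iff module_hom.add module_hom.scale)

lemma degree_two_fibre:
  fixes d :: "'a \<Rightarrow> nat"
  assumes "finite F" "(\<Sum>x\<in>F. d x) = 2" "\<And>x. x \<in> F \<Longrightarrow> d x > 0"
  obtains (one) a where "F = {a}" "d a = 2" | (two) a b where "a \<noteq> b" "F = {a, b}" "d a = 1" "d b = 1"
proof -
  have "(\<Sum>x\<in>F. 1) \<le> (\<Sum>x\<in>F. d x)" using assms(3) by (intro sum_mono) (simp add: Suc_leI)
  then have "card F \<le> 2" using assms(2) by simp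
  moreover have "card F \<noteq> 0" using assms by auto
  ultimately consider "card F = 1" | "card F = 2" by linarith
  then show thesis
  proof cases
    case 1
    then obtain a where "F = {a}" by (rule card_1_singletonE)
    then show ?thesis using assms one by simp
  next
    case 2
    then obtain a b where ab: "F = {a, b}" "a \<noteq> b" by (auto simp: card_2_iff)
    then have "d a + d b = 2" "d a > 0" "d b > 0" using assms by auto
    then have "d a = 1" "d b = 1" by linarith+
    then show ?thesis using ab two by blast
  qed
qed

lemma oriented_graphI:
  assumes "metric_graph H" "orientation H S"
  shows "oriented_graph H S"
proof
  show "h \<in> S \<longleftrightarrow> hinv H h \<notin> S" if "h \<in> halfs H" for h
    using assms(2) that by (simp only: orientation_def)
qed (use assms(1) in \<open>simp_all add: metric_graph_def\<close>)

locale oriented_cover =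
  fixes Gt :: "('w, 'k) mgraph" and G :: "('v, 'h) mgraph"
    and p :: "('w, 'k, 'v, 'h) cover" and At :: "'k set" and A :: "'h set"
  assumes cover: "double_cover Gt G p"
    and orient_t: "orientation Gt At" and orient_b: "orientation G A"
    and compat: "compatible_orientations Gt p At A"
begin

lemma metric: "metric_graph Gt" "metric_graph G"
  using cover by (simp_all add: double_cover_def)

sublocale T: oriented_graph Gt At
  by (rule oriented_graphI[OF metric(1) orient_t])

sublocale B: oriented_graph G A
  by (rule oriented_graphI[OF metric(2) orient_b])

lemma inv_neq: "h \<in> halfs G \<Longrightarrow> hinv G h \<noteq> h"
  using metric(2) by (simp add: metric_graph_def)

lemma hmap_in: "k \<in> halfs Gt \<Longrightarrow> hmap p k \<in> halfs G"
  using cover by (auto simp: double_cover_def)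

lemma hroot_hmap: "k \<in> halfs Gt \<Longrightarrow> hroot G (hmap p k) = vmap p (hroot Gt k)"
  and hinv_hmap: "k \<in> halfs Gt \<Longrightarrow> hinv G (hmap p k) = hmap p (hinv Gt k)"
  using cover by (auto simp: double_cover_def)

lemma orient_hmap: "k \<in> halfs Gt \<Longrightarrow> k \<in> At \<longleftrightarrow> hmap p k \<in> A"
  using compat by (simp add: compatible_orientations_def)

definition hdeg :: "'k \<Rightarrow> nat" where
  "hdeg k = edeg p (edge_of Gt k)"

text \<open>Fibres over half-edges replace fibres over edges: \<open>edge_of Gt\<close> maps
  \<open>hfib h\<close> bijectively onto the preimages of \<open>edge_of G h\<close>, and a
  half-edge also determines an end at which the degree condition applies.\<close>

definition hfib :: "'h \<Rightarrow> 'k set" where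
  "hfib h = {k \<in> halfs Gt. hmap p k = h}"

definition vfib :: "'v \<Rightarrow> 'w set" where
  "vfib v = {w \<in> verts Gt. vmap p w = v}"

lemma finite_hfib: "finite (hfib h)"
  by (simp add: hfib_def T.finite_halfs)

lemma finite_vfib: "finite (vfib v)"
  by (simp add: vfib_def T.finite_verts)

lemma hdeg_pos: "k \<in> halfs Gt \<Longrightarrow> hdeg k > 0"
  using cover T.edge_of_in by (auto simp: double_cover_def hdeg_def)

lemma vdeg_pos: "w \<in> verts Gt \<Longrightarrow> vdeg p w > 0"
  using cover by (auto simp: double_cover_def)

lemma sum_hdeg: "h \<in> halfs G \<Longrightarrow> (\<Sum>k\<in>hfib h. hdeg k) = 2"
  using cover by (simp add: double_cover_def hfib_def hdeg_def)

lemma sum_vdeg: "v \<in> verts G \<Longrightarrow> (\<Sum>w\<in>vfib v. vdeg p w) = 2"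
  using cover by (simp add: double_cover_def vfib_def)

lemma vdeg_eq:
  assumes "w \<in> verts Gt" "h \<in> halfs G" "hroot G h = vmap p w"
  shows "vdeg p w = (\<Sum>k\<in>{k \<in> hfib h. hroot Gt k = w}. hdeg k)"
proof -
  have "{k \<in> hfib h. hroot Gt k = w} = {k. k \<in> halfs Gt \<and> hroot Gt k = w \<and> hmap p k = h}"
    by (auto simp: hfib_def)
  then show ?thesis using cover assms by (simp add: double_cover_def hdeg_def)
qed

lemma elen_eq: "f \<in> edges Gt \<Longrightarrow> elen G (hmap p ` f) = real (edeg p f) * elen Gt f"
  using cover by (simp add: double_cover_def)

lemma hmap_edge_of: "k \<in> halfs Gt \<Longrightarrow> hmap p ` edge_of Gt k = edge_of G (hmap p k)"
  by (simp add: edge_of_def hinv_hmap)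

lemma edge_preimages_eq:
  assumes h: "h \<in> halfs G"
  shows "edge_preimages Gt p (edge_of G h) = edge_of Gt ` hfib h"
proof
  show "edge_preimages Gt p (edge_of G h) \<subseteq> edge_of Gt ` hfib h"
  proof
    fix f assume "f \<in> edge_preimages Gt p (edge_of G h)"
    then obtain k where k: "k \<in> halfs Gt" "f = edge_of Gt k" "edge_of G (hmap p k) = edge_of G h"
      by (auto simp: edge_preimages_def edges_def hmap_edge_of)
    then have "hmap p k = h \<or> hmap p k = hinv G h" by (auto simp: edge_of_def doubleton_eq_iff)
    then show "f \<in> edge_of Gt ` hfib h"
    proof
      assume "hmap p k = h"
      then show ?thesis using k by (auto simp: hfib_def)
    next
      assume "hmap p k = hinv G h"
      then have "hmap p (hinv Gt k) = h" using k h by (simp add: B.inv_inv flip: hinv_hmap)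
      then have "hinv Gt k \<in> hfib h" using k by (simp add: hfib_def T.inv_in)
      then show ?thesis using k by (intro image_eqI[of _ _ "hinv Gt k"]) (simp_all add: T.edge_of_inv)
    qed
  qed
  show "edge_of Gt ` hfib h \<subseteq> edge_preimages Gt p (edge_of G h)"
  proof
    fix f assume "f \<in> edge_of Gt ` hfib h"
    then obtain k where "k \<in> halfs Gt" "hmap p k = h" "f = edge_of Gt k" by (auto simp: hfib_def)
    then show "f \<in> edge_preimages Gt p (edge_of G h)"
      by (simp add: edge_preimages_def hmap_edge_of T.edge_of_in)
  qed
qed

text \<open>If both halves of an edge lay over \<open>h\<close>, the involution of the base would
  fix \<open>h\<close>; edges are never folded.\<close>

lemma inj_on_edge_of_hfib:
  assumes h: "h \<in> halfs G"
  shows "inj_on (edge_of Gt) (hfib h)"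
proof (rule inj_onI)
  fix k k' assume kk: "k \<in> hfib h" "k' \<in> hfib h" "edge_of Gt k = edge_of Gt k'"
  then have "k = k' \<or> k = hinv Gt k'" by (auto simp: edge_of_def doubleton_eq_iff)
  moreover have "k \<noteq> hinv Gt k'"
  proof
    assume "k = hinv Gt k'"
    then have "hinv G h = h" using kk hinv_hmap[of k'] by (auto simp: hfib_def)
    then show False using inv_neq[OF h] by simp
  qed
  ultimately show "k = k'" by blast
qed

lemma dilated_edge_iff: "h \<in> halfs G \<Longrightarrow> dilated_edge Gt p (edge_of G h) \<longleftrightarrow> card (hfib h) = 1"
  by (simp add: dilated_edge_def edge_preimages_eq card_image inj_on_edge_of_hfib)

lemma finite_edge_preimages: "finite (edge_preimages Gt p e)"
  by (simp add: edge_preimages_def T.finite_edges)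

lemma hfib_cases [consumes 1]:
  assumes h: "h \<in> halfs G"
  obtains (dil) k where "hfib h = {k}" "hdeg k = 2" "dilated_edge Gt p (edge_of G h)"
  | (undil) k k' where "k \<noteq> k'" "hfib h = {k, k'}" "hdeg k = 1" "hdeg k' = 1" "\<not> dilated_edge Gt p (edge_of G h)"
proof (rule degree_two_fibre[OF finite_hfib sum_hdeg[OF h]])
  show "hdeg x > 0" if "x \<in> hfib h" for x using that hdeg_pos by (simp add: hfib_def)
  show thesis if "hfib h = {a}" "hdeg a = 2" for a
    using that h by (intro dil[of a]) (simp_all add: dilated_edge_iff)
  show thesis if "a \<noteq> b" "hfib h = {a, b}" "hdeg a = 1" "hdeg b = 1" for a b
    using that h by (intro undil[of a b]) (simp_all add: dilated_edge_iff)
qed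

lemma edeg_eq:
  assumes f: "f \<in> edges Gt"
  shows "edeg p f = (if dilated_edge Gt p (hmap p ` f) then 2 else 1)"
proof -
  obtain k where k: "k \<in> halfs Gt" "f = edge_of Gt k" using f by (auto simp: edges_def)
  have in_fib: "k \<in> hfib (hmap p k)" using k by (simp add: hfib_def)
  have im: "hmap p ` f = edge_of G (hmap p k)" using k by (simp add: hmap_edge_of)
  have d: "edeg p f = hdeg k" using k by (simp add: hdeg_def)
  from hmap_in[OF k(1)] show ?thesis
  proof (cases rule: hfib_cases)
    case (dil k')
    then have "k = k'" using in_fib by simp
    then show ?thesis unfolding im d using dil by simp
  next
    case (undil k' k'')
    then have "k = k' \<or> k = k''" using in_fib by simp
    then have "hdeg k = 1" using undil by metis
    then show ?thesis unfolding im d using undil by simp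
  qed
qed

lemma edge_image_in: "f \<in> edges Gt \<Longrightarrow> hmap p ` f \<in> edges G"
  by (auto simp: edges_def hmap_edge_of hmap_in)

section \<open>Push-forward and pull-back of chains and cycles\<close>

abbreviation "push \<equiv> push_forward p"
abbreviation "pull \<equiv> pull_back Gt p"

lemma frag_hom_push: "frag_hom push"
  by (simp add: push_forward_def[abs_def])

lemma frag_hom_pull: "frag_hom pull"
  by (simp add: pull_back_def[abs_def])

lemma push_of: "push (frag_of f) = frag_of (hmap p ` f)"
  by (simp add: push_forward_def)

text \<open>The case distinction in \<open>pull_back\<close> amounts to weighting each preimage by
  its degree, which lets the fibre sums below treat dilated and undilated edges alike.\<close>

lemma pull_of:
  "pull (frag_of e) = (\<Sum>f\<in>edge_preimages Gt p e. frag_cmul (int (edeg p f)) (frag_of f))"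
proof -
  have "edeg p f = (if dilated_edge Gt p e then 2 else 1)" if "f \<in> edge_preimages Gt p e" for f
    using that edeg_eq[of f] by (auto simp: edge_preimages_def)
  then show ?thesis by (simp add: pull_back_def frag_cmul_sum)
qed

lemma pull_of_half:
  "h \<in> halfs G \<Longrightarrow> pull (frag_of (edge_of G h)) = (\<Sum>k\<in>hfib h. frag_cmul (int (hdeg k)) (frag_of (edge_of Gt k)))"
  by (simp add: pull_of edge_preimages_eq sum.reindex inj_on_edge_of_hfib hdeg_def)

lemma push_in: "Poly_Mapping.keys x \<subseteq> edges Gt \<Longrightarrow> Poly_Mapping.keys (push x) \<subseteq> edges G"
  using frag_extend_in_subspace[OF subspace_frag_on, of x "edges Gt" "\<lambda>f. frag_of (hmap p ` f)" "edges G"]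
  by (simp add: push_forward_def edge_image_in)

lemma pull_in: "Poly_Mapping.keys (pull x) \<subseteq> edges Gt"
proof -
  have "pull x \<in> frag_on (edges Gt)"
    unfolding pull_back_def
  proof (rule frag_extend_in_subspace[OF subspace_frag_on order_refl])
    fix e
    have "(\<Sum>f\<in>edge_preimages Gt p e. frag_of f) \<in> frag_on (edges Gt)"
      by (rule frag.subspace_sum[OF subspace_frag_on]) (simp add: edge_preimages_def)
    then show "(if dilated_edge Gt p e then frag_cmul 2 (\<Sum>f\<in>edge_preimages Gt p e. frag_of f)
        else (\<Sum>f\<in>edge_preimages Gt p e. frag_of f)) \<in> frag_on (edges Gt)"
      using frag.subspace_scale[OF subspace_frag_on] by (simp only: split: if_split) blast
  qed
  then show ?thesis by simp
qed

lemma push_pull: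
  assumes "Poly_Mapping.keys x \<subseteq> edges G"
  shows "push (pull x) = frag_cmul 2 x"
proof (rule frag_hom_eqI[OF frag_hom_compose[OF frag_hom_pull frag_hom_push] frag.module_hom_scale_self assms])
  fix e assume "e \<in> edges G"
  then obtain h where h: "h \<in> halfs G" "e = edge_of G h" by (auto simp: edges_def)
  have "push (pull (frag_of e)) = (\<Sum>k\<in>hfib h. frag_cmul (int (hdeg k)) (frag_of e))"
    using h by (simp add: pull_of_half module_hom.sum[OF frag_hom_push] module_hom.scale[OF frag_hom_push] push_of)
      (intro sum.cong, auto simp: hfib_def hmap_edge_of)
  also have "\<dots> = frag_cmul (int (\<Sum>k\<in>hfib h. hdeg k)) (frag_of e)"
    by (simp add: frag.scale_sum_left)
  finally show "push (pull (frag_of e)) = frag_cmul 2 (frag_of e)" by (simp add: sum_hdeg[OF h(1)])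
qed

lemma lookup_pull:
  assumes "Poly_Mapping.keys y \<subseteq> edges G" "f \<in> edges Gt"
  shows "Poly_Mapping.lookup (pull y) f = int (edeg p f) * Poly_Mapping.lookup y (hmap p ` f)"
  using assms(1)
proof (induction y rule: frag_induction)
  case (one e)
  have "Poly_Mapping.lookup (pull (frag_of e)) f =
      (\<Sum>f'\<in>edge_preimages Gt p e. if f = f' then int (edeg p f') else 0)"
    unfolding pull_of Poly_Mapping.lookup_sum by (intro sum.cong) auto
  also have "\<dots> = (if hmap p ` f = e then int (edeg p f) else 0)"
    using finite_edge_preimages[of e] assms(2) by (simp add: edge_preimages_def)
  finally show ?case by simp
qed (simp_all add: module_hom.zero[OF frag_hom_pull] module_hom.diff[OF frag_hom_pull]
      Poly_Mapping.lookup_minus algebra_simps)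

text \<open>Adjointness rests on the length condition: the degree that appears as a coefficient of
  \<open>pull x\<close> at \<open>f\<close> turns \<open>elen Gt f\<close> into the length of the
  image edge.\<close>

lemma pairing_pull:
  assumes x: "Poly_Mapping.keys x \<subseteq> edges G" and y: "Poly_Mapping.keys y \<subseteq> edges Gt"
  shows "length_pairing Gt (pull x) y = length_pairing G x (push y)"
proof (rule frag_form_eqI[OF frag_form_length_pairing frag_form_compose[OF frag_hom_push frag_form_length_pairing] y])
  fix f assume f: "f \<in> edges Gt"
  have "length_pairing Gt (pull x) (frag_of f) =
      (\<Sum>f'\<in>edges Gt. if f' = f then of_int (Poly_Mapping.lookup (pull x) f) * elen Gt f else 0)"
    unfolding length_pairing_def by (intro sum.cong) auto
  also have "\<dots> = of_int (Poly_Mapping.lookup x (hmap p ` f)) * elen G (hmap p ` f)"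
    using f T.finite_edges by (simp add: lookup_pull[OF x f] elen_eq)
  also have "\<dots> = (\<Sum>e\<in>edges G. if e = hmap p ` f then of_int (Poly_Mapping.lookup x e) * elen G e else 0)"
    using edge_image_in[OF f] B.finite_edges by simp
  also have "\<dots> = length_pairing G x (push (frag_of f))"
    unfolding length_pairing_def push_of by (intro sum.cong) auto
  finally show "length_pairing Gt (pull x) (frag_of f) = length_pairing G x (push (frag_of f))" .
qed

lemma bd_push:
  assumes "Poly_Mapping.keys x \<subseteq> edges Gt"
  shows "B.bd (push x) = frag_extend (frag_of \<circ> vmap p) (T.bd x)"
proof (rule frag_hom_eqI[OF frag_hom_compose[OF frag_hom_push B.frag_hom_bd]
      frag_hom_compose[OF T.frag_hom_bd frag_hom_extend] assms])
  fix f assume "f \<in> edges Gt"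
  then obtain k where k: "k \<in> halfs Gt" "k \<in> At" "f = edge_of Gt k" by (rule T.edgeE)
  have "hmap p k \<in> A" using k orient_hmap by blast
  then show "B.bd (push (frag_of f)) = frag_extend (frag_of \<circ> vmap p) (T.bd (frag_of f))"
    using k by (simp add: push_of boundary_def hmap_edge_of T.source_edge_of T.target_edge_of
        B.source_edge_of B.target_edge_of hmap_in hroot_hmap hinv_hmap T.inv_in frag_extend_diff)
qed

lemma push_cycles: "x \<in> T.cycles \<Longrightarrow> push x \<in> B.cycles"
  using push_in bd_push by simp

text \<open>Pull-back of 0-chains, weighted by the vertex degrees so that \<open>pull\<close>
  becomes a chain map.\<close>

definition vpull :: "('v \<Rightarrow>\<^sub>0 int) \<Rightarrow> ('w \<Rightarrow>\<^sub>0 int)" where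
  "vpull = frag_extend (\<lambda>v. \<Sum>w\<in>vfib v. frag_cmul (int (vdeg p w)) (frag_of w))"

text \<open>Grouping the fibre of \<open>h\<close> by roots turns the sum of edge degrees at each
  vertex into the local degree there, by condition (i) of a double cover.\<close>

lemma sum_root_hfib:
  assumes h: "h \<in> halfs G"
  shows "(\<Sum>k\<in>hfib h. frag_cmul (int (hdeg k)) (frag_of (hroot Gt k))) = vpull (frag_of (hroot G h))"
proof -
  have "vpull (frag_of (hroot G h)) = (\<Sum>w\<in>vfib (hroot G h). frag_cmul (int (vdeg p w)) (frag_of w))"
    by (simp add: vpull_def)
  also have "\<dots> = (\<Sum>w\<in>vfib (hroot G h). \<Sum>k\<in>{k \<in> hfib h. hroot Gt k = w}.
      frag_cmul (int (hdeg k)) (frag_of (hroot Gt k)))"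
  proof (rule sum.cong[OF refl])
    fix w assume "w \<in> vfib (hroot G h)"
    then have "vdeg p w = (\<Sum>k\<in>{k \<in> hfib h. hroot Gt k = w}. hdeg k)"
      using h by (intro vdeg_eq) (auto simp: vfib_def)
    then show "frag_cmul (int (vdeg p w)) (frag_of w) =
        (\<Sum>k\<in>{k \<in> hfib h. hroot Gt k = w}. frag_cmul (int (hdeg k)) (frag_of (hroot Gt k)))"
      by (simp add: frag.scale_sum_left)
  qed
  also have "\<dots> = (\<Sum>k\<in>hfib h. frag_cmul (int (hdeg k)) (frag_of (hroot Gt k)))"
    by (rule sum.group[OF finite_hfib finite_vfib])
      (auto simp: hfib_def vfib_def T.root_in hroot_hmap)
  finally show ?thesis ..
qed

lemma bd_pull:
  assumes "Poly_Mapping.keys x \<subseteq> edges G"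
  shows "T.bd (pull x) = vpull (B.bd x)"
proof (rule frag_hom_eqI[OF frag_hom_compose[OF frag_hom_pull T.frag_hom_bd] _ assms])
  show "frag_hom (\<lambda>x. vpull (B.bd x))"
    unfolding vpull_def by (rule frag_hom_compose[OF B.frag_hom_bd frag_hom_extend])
  fix e assume "e \<in> edges G"
  then obtain h where h: "h \<in> halfs G" "h \<in> A" "e = edge_of G h" by (rule B.edgeE)
  have bd: "T.bd (frag_of (edge_of Gt k)) = frag_of (hroot Gt (hinv Gt k)) - frag_of (hroot Gt k)"
    if "k \<in> hfib h" for k
  proof -
    have "k \<in> halfs Gt" "k \<in> At" using that h orient_hmap[of k] by (auto simp: hfib_def)
    then show ?thesis by (simp add: boundary_def T.source_edge_of T.target_edge_of)
  qed
  have "T.bd (pull (frag_of e)) = (\<Sum>k\<in>hfib h. frag_cmul (int (hdeg k)) (T.bd (frag_of (edge_of Gt k))))"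
    using h by (simp add: pull_of_half module_hom.sum[OF T.frag_hom_bd] module_hom.scale[OF T.frag_hom_bd])
  also have "\<dots> = (\<Sum>k\<in>hfib h. frag_cmul (int (hdeg k)) (frag_of (hroot Gt (hinv Gt k)))) -
      (\<Sum>k\<in>hfib h. frag_cmul (int (hdeg k)) (frag_of (hroot Gt k)))"
    by (simp add: bd frag.scale_right_diff_distrib sum_subtractf)
  \<comment> \<open>The involution carries the fibre of \<open>h\<close> to that of the opposite
    half-edge and preserves degrees, so the targets upstairs become roots in that other
    fibre.\<close>
  also have "(\<Sum>k\<in>hfib h. frag_cmul (int (hdeg k)) (frag_of (hroot Gt (hinv Gt k)))) =
      (\<Sum>k\<in>hfib (hinv G h). frag_cmul (int (hdeg k)) (frag_of (hroot Gt k)))"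
    by (rule sum.reindex_bij_witness[of _ "hinv Gt" "hinv Gt"])
      (use h in \<open>auto simp: hfib_def T.inv_inv T.inv_in hdeg_def T.edge_of_inv B.inv_inv simp flip: hinv_hmap\<close>)
  also have "\<dots> = vpull (frag_of (hroot G (hinv G h)))"
    by (rule sum_root_hfib[OF B.inv_in[OF h(1)]])
  also have "(\<Sum>k\<in>hfib h. frag_cmul (int (hdeg k)) (frag_of (hroot Gt k))) = vpull (frag_of (hroot G h))"
    by (rule sum_root_hfib[OF h(1)])
  also have "vpull (frag_of (hroot G (hinv G h))) - vpull (frag_of (hroot G h)) = vpull (B.bd (frag_of e))"
    using h by (simp add: boundary_def B.source_edge_of B.target_edge_of vpull_def frag_extend_diff)
  finally show "T.bd (pull (frag_of e)) = vpull (B.bd (frag_of e))" .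
qed

lemma pull_cycles: "x \<in> B.cycles \<Longrightarrow> pull x \<in> T.cycles"
  using pull_in bd_pull by (simp add: vpull_def)

subsection \<open>The dilation subgraph\<close>

abbreviation "Dil \<equiv> dilation_subgraph Gt G p"

lemma dilated_vertex_iff: "dilated_vertex Gt p v \<longleftrightarrow> card (vfib v) = 1"
  by (simp add: dilated_vertex_def vertex_preimages_def vfib_def)

text \<open>A half-edge of degree 2 forces local degree 2 at its root, which exhausts the fibre of
  the vertex below. Hence the dilated edges and vertices really form a subgraph.\<close>

lemma dilated_root:
  assumes h: "h \<in> halfs G" and dil: "dilated_edge Gt p (edge_of G h)"
  shows "dilated_vertex Gt p (hroot G h)"
  using h
proof (cases rule: hfib_cases)
  case (dil k)
  have k: "k \<in> halfs Gt" "hmap p k = h" using dil(1) by (auto simp: hfib_def)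
  let ?w = "hroot Gt k"
  have w: "?w \<in> vfib (hroot G h)" using k by (auto simp: vfib_def T.root_in simp flip: hroot_hmap)
  have "{k' \<in> hfib h. hroot Gt k' = ?w} = {k}" using dil(1) by auto
  then have deg: "vdeg p ?w = 2"
    using vdeg_eq[of ?w h] w h dil(2) by (simp add: vfib_def)
  have pos: "vdeg p w > 0" if "w \<in> vfib (hroot G h)" for w
    using that vdeg_pos by (simp add: vfib_def)
  have "card (vfib (hroot G h)) = 1"
  proof (rule degree_two_fibre[OF finite_vfib sum_vdeg[OF B.root_in[OF h]] pos])
    show "card (vfib (hroot G h)) = 1" if "vfib (hroot G h) = {a}" for a using that by simp
    show "card (vfib (hroot G h)) = 1" if "vfib (hroot G h) = {a, b}" "vdeg p a = 1" "vdeg p b = 1" for a b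
    proof -
      have "?w = a \<or> ?w = b" using w that(1) by simp
      then have "vdeg p ?w = 1" using that by (elim disjE) simp_all
      then show ?thesis using deg by simp
    qed
  qed
  then show ?thesis by (simp add: dilated_vertex_iff)
qed (use assms in simp)

lemma edge_of_Dil: "edge_of Dil = edge_of G"
  by (simp add: edge_of_def[abs_def] dilation_subgraph_def)

lemma boundary_Dil: "boundary Dil A = B.bd"
  by (simp add: boundary_def[abs_def] source_def[abs_def] target_def[abs_def] dilation_subgraph_def)

sublocale D: oriented_graph Dil A
proof
  show "hroot Dil h \<in> verts Dil" if "h \<in> halfs Dil" for h
    using that dilated_root[of h] B.root_in[of h] by (simp add: dilation_subgraph_def)
  show "hinv Dil h \<in> halfs Dil" if "h \<in> halfs Dil" for h
    using that B.inv_in[of h] B.edge_of_inv[of h] by (simp add: dilation_subgraph_def)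
  show "hinv Dil (hinv Dil h) = h" if "h \<in> halfs Dil" for h
    using that B.inv_inv[of h] by (simp add: dilation_subgraph_def)
  show "h \<in> A \<longleftrightarrow> hinv Dil h \<notin> A" if "h \<in> halfs Dil" for h
    using that B.orient[of h] by (simp only: dilation_subgraph_def) simp
qed (simp_all add: dilation_subgraph_def B.finite_verts B.finite_halfs)

lemma edges_Dil: "edges Dil = {e \<in> edges G. dilated_edge Gt p e}"
  unfolding edges_def edge_of_Dil by (auto simp: dilation_subgraph_def)

lemma D_cycles_eq: "D.cycles = {y. Poly_Mapping.keys y \<subseteq> edges Dil \<and> B.bd y = 0}"
  by (simp add: boundary_Dil)

lemma D_cycles_subset: "D.cycles \<subseteq> B.cycles"
  by (auto simp: boundary_Dil edges_Dil)

text \<open>Over dilated edges the pull-back is twice the sum of preimages, so dropping the factor 2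
  gives \<open>x\<close>. Its boundary vanishes after doubling, hence vanishes.\<close>

lemma exists_half_pull:
  assumes y: "y \<in> D.cycles"
  shows "\<exists>x\<in>T.cycles. frag_cmul 2 x = pull y"
proof
  define x where "x = frag_extend (\<lambda>e. \<Sum>f\<in>edge_preimages Gt p e. frag_of f) y"
  have keys: "Poly_Mapping.keys y \<subseteq> edges Dil" and bd: "B.bd y = 0" using y by (auto simp: boundary_Dil)
  have dbl: "frag_cmul 2 x = pull y"
    unfolding x_def
    by (rule frag_hom_eqI[OF frag_hom_compose[OF frag_hom_extend frag.module_hom_scale_self] frag_hom_pull keys])
      (simp add: edges_Dil pull_back_def)
  have "Poly_Mapping.keys x = Poly_Mapping.keys (frag_cmul 2 x)" by auto
  then have "Poly_Mapping.keys x \<subseteq> edges Gt" using pull_in dbl by simp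
  moreover have "frag_cmul 2 (T.bd x) = 0"
    using pull_cycles[of y] y D_cycles_subset dbl by (auto simp flip: module_hom.scale[OF T.frag_hom_bd])
  ultimately show "x \<in> T.cycles" by simp
  show "frag_cmul 2 x = pull y" by (rule dbl)
qed

text \<open>A preimage of an undilated edge has degree 1, so the coefficient of
  \<open>pull y\<close> there is that of \<open>y\<close> itself.\<close>

lemma half_pull_even:
  assumes y: "Poly_Mapping.keys y \<subseteq> edges G" and x: "frag_cmul 2 x = pull y"
    and e: "e \<in> edges G" "\<not> dilated_edge Gt p e"
  shows "even (Poly_Mapping.lookup y e)"
proof -
  obtain h where h: "h \<in> halfs G" "e = edge_of G h" using e by (auto simp: edges_def)
  have "hfib h \<noteq> {}" using sum_hdeg[OF h(1)] by auto
  then obtain k where k: "k \<in> halfs Gt" "hmap p k = h" by (auto simp: hfib_def)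
  define f where "f = edge_of Gt k"
  have f: "f \<in> edges Gt" "hmap p ` f = e" using k h by (simp_all add: f_def T.edge_of_in hmap_edge_of)
  have "edeg p f = 1" using edeg_eq[OF f(1)] f(2) e(2) by simp
  then have "Poly_Mapping.lookup (frag_cmul 2 x) f = Poly_Mapping.lookup y e"
    unfolding x using lookup_pull[OF y f(1)] f(2) by simp
  then have "Poly_Mapping.lookup y e = 2 * Poly_Mapping.lookup x f" by simp
  then show ?thesis by (rule dvdI)
qed

text \<open>The boundary map of the dilation subgraph has a torsion-free cokernel.\<close>

lemma even_off_Dil:
  assumes y: "y \<in> B.cycles"
    and even: "\<And>e. e \<in> edges G \<Longrightarrow> \<not> dilated_edge Gt p e \<Longrightarrow> even (Poly_Mapping.lookup y e)"
  shows "\<exists>l\<in>B.cycles. y - frag_cmul 2 l \<in> D.cycles"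
proof -
  define U where "U = {e \<in> edges G. \<not> dilated_edge Gt p e}"
  define z where "z = (\<Sum>e\<in>U. frag_cmul (Poly_Mapping.lookup y e div 2) (frag_of e))"
  have "finite U" by (simp add: U_def B.finite_edges)
  have lz: "Poly_Mapping.lookup z e = (if e \<in> U then Poly_Mapping.lookup y e div 2 else 0)" for e
  proof -
    have "Poly_Mapping.lookup z e = (\<Sum>e'\<in>U. if e = e' then Poly_Mapping.lookup y e' div 2 else 0)"
      unfolding z_def Poly_Mapping.lookup_sum by (intro sum.cong) auto
    then show ?thesis using \<open>finite U\<close> by simp
  qed
  have z: "Poly_Mapping.keys z \<subseteq> edges G"
    using lz by (auto simp: in_keys_iff U_def split: if_splits)
  define d where "d = y - frag_cmul 2 z"
  have d: "Poly_Mapping.keys d \<subseteq> edges Dil"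
  proof
    fix e assume "e \<in> Poly_Mapping.keys d"
    then have ne: "Poly_Mapping.lookup y e - 2 * Poly_Mapping.lookup z e \<noteq> 0"
      by (simp add: d_def in_keys_iff Poly_Mapping.lookup_minus)
    have "e \<notin> U"
    proof
      assume e: "e \<in> U"
      then have "even (Poly_Mapping.lookup y e)" using even[of e] by (simp add: U_def)
      then show False using ne e by (simp add: lz)
    qed
    moreover from this have "Poly_Mapping.lookup y e \<noteq> 0" using ne by (simp add: lz)
    then have "e \<in> edges G" using y by (auto simp: in_keys_iff)
    ultimately show "e \<in> edges Dil" by (simp add: edges_Dil U_def)
  qed
  \<comment> \<open>\<open>z\<close> is half of the part of \<open>y\<close> off the dilation
    subgraph and \<open>d\<close> is the rest. Halving the boundary of \<open>d\<close> inside that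
    subgraph produces the correction \<open>d'\<close> that closes \<open>z\<close> up to a
    cycle.\<close>
  have "D.bd d = frag_cmul 2 (- B.bd z)"
    using y by (simp add: d_def boundary_Dil module_hom.diff[OF B.frag_hom_bd] module_hom.scale[OF B.frag_hom_bd])
  from D.bd_halve[OF d this] obtain d' where d': "Poly_Mapping.keys d' \<subseteq> edges Dil" "B.bd d' = - B.bd z"
    by (auto simp: boundary_Dil)
  have "z + d' \<in> frag_on (edges G)"
    using z d' by (intro frag.subspace_add[OF subspace_frag_on]) (auto simp: edges_Dil)
  then have l: "z + d' \<in> B.cycles" using d' by (simp add: module_hom.add[OF B.frag_hom_bd])
  have eq: "y - frag_cmul 2 (z + d') = d - frag_cmul 2 d'"
    by (simp add: d_def frag_cmul_distrib2)
  have "d - frag_cmul 2 d' \<in> frag_on (edges Dil)"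
    using d d' by (intro frag.subspace_diff[OF subspace_frag_on] frag.subspace_scale[OF subspace_frag_on]) auto
  moreover have "B.bd (y - frag_cmul 2 (z + d')) = 0"
    using y l by (simp add: module_hom.diff[OF B.frag_hom_bd] module_hom.scale[OF B.frag_hom_bd])
  ultimately have "y - frag_cmul 2 (z + d') \<in> D.cycles"
    unfolding D_cycles_eq eq by simp
  then show ?thesis using l by blast
qed

section \<open>Surjectivity of the push-forward for a dilated cover\<close>

text \<open>As \<open>w0\<close> is the only vertex over \<open>v0\<close>, all lifts of a path end at \<open>w0\<close>, and \<open>c\<close> does not depend on \<open>w\<close>.\<close>

lemma lift_path:
  assumes w0: "vfib v0 = {w0}" and path: "(v, v0) \<in> B.steps\<^sup>*"
  shows "\<exists>c. \<forall>w\<in>vfib v. \<exists>q. Poly_Mapping.keys q \<subseteq> edges Gt \<and> T.bd q = frag_of w - frag_of w0 \<and> push q = c"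
  using path
proof (induction rule: converse_rtrancl_induct)
  case base
  show ?case
    by (intro exI[of _ 0] ballI)
      (simp add: w0 module_hom.zero[OF T.frag_hom_bd] module_hom.zero[OF frag_hom_push])
next
  case (step v' v)
  then obtain c where c: "\<forall>w\<in>vfib v. \<exists>q. Poly_Mapping.keys q \<subseteq> edges Gt \<and>
      T.bd q = frag_of w - frag_of w0 \<and> push q = c" by auto
  obtain h where h: "h \<in> halfs G" "v' = hroot G h" "v = hroot G (hinv G h)"
    using step.hyps(1) by (auto simp: B.steps_def)
  show ?case
  proof (intro exI[of _ "c - B.dart h"] ballI)
    fix w' assume w': "w' \<in> vfib v'"
    then have w'': "w' \<in> verts Gt" "hroot G h = vmap p w'" using h by (auto simp: vfib_def)
    \<comment> \<open>The local degree at \<open>w'\<close> is positive, so some half-edge over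
      \<open>h\<close> starts there.\<close>
    have "{k \<in> hfib h. hroot Gt k = w'} \<noteq> {}"
      using vdeg_eq[OF w''(1) h(1) w''(2)] vdeg_pos[OF w''(1)] by (intro notI) simp
    then obtain k where k: "k \<in> halfs Gt" "hmap p k = h" "hroot Gt k = w'" by (auto simp: hfib_def)
    have "hroot Gt (hinv Gt k) \<in> vfib v"
      using k h by (auto simp: vfib_def T.root_in T.inv_in hinv_hmap simp flip: hroot_hmap)
    with c obtain q where q: "Poly_Mapping.keys q \<subseteq> edges Gt"
      "T.bd q = frag_of (hroot Gt (hinv Gt k)) - frag_of w0" "push q = c" by blast
    have "q - T.dart k \<in> frag_on (edges Gt)"
      using q T.keys_dart[OF k(1)] by (intro frag.subspace_diff[OF subspace_frag_on]) auto
    moreover have "T.bd (q - T.dart k) = frag_of w' - frag_of w0"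
      using q k by (simp add: module_hom.diff[OF T.frag_hom_bd] T.bd_dart)
    moreover have "push (T.dart k) = B.dart h"
      using k orient_hmap[OF k(1)]
      by (simp add: T.dart_def B.dart_def push_of hmap_edge_of module_hom.neg[OF frag_hom_push])
    then have "push (q - T.dart k) = c - B.dart h"
      using q by (simp add: module_hom.diff[OF frag_hom_push])
    ultimately show "\<exists>q. Poly_Mapping.keys q \<subseteq> edges Gt \<and> T.bd q = frag_of w' - frag_of w0 \<and> push q = c - B.dart h"
      by (intro exI[of _ "q - T.dart k"]) simp
  qed
qed

lemma exists_dilated_vertex:
  assumes "dilated_cover Gt G p"
  shows "\<exists>v0\<in>verts G. \<exists>w0. vfib v0 = {w0}"
proof -
  have "\<exists>v. v \<in> verts Dil"
  proof (cases "verts Dil = {}")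
    case True
    then obtain e where "e \<in> edges Dil" using assms by (auto simp: dilated_cover_def)
    then obtain h where "h \<in> halfs Dil" by (auto simp: edges_def)
    then show ?thesis using D.root_in by blast
  qed auto
  then obtain v0 where "v0 \<in> verts G" "card (vfib v0) = 1"
    by (auto simp: dilation_subgraph_def dilated_vertex_iff)
  moreover from this(2) obtain w0 where "vfib v0 = {w0}" by (rule card_1_singletonE)
  ultimately show ?thesis by blast
qed

text \<open>Let \<open>c v\<close> be the image of a lifted path from \<open>w0\<close> to any
  vertex over \<open>v\<close>. Closing up a lift of an edge \<open>e\<close> by two such paths
  gives a cycle that pushes to \<open>e\<close> plus \<open>c\<close> at its source minus
  \<open>c\<close> at its target. Over a cycle \<open>y\<close> these corrections add up to
  \<open>c\<close> evaluated on the boundary of \<open>y\<close>, which is 0.\<close>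

lemma push_surj:
  assumes dil: "dilated_cover Gt G p" and conn: "connected_graph G" and y: "y \<in> B.cycles"
  shows "\<exists>x\<in>T.cycles. push x = y"
proof -
  obtain v0 w0 where v0: "v0 \<in> verts G" "vfib v0 = {w0}" using exists_dilated_vertex[OF dil] by blast
  define Q where "Q v c \<longleftrightarrow> (\<forall>w\<in>vfib v. \<exists>q. Poly_Mapping.keys q \<subseteq> edges Gt \<and>
      T.bd q = frag_of w - frag_of w0 \<and> push q = c)" for v c
  define c where "c v = (SOME c. Q v c)" for v
  have Q: "Q v (c v)" if "v \<in> verts G" for v
  proof -
    have "(v, v0) \<in> B.steps\<^sup>*" using conn v0 that by (simp add: connected_graph_def B.connection_eq)
    then have "\<exists>c. Q v c" unfolding Q_def by (rule lift_path[OF v0(2)])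
    then show ?thesis unfolding c_def by (rule someI_ex)
  qed
  define R where "R e z \<longleftrightarrow> z \<in> T.cycles \<and> push z = frag_of e + c (source G A e) - c (target G A e)" for e z
  define g where "g e = (SOME z. R e z)" for e
  have R: "R e (g e)" if e: "e \<in> edges G" for e
  proof -
    obtain h where h: "h \<in> halfs G" "h \<in> A" "e = edge_of G h" by (rule B.edgeE[OF e])
    have "hfib h \<noteq> {}" using sum_hdeg[OF h(1)] by auto
    then obtain k where k: "k \<in> halfs Gt" "hmap p k = h" by (auto simp: hfib_def)
    then have kA: "k \<in> At" using orient_hmap h by blast
    have fs: "hroot Gt k \<in> vfib (hroot G h)" "hroot Gt (hinv Gt k) \<in> vfib (hroot G (hinv G h))"
      using k by (auto simp: vfib_def T.root_in T.inv_in hinv_hmap simp flip: hroot_hmap)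
    from Q[OF B.root_in[OF h(1)]] fs(1)
    obtain q where q: "Poly_Mapping.keys q \<subseteq> edges Gt" "T.bd q = frag_of (hroot Gt k) - frag_of w0"
      "push q = c (hroot G h)" unfolding Q_def by blast
    from Q[OF B.root_in[OF B.inv_in[OF h(1)]]] fs(2)
    obtain q' where q': "Poly_Mapping.keys q' \<subseteq> edges Gt"
      "T.bd q' = frag_of (hroot Gt (hinv Gt k)) - frag_of w0" "push q' = c (hroot G (hinv G h))"
      unfolding Q_def by blast
    \<comment> \<open>The closed walk from \<open>w0\<close> to the source of the lifted edge, along
      that edge, and back to \<open>w0\<close>.\<close>
    let ?z = "q + frag_of (edge_of Gt k) - q'"
    have "?z \<in> frag_on (edges Gt)"
      using q q' k by (intro frag.subspace_diff[OF subspace_frag_on] frag.subspace_add[OF subspace_frag_on])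
        (auto simp: T.edge_of_in)
    moreover have "T.bd (frag_of (edge_of Gt k)) = frag_of (hroot Gt (hinv Gt k)) - frag_of (hroot Gt k)"
      using k kA by (simp add: boundary_def T.source_edge_of T.target_edge_of)
    then have "T.bd ?z = 0"
      using q q' by (simp add: module_hom.diff[OF T.frag_hom_bd] module_hom.add[OF T.frag_hom_bd])
    moreover have "push ?z = frag_of e + c (source G A e) - c (target G A e)"
      using q q' k h by (simp add: module_hom.diff[OF frag_hom_push] module_hom.add[OF frag_hom_push]
          push_of hmap_edge_of B.source_edge_of B.target_edge_of)
    ultimately have "R e ?z" by (simp add: R_def)
    then show ?thesis unfolding g_def by (rule someI)
  qed
  have keys: "Poly_Mapping.keys y \<subseteq> edges G" using y by simp
  have "frag_extend g y \<in> T.cycles"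
    by (rule frag_extend_in_subspace[OF T.subspace_cycles keys]) (use R in \<open>simp add: R_def\<close>)
  moreover have "push (frag_extend g y) = y - frag_extend c (B.bd y)"
    by (rule frag_hom_eqI[OF frag_hom_compose[OF frag_hom_extend frag_hom_push]
          frag_hom_sub[OF frag.module_hom_ident frag_hom_compose[OF B.frag_hom_bd frag_hom_extend]] keys])
      (use R in \<open>simp add: R_def boundary_def frag_extend_diff\<close>)
  then have "push (frag_extend g y) = y" using y by simp
  ultimately show ?thesis by (rule bexI[rotated])
qed

end

section \<open>Volumes\<close>

text \<open>Rows and columns use the same basis, so the sign of a change of basis enters squared and
  the definite description denotes a single value.\<close>

lemma vol2_Jac_eq:
  assumes "metric_graph G" "orientation G A"
    and b: "rel_basis {0} {x. Poly_Mapping.keys x \<subseteq> edges G \<and> boundary G A x = 0} n b"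
  shows "vol2_Jac G A = det (mat n n (\<lambda>(i, j). length_pairing G (b i) (b j)))"
proof -
  interpret oriented_graph G A by (rule oriented_graphI[OF assms(1,2)])
  show ?thesis
    unfolding vol2_Jac_def zbasis_H1_iff
  proof (rule the_equality)
    show "\<exists>m \<gamma>. rel_basis {0} cycles m \<gamma> \<and> det (mat n n (\<lambda>(i, j). length_pairing G (b i) (b j))) =
        det (mat m m (\<lambda>(i, j). length_pairing G (\<gamma> i) (\<gamma> j)))"
      using b by (intro exI[of _ n] exI[of _ b]) simp
    fix D assume "\<exists>m \<gamma>. rel_basis {0} cycles m \<gamma> \<and> D = det (mat m m (\<lambda>(i, j). length_pairing G (\<gamma> i) (\<gamma> j)))"
    then obtain m \<gamma> where "rel_basis {0} cycles m \<gamma>"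
      "D = det (mat m m (\<lambda>(i, j). length_pairing G (\<gamma> i) (\<gamma> j)))" by (elim exE conjE)
    then show "D = det (mat n n (\<lambda>(i, j). length_pairing G (b i) (b j)))"
      using gram_det_unique[where B = "length_pairing G", OF frag_form_length_pairing length_pairing_commute b]
      by simp
  qed
qed

text \<open>Positivity later permits division by the volume of the base and the removal of absolute
  values from Gram determinants.\<close>

lemma vol2_Jac_pos:
  assumes "metric_graph G" "orientation G A"
  shows "vol2_Jac G A > 0"
proof -
  interpret oriented_graph G A by (rule oriented_graphI[OF assms(1,2)])
  from exists_basis[OF finite_edges subspace_cycles]
  obtain n b where b: "rel_basis {0} cycles n b" "real_indep n b" by auto
  have "det (mat n n (\<lambda>(i, j). \<Sum>e\<in>edges G. of_int (Poly_Mapping.lookup (b i) e) *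
    of_int (Poly_Mapping.lookup (b j) e) * elen G e)) > 0"
  proof (rule gram_det_pos[OF finite_edges _ _ b(2)])
    show "elen G e > 0" if "e \<in> edges G" for e using assms(1) that by (simp add: metric_graph_def)
    show "Poly_Mapping.keys (b i) \<subseteq> edges G" if "i < n" for i using rel_basisD(1)[OF b(1) that] by simp
  qed
  then show ?thesis by (simp only: vol2_Jac_eq[OF assms b(1)] length_pairing_def)
qed

lemma det_scaled_rows:
  "det (mat n n (\<lambda>(i, j). c i * f i j)) = (\<Prod>i<n. c i) * det (mat n n (\<lambda>(i, j). f i j :: real))"
proof -
  have "det (mat n n (\<lambda>(i, j). c i * f i j)) =
      (\<Sum>\<pi> | \<pi> permutes {0..<n}. signof \<pi> * (\<Prod>i = 0..<n. c i * f i (\<pi> i)))"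
    unfolding det_def'[OF mat_carrier]
    by (intro sum.cong arg_cong2[of _ _ _ _ "(*)"] prod.cong refl) (auto dest: permutes_in_image)
  also have "\<dots> = (\<Prod>i<n. c i) * (\<Sum>\<pi> | \<pi> permutes {0..<n}. signof \<pi> * (\<Prod>i = 0..<n. f i (\<pi> i)))"
    by (simp add: prod.distrib sum_distrib_left lessThan_atLeast0 mult_ac)
  also have "(\<Sum>\<pi> | \<pi> permutes {0..<n}. signof \<pi> * (\<Prod>i = 0..<n. f i (\<pi> i))) = det (mat n n (\<lambda>(i, j). f i j))"
    unfolding det_def'[OF mat_carrier]
    by (intro sum.cong arg_cong2[of _ _ _ _ "(*)"] prod.cong refl) (auto dest: permutes_in_image)
  finally show ?thesis .
qed

lemma det_block_upper:
  fixes f :: "nat \<Rightarrow> nat \<Rightarrow> real"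
  assumes "\<And>i j. i < g \<Longrightarrow> j < n \<Longrightarrow> f (n + i) j = 0"
  shows "det (mat (n + g) (n + g) (\<lambda>(i, j). f i j)) =
    det (mat n n (\<lambda>(i, j). f i j)) * det (mat g g (\<lambda>(i, j). f (n + i) (n + j)))"
proof -
  have "mat (n + g) (n + g) (\<lambda>(i, j). f i j) = four_block_mat (mat n n (\<lambda>(i, j). f i j))
      (mat n g (\<lambda>(i, j). f i (n + j))) (0\<^sub>m g n) (mat g g (\<lambda>(i, j). f (n + i) (n + j)))"
  proof (rule eq_matI)
    fix i j
    assume "i < dim_row (four_block_mat (mat n n (\<lambda>(i, j). f i j))
      (mat n g (\<lambda>(i, j). f i (n + j))) (0\<^sub>m g n) (mat g g (\<lambda>(i, j). f (n + i) (n + j))))"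
      and "j < dim_col (four_block_mat (mat n n (\<lambda>(i, j). f i j))
      (mat n g (\<lambda>(i, j). f i (n + j))) (0\<^sub>m g n) (mat g g (\<lambda>(i, j). f (n + i) (n + j))))"
    then have ij: "i < n + g" "j < n + g" by simp_all
    have "f i j = 0" if "\<not> i < n" "j < n" using assms[of "i - n" j] that ij by simp
    then show "mat (n + g) (n + g) (\<lambda>(i, j). f i j) $$ (i, j) = four_block_mat (mat n n (\<lambda>(i, j). f i j))
      (mat n g (\<lambda>(i, j). f i (n + j))) (0\<^sub>m g n) (mat g g (\<lambda>(i, j). f (n + i) (n + j))) $$ (i, j)"
      using ij by (cases "i < n"; cases "j < n") simp_all
  qed simp_all
  then show ?thesis
    by (simp only: det_four_block_mat_lower_left_zero[OF mat_carrier mat_carrier refl mat_carrier])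
qed

section \<open>The dilation subgraph inside the cycles of the base, and the saturated
  pull-back\<close>

context oriented_cover
begin

text \<open>Forgetting the coefficients on dilated edges is a map \<open>\<rho>\<close> that kills,
  among the cycles of the base, exactly those of the dilation subgraph. The quotient thus embeds in
  a free group and has a basis to lift.\<close>

lemma exists_adapted_basis:
  obtains r s gd gu where "rel_basis {0} D.cycles r gd" "rel_basis D.cycles B.cycles s gu"
proof -
  from exists_basis[OF D.finite_edges D.subspace_cycles]
  obtain r gd where gd: "rel_basis {0} D.cycles r gd" by auto
  define \<rho> where "\<rho> = frag_extend (\<lambda>e. if dilated_edge Gt p e then 0 else frag_of e)"
  have \<rho>: "frag_hom \<rho>" by (simp add: \<rho>_def)
  have lookup_\<rho>: "Poly_Mapping.lookup (\<rho> y) e = (if dilated_edge Gt p e then 0 else Poly_Mapping.lookup y e)" for y e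
  proof (induction y rule: frag_induction[OF order_refl])
    case (2 x)
    then show ?case by (simp add: \<rho>_def)
  qed (simp_all add: module_hom.zero[OF \<rho>] module_hom.diff[OF \<rho>] Poly_Mapping.lookup_minus)
  have ker: "\<rho> y = 0 \<longleftrightarrow> y \<in> D.cycles" if y: "y \<in> B.cycles" for y
  proof -
    have "\<rho> y = 0 \<longleftrightarrow> (\<forall>e. \<not> dilated_edge Gt p e \<longrightarrow> Poly_Mapping.lookup y e = 0)"
      by (auto simp: poly_mapping_eq_iff fun_eq_iff lookup_\<rho>)
    also have "\<dots> \<longleftrightarrow> Poly_Mapping.keys y \<subseteq> edges Dil"
      using y by (auto simp: edges_Dil in_keys_iff)
    finally show ?thesis using y by (simp add: boundary_Dil)
  qed
  have "Poly_Mapping.keys z \<subseteq> edges G" if "z \<in> \<rho> ` B.cycles" for z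
    using that by (auto simp: in_keys_iff lookup_\<rho> split: if_splits)
  from exists_basis[OF B.finite_edges module_hom.subspace_image[OF \<rho> B.subspace_cycles] this]
  obtain s d where d: "rel_basis {0} (\<rho> ` B.cycles) s d" by auto
  obtain gu where "rel_basis D.cycles B.cycles s gu"
    by (rule exists_rel_basis_hom[OF \<rho> ker B.subspace_cycles d]) (assumption | rule that)+
  then show thesis using gd by (rule that[rotated])
qed

text \<open>The saturation of the image of \<open>pull\<close>.\<close>

definition sat_pull :: "('k set \<Rightarrow>\<^sub>0 int) set" where
  "sat_pull = {x \<in> T.cycles. frag_cmul 2 x = pull (push x)}"

definition ker_push :: "('k set \<Rightarrow>\<^sub>0 int) set" where
  "ker_push = {x \<in> T.cycles. push x = 0}"

text \<open>On \<open>sat_pull\<close> the double of an element is the pull-back of its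
  push-forward. Identities in the cover can therefore be checked after \<open>push\<close>.\<close>

lemma sat_pull_eqI:
  assumes "x \<in> sat_pull" "x' \<in> sat_pull" "push x = push x'"
  shows "x = x'"
proof -
  have "frag_cmul 2 (x - x') = 0"
    using assms by (simp add: sat_pull_def frag.scale_right_diff_distrib)
  then show ?thesis by simp
qed

text \<open>
  Its kernel is \<open>sat_pull\<close>, which exhibits the quotient of the cycles by \<open>sat_pull\<close> as a subgroup of a
  free abelian group.
\<close>

definition defect :: "('k set \<Rightarrow>\<^sub>0 int) \<Rightarrow> ('k set \<Rightarrow>\<^sub>0 int)" where
  "defect x = frag_cmul 2 x - pull (push x)"

lemma frag_hom_defect: "frag_hom defect"
  unfolding defect_def[abs_def]
  by (rule frag_hom_sub[OF frag.module_hom_scale_self frag_hom_compose[OF frag_hom_push frag_hom_pull]])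

lemma subspace_sat_pull: "frag.subspace sat_pull"
proof -
  have "sat_pull = T.cycles \<inter> {x. defect x = 0}" by (auto simp: sat_pull_def defect_def)
  then show ?thesis
    using frag.subspace_inter[OF T.subspace_cycles module_hom.subspace_kernel[OF frag_hom_defect]] by simp
qed

lemma subspace_ker_push: "frag.subspace ker_push"
proof -
  have "ker_push = T.cycles \<inter> {x. push x = 0}" by (auto simp: ker_push_def)
  then show ?thesis
    using frag.subspace_inter[OF T.subspace_cycles module_hom.subspace_kernel[OF frag_hom_push]] by simp
qed

text \<open>If \<open>n x = pull y\<close>, then
  \<open>n pull (push x) = pull (push (pull y)) = 2 pull y = 2 n x\<close>, and \<open>n\<close>
  cancels. Conversely \<open>n = 2\<close> works, so an explicit equation describes the
  saturation.\<close>

lemma sat_pull_iff: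
  assumes x: "x \<in> T.cycles"
  shows "(\<exists>n::nat. n > 0 \<and> frag_cmul (int n) x \<in> pull ` B.cycles) \<longleftrightarrow> x \<in> sat_pull"
proof
  assume "\<exists>n::nat. n > 0 \<and> frag_cmul (int n) x \<in> pull ` B.cycles"
  then obtain n :: nat and y where n: "n > 0" and y: "y \<in> B.cycles" "frag_cmul (int n) x = pull y" by auto
  have "frag_cmul (int n) (pull (push x)) = pull (push (pull y))"
    by (simp add: module_hom.scale[OF frag_hom_pull] module_hom.scale[OF frag_hom_push] flip: y(2))
  also have "\<dots> = frag_cmul 2 (pull y)"
    using y(1) by (simp add: push_pull module_hom.scale[OF frag_hom_pull])
  also have "\<dots> = frag_cmul (int n) (frag_cmul 2 x)"
    unfolding y(2)[symmetric] by (simp add: mult.commute)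
  finally have "frag_cmul (int n) (pull (push x) - frag_cmul 2 x) = 0"
    by (simp only: frag.scale_right_diff_distrib) simp
  then show "x \<in> sat_pull" using n x by (simp add: sat_pull_def)
next
  assume "x \<in> sat_pull"
  then have "frag_cmul (int 2) x = pull (push x)" by (simp add: sat_pull_def)
  then have "frag_cmul (int 2) x \<in> pull ` B.cycles" using push_cycles[OF x] by (rule image_eqI)
  then show "\<exists>n::nat. n > 0 \<and> frag_cmul (int n) x \<in> pull ` B.cycles" by (intro exI[of _ 2]) simp
qed

lemma pairing_sat_pull:
  assumes x: "x \<in> sat_pull" and y: "y \<in> T.cycles"
  shows "2 * length_pairing Gt x y = length_pairing G (push x) (push y)"
proof -
  have "length_pairing Gt y (frag_cmul 2 x) = 2 * length_pairing Gt y x"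
    by (simp add: module_hom.scale[OF frag_form_length_pairing])
  then have "2 * length_pairing Gt x y = length_pairing Gt (frag_cmul 2 x) y"
    by (simp only: length_pairing_commute[of Gt y])
  also have "frag_cmul 2 x = pull (push x)" using x by (simp add: sat_pull_def)
  also have "length_pairing Gt (pull (push x)) y = length_pairing G (push x) (push y)"
    using x y push_cycles by (intro pairing_pull) (auto simp: sat_pull_def)
  finally show ?thesis .
qed

text \<open>This orthogonality serves twice: it makes the Prym pairing independent of
  representatives and provides the zero block in \<open>prym_det\<close>.\<close>

lemma pairing_sat_pull_ker_push:
  assumes "x \<in> sat_pull" "y \<in> ker_push"
  shows "length_pairing Gt x y = 0"
proof -
  have "length_pairing G (push x) 0 = 0" by (rule module_hom.zero[OF frag_form_length_pairing])
  then show ?thesis using pairing_sat_pull[OF assms(1), of y] assms(2) by (simp add: ker_push_def)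
qed

text \<open>On cycles of the dilation subgraph the element selected is unique, chains being
  torsion-free.\<close>

definition half_pull :: "('h set \<Rightarrow>\<^sub>0 int) \<Rightarrow> ('k set \<Rightarrow>\<^sub>0 int)" where
  "half_pull y = (SOME x. x \<in> T.cycles \<and> frag_cmul 2 x = pull y)"

lemma half_pull:
  assumes y: "y \<in> D.cycles"
  shows "half_pull y \<in> sat_pull" "push (half_pull y) = y"
proof -
  have "\<exists>x. x \<in> T.cycles \<and> frag_cmul 2 x = pull y" using exists_half_pull[OF y] by (simp only: bex_simps Bex_def)
  then have h: "half_pull y \<in> T.cycles \<and> frag_cmul 2 (half_pull y) = pull y"
    unfolding half_pull_def by (rule someI_ex)
  have "y \<in> B.cycles" using y D_cycles_subset by blast
  then have "frag_cmul 2 (push (half_pull y)) = frag_cmul 2 y"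
    using h by (simp add: push_pull flip: module_hom.scale[OF frag_hom_push])
  then have "frag_cmul 2 (push (half_pull y) - y) = 0" by (simp only: frag.scale_right_diff_distrib) simp
  then show p: "push (half_pull y) = y" by simp
  show "half_pull y \<in> sat_pull" using h by (simp add: sat_pull_def p)
qed

lemma pull_sat_pull:
  assumes y: "y \<in> B.cycles"
  shows "pull y \<in> sat_pull"
  using pull_cycles[OF y] y by (simp add: sat_pull_def push_pull module_hom.scale[OF frag_hom_pull])

text \<open>\<open>push\<close> sends the proposed family to the \<open>gd i\<close> and to twice
  the \<open>gu i\<close>. It is injective on \<open>sat_pull\<close>, and by parity the
  push-forward of an element of \<open>sat_pull\<close> is a cycle of the dilation subgraph plus
  twice a cycle, hence a combination of these images.\<close>

lemma sat_pull_basis: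
  assumes gd: "rel_basis {0} D.cycles r gd" and gu: "rel_basis D.cycles B.cycles s gu"
  shows "rel_basis {0} sat_pull (r + s) (\<lambda>i. if i < r then half_pull (gd i) else pull (gu (i - r)))"
    (is "rel_basis _ _ _ ?p")
proof -
  have gdD: "gd i \<in> D.cycles" if "i < r" for i using rel_basisD(1)[OF gd that] .
  have guB: "gu i \<in> B.cycles" if "i < s" for i using rel_basisD(1)[OF gu that] .
  have p: "?p i \<in> sat_pull" if "i < r + s" for i
  proof (cases "i < r")
    case True
    then show ?thesis using half_pull(1)[OF gdD[OF True]] by simp
  next
    case False
    then have "i - r < s" using that by simp
    then show ?thesis using pull_sat_pull[OF guB] False by simp
  qed
  have push_lin: "push (lin_comb (r + s) c ?p) = lin_comb r c gd + lin_comb s (\<lambda>i. 2 * c (r + i)) gu" for c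
  proof -
    have 1: "lin_comb r c (\<lambda>i. push (half_pull (gd i))) = lin_comb r c gd"
      by (rule lin_comb_cong) (simp_all only: half_pull(2)[OF gdD])
    have "push (pull (gu i)) = frag_cmul 2 (gu i)" if "i < s" for i
      using push_pull[of "gu i"] guB[OF that] by simp
    then have 2: "lin_comb s (\<lambda>i. c (r + i)) (\<lambda>i. push (pull (gu i))) = lin_comb s (\<lambda>i. 2 * c (r + i)) gu"
      by (simp add: lin_comb_def mult.commute)
    show ?thesis
      unfolding lin_comb_append[of r s c "\<lambda>i. half_pull (gd i)" "\<lambda>i. pull (gu i)"]
        module_hom.add[OF frag_hom_push] frag_hom_lin_comb[OF frag_hom_push] 1 2 ..
  qed
  note g = rel_basis_trans(1)[OF gd gu D.subspace_cycles B.subspace_cycles D_cycles_subset]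
  have g: "rel_basis {0} B.cycles (r + s) (\<lambda>i. if i < r then gd i else gu (i - r))"
    by (rule g) (use frag.subspace_0[OF D.subspace_cycles] in simp)
  show ?thesis
    unfolding rel_basis_def
  proof (intro conjI ballI allI impI)
    fix x assume x: "x \<in> sat_pull"
    let ?y = "push x"
    have yB: "?y \<in> B.cycles" using x push_cycles by (simp add: sat_pull_def)
    have "even (Poly_Mapping.lookup ?y e)" if "e \<in> edges G" "\<not> dilated_edge Gt p e" for e
      using half_pull_even[of ?y x e] yB x that by (simp add: sat_pull_def)
    from even_off_Dil[OF yB this] obtain l where l: "l \<in> B.cycles" "?y - frag_cmul 2 l \<in> D.cycles" by auto
    obtain b where b: "l - lin_comb s b gu \<in> D.cycles" using rel_basisD(2)[OF gu l(1)] ..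
    \<comment> \<open>Replacing \<open>l\<close> by its \<open>gu\<close> part alters
      \<open>2 l\<close> only by an element of \<open>D.cycles\<close>, which the
      \<open>gd i\<close> absorb.\<close>
    have "?y - frag_cmul 2 l + frag_cmul 2 (l - lin_comb s b gu) \<in> D.cycles"
      by (rule frag.subspace_add[OF D.subspace_cycles l(2) frag.subspace_scale[OF D.subspace_cycles b]])
    then have "?y - frag_cmul 2 (lin_comb s b gu) \<in> D.cycles"
      by (simp only: frag.scale_right_diff_distrib add_diff_eq diff_add_cancel)
    from rel_basisD(2)[OF gd this] obtain a where
      a: "?y - frag_cmul 2 (lin_comb s b gu) - lin_comb r a gd \<in> {0}" ..
    define c where "c = (\<lambda>i. if i < r then a i else b (i - r))"
    have "lin_comb r c gd = lin_comb r a gd" by (rule lin_comb_cong) (simp_all add: c_def)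
    moreover have "lin_comb s (\<lambda>i. 2 * c (r + i)) gu = frag_cmul 2 (lin_comb s b gu)"
      by (simp add: c_def lin_comb_scale)
    ultimately have "push (lin_comb (r + s) c ?p) = lin_comb r a gd + frag_cmul 2 (lin_comb s b gu)"
      unfolding push_lin by simp
    also have "\<dots> = ?y" using a by (simp add: algebra_simps)
    finally have eq: "push x = push (lin_comb (r + s) c ?p)" by (rule sym)
    have "x = lin_comb (r + s) c ?p"
      by (rule sat_pull_eqI[OF x lin_comb_mem[OF subspace_sat_pull p] eq])
    then have "x - lin_comb (r + s) c ?p \<in> {0}" by simp
    then show "\<exists>c. x - lin_comb (r + s) c ?p \<in> {0}" by (rule exI[of _ c])
  next
    fix c i assume c: "lin_comb (r + s) c ?p \<in> {0}" and i: "i < r + s"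
    \<comment> \<open>Doubling the last \<open>s\<close> coefficients accounts for
      \<open>push (pull y) = 2 y\<close>; the push-forward then becomes a combination of the basis
      of the base cycles.\<close>
    define c' where "c' = (\<lambda>i. if i < r then c i else 2 * c i)"
    have "lin_comb r c' gd = lin_comb r c gd" by (rule lin_comb_cong) (simp_all add: c'_def)
    moreover have "lin_comb s (\<lambda>i. c' (r + i)) gu = lin_comb s (\<lambda>i. 2 * c (r + i)) gu"
      by (simp add: c'_def)
    ultimately have "lin_comb (r + s) c' (\<lambda>i. if i < r then gd i else gu (i - r)) = push (lin_comb (r + s) c ?p)"
      unfolding push_lin lin_comb_append[of r s c' gd gu] by simp
    then have "lin_comb (r + s) c' (\<lambda>i. if i < r then gd i else gu (i - r)) \<in> {0}"
      using c module_hom.zero[OF frag_hom_push] by simp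
    from rel_basisD(3)[OF g this i] show "c i = 0" by (simp add: c'_def split: if_splits)
  qed (rule p)
qed

section \<open>The Prym lattices, their pairing and its determinant\<close>

lemma prym_K'_group:
  shows "carrier (prym_K' Gt G p At A) = ker_push"
    "monoid.mult (prym_K' Gt G p At A) = (+)" "one (prym_K' Gt G p At A) = 0"
  by (simp_all add: prym_K'_def kernel_def T.carrier_H1 T.mult_H1 T.one_H1 B.one_H1 ker_push_def)

lemma zbasis_prym_K'_iff: "zbasis (prym_K' Gt G p At A) n \<mu> \<longleftrightarrow> rel_basis {0} ker_push n \<mu>"
proof -
  have "frag.subspace (carrier (prym_K' Gt G p At A))" by (simp only: prym_K'_group subspace_ker_push)
  from zbasis_frag_iff[OF this prym_K'_group(2,3)] show ?thesis by (simp only: prym_K'_group)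
qed

abbreviation "K_proj \<equiv> tf_proj (H1 Gt At) (pull ` B.cycles)"

lemma prym_K_quotient:
  shows "comm_group (prym_K Gt G p At A)"
    and "K_proj \<in> hom (H1 Gt At) (prym_K Gt G p At A)"
    and "K_proj ` T.cycles = carrier (prym_K Gt G p At A)"
    and "x \<in> T.cycles \<Longrightarrow> K_proj x = \<one>\<^bsub>prym_K Gt G p At A\<^esub> \<longleftrightarrow> x \<in> sat_pull"
    and "\<kappa> \<in> carrier (prym_K Gt G p At A) \<Longrightarrow> x \<in> \<Union>\<kappa> \<longleftrightarrow> x \<in> T.cycles \<and> K_proj x = \<kappa>"
proof -
  define S where "S = pull ` B.cycles"
  have "frag.subspace S" unfolding S_def by (rule module_hom.subspace_image[OF frag_hom_pull B.subspace_cycles])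
  moreover have "S \<subseteq> carrier (H1 Gt At)" unfolding S_def T.carrier_H1 using pull_cycles by (rule image_subsetI)
  ultimately have S: "subgroup S (H1 Gt At)" by (rule subgroup_frag[OF T.H1_group])
  have K: "prym_K Gt G p At A = H1 Gt At Mod S Mod torsion (H1 Gt At Mod S)"
    by (simp only: prym_K_def coker_def Let_def B.carrier_H1 S_def)
  note tf = tf_quotient[OF comm_group_frag[OF T.H1_group] S, folded K, unfolded S_def T.carrier_H1]
  show "comm_group (prym_K Gt G p At A)" by (rule tf(1))
  show "K_proj \<in> hom (H1 Gt At) (prym_K Gt G p At A)" by (rule tf(2))
  show "K_proj ` T.cycles = carrier (prym_K Gt G p At A)" by (rule tf(3))
  show "K_proj x = \<one>\<^bsub>prym_K Gt G p At A\<^esub> \<longleftrightarrow> x \<in> sat_pull" if "x \<in> T.cycles"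
    using tf(4)[OF that] unfolding nat_pow_frag[OF T.H1_group(2,3)] sat_pull_iff[OF that] .
  show "x \<in> \<Union>\<kappa> \<longleftrightarrow> x \<in> T.cycles \<and> K_proj x = \<kappa>" if "\<kappa> \<in> carrier (prym_K Gt G p At A)"
    by (rule tf(5)[OF that])
qed

lemma zbasis_prym_K_iff:
  assumes "\<And>i. i < n \<Longrightarrow> k i \<in> T.cycles" "\<And>i. i < n \<Longrightarrow> K_proj (k i) = \<kappa> i"
  shows "zbasis (prym_K Gt G p At A) n \<kappa> \<longleftrightarrow> rel_basis sat_pull T.cycles n k"
  using zbasis_iff_rel_basis[OF T.H1_group prym_K_quotient(1,2), unfolded T.carrier_H1,
      OF prym_K_quotient(3,4) assms] .

text \<open>Two representatives of a class differ by an element of \<open>sat_pull\<close>, which is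
  orthogonal to \<open>ker_push\<close>.\<close>

lemma prym_pairing_eq:
  assumes k: "k \<in> T.cycles" and \<mu>: "\<mu> \<in> ker_push"
  shows "prym_pairing Gt (K_proj k) \<mu> = length_pairing Gt k \<mu>"
  unfolding prym_pairing_def
proof (rule the_equality)
  have car: "K_proj k \<in> carrier (prym_K Gt G p At A)" using k prym_K_quotient(3) by blast
  note mem = prym_K_quotient(5)[OF car]
  show "\<exists>x\<in>\<Union>(K_proj k). length_pairing Gt k \<mu> = length_pairing Gt x \<mu>"
    by (rule bexI[of _ k, OF refl]) (use mem k in simp)
  fix r assume "\<exists>x\<in>\<Union>(K_proj k). r = length_pairing Gt x \<mu>"
  then obtain x where x: "x \<in> \<Union>(K_proj k)" and r: "r = length_pairing Gt x \<mu>" by (elim bexE)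
  from x have x: "x \<in> T.cycles" "K_proj x = K_proj k" unfolding mem by (rule conjunct1, rule conjunct2)
  have d: "x - k \<in> T.cycles" by (rule frag.subspace_diff[OF T.subspace_cycles x(1) k])
  have "K_proj (x - k) = \<one>\<^bsub>prym_K Gt G p At A\<^esub>"
    using hom_frag_eq_iff[OF T.H1_group comm_group.axioms(2)[OF prym_K_quotient(1)] prym_K_quotient(2),
        unfolded T.carrier_H1, OF x(1) k] x(2) by (rule iffD1)
  then have "x - k \<in> sat_pull" using prym_K_quotient(4)[OF d] by (rule iffD1[rotated])
  from pairing_sat_pull_ker_push[OF this \<mu>] have "length_pairing Gt \<mu> (x - k) = 0"
    by (simp only: length_pairing_commute[of Gt \<mu>])
  then show "r = length_pairing Gt k \<mu>"
    by (simp add: r module_hom.diff[OF frag_form_length_pairing] length_pairing_commute[of Gt _ \<mu>])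
qed

text \<open>The bases of \<open>K\<close> and \<open>K'\<close> are arbitrary, so this one
  computation yields both existence and uniqueness of the value in \<open>vol2_Prym\<close>.
  Equality of \<open>m\<close> and \<open>n\<close> follows from counting two bases of the cycles of
  the cover.\<close>

lemma prym_det:
  assumes surj: "\<And>y. y \<in> B.cycles \<Longrightarrow> \<exists>x\<in>T.cycles. push x = y"
    and gd: "rel_basis {0} D.cycles r gd" and gu: "rel_basis D.cycles B.cycles s gu"
    and k: "rel_basis sat_pull T.cycles n k" and \<mu>: "rel_basis {0} ker_push m \<mu>"
  shows "m = n"
    and "\<bar>det (mat n n (\<lambda>(i, j). length_pairing Gt (k i) (\<mu> j)))\<bar> =
      2 ^ r * (vol2_Jac Gt At / vol2_Jac G A)"
proof -
  define g where "g = r + s"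
  define \<gamma> where "\<gamma> = (\<lambda>i. if i < r then gd i else gu (i - r))"
  define q where "q = (\<lambda>i. if i < r then half_pull (gd i) else pull (gu (i - r)))"
  have 0: "{0} \<subseteq> D.cycles" "{0} \<subseteq> sat_pull" "{0} \<subseteq> ker_push"
    using frag.subspace_0[OF D.subspace_cycles] frag.subspace_0[OF subspace_sat_pull]
      frag.subspace_0[OF subspace_ker_push] by simp_all
  have sub: "sat_pull \<subseteq> T.cycles" "ker_push \<subseteq> T.cycles" by (auto simp: sat_pull_def ker_push_def)
  have \<gamma>: "rel_basis {0} B.cycles g \<gamma>"
    unfolding g_def \<gamma>_def
    by (rule rel_basis_trans(1)[OF gd gu D.subspace_cycles B.subspace_cycles D_cycles_subset 0(1)])
  have q: "rel_basis {0} sat_pull g q"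
    unfolding g_def q_def by (rule sat_pull_basis[OF gd gu])
  define \<sigma> where "\<sigma> i = (SOME x. x \<in> T.cycles \<and> push x = \<gamma> i)" for i
  have \<sigma>: "\<sigma> i \<in> T.cycles" "push (\<sigma> i) = \<gamma> i" if "i < g" for i
  proof -
    have "\<exists>x. x \<in> T.cycles \<and> push x = \<gamma> i"
      using surj[OF rel_basisD(1)[OF \<gamma> that]] by (simp only: Bex_def)
    then have "\<sigma> i \<in> T.cycles \<and> push (\<sigma> i) = \<gamma> i" unfolding \<sigma>_def by (rule someI_ex)
    then show "\<sigma> i \<in> T.cycles" "push (\<sigma> i) = \<gamma> i" by auto
  qed
  have im: "push ` T.cycles = B.cycles"
  proof
    show "push ` T.cycles \<subseteq> B.cycles" using push_cycles by (rule image_subsetI)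
    show "B.cycles \<subseteq> push ` T.cycles"
    proof
      fix y assume "y \<in> B.cycles"
      from surj[OF this] obtain x where "x \<in> T.cycles" "push x = y" ..
      then show "y \<in> push ` T.cycles" by (intro image_eqI[of _ _ x]) simp_all
    qed
  qed
  have "rel_basis {0} (push ` T.cycles) g (\<lambda>i. push (\<sigma> i))"
    unfolding im using \<gamma> rel_basis_cong[of g "\<lambda>i. push (\<sigma> i)" \<gamma>, OF \<sigma>(2)] by simp
  moreover have "push x = 0 \<longleftrightarrow> x \<in> ker_push" if "x \<in> T.cycles" for x
    using that by (simp add: ker_push_def)
  ultimately have \<sigma>K: "rel_basis ker_push T.cycles g \<sigma>"
    using rel_basis_hom[of push g \<sigma> T.cycles ker_push, OF frag_hom_push \<sigma>(1) _ T.subspace_cycles] by simp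
  \<comment> \<open>Placing \<open>k\<close> before \<open>q\<close> and \<open>\<mu>\<close> before
    \<open>\<sigma>\<close> puts the vanishing pairings of \<open>q\<close> with
    \<open>\<mu>\<close> in the lower left block.\<close>
  define X where "X = (\<lambda>i. if i < n then k i else q (i - n))"
  define Y where "Y = (\<lambda>i. if i < m then \<mu> i else \<sigma> (i - m))"
  have X: "rel_basis {0} T.cycles (n + g) X"
    unfolding X_def
    by (rule rel_basis_trans(2)[OF q k subspace_sat_pull T.subspace_cycles sub(1) 0(2)])
  have Y: "rel_basis {0} T.cycles (m + g) Y"
    unfolding Y_def
    by (rule rel_basis_trans(1)[OF \<mu> \<sigma>K subspace_ker_push T.subspace_cycles sub(2) 0(3)])
  have "n + g = m + g" by (rule rel_basis_card_unique[OF frag.subspace_single_0 X Y])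
  then show mn: "m = n" by simp
  let ?B = "length_pairing Gt"
  \<comment> \<open>Pairing with an element of \<open>sat_pull\<close> upstairs is half the pairing
    of push-forwards. That half survives where \<open>push (q i) = \<gamma> i\<close>, for
    \<open>i < r\<close>, and is cancelled where \<open>push (q i) = 2 \<gamma> i\<close>.\<close>
  define \<epsilon> :: "nat \<Rightarrow> real" where "\<epsilon> i = (if i < r then 1 / 2 else 1)" for i
  have q\<sigma>: "?B (q i) (\<sigma> j) = \<epsilon> i * length_pairing G (\<gamma> i) (\<gamma> j)" if ij: "i < g" "j < g" for i j
  proof -
    have "2 * ?B (q i) (\<sigma> j) = length_pairing G (push (q i)) (\<gamma> j)"
      using pairing_sat_pull[OF rel_basisD(1)[OF q ij(1)] \<sigma>(1)[OF ij(2)]] \<sigma>(2)[OF ij(2)] by simp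
    moreover have "length_pairing G (push (q i)) (\<gamma> j) = 2 * (\<epsilon> i * length_pairing G (\<gamma> i) (\<gamma> j))"
    proof (cases "i < r")
      case True
      then show ?thesis
        using half_pull(2)[OF rel_basisD(1)[OF gd True]] by (simp add: q_def \<gamma>_def \<epsilon>_def)
    next
      case False
      then have "gu (i - r) \<in> B.cycles" using ij(1) by (intro rel_basisD(1)[OF gu]) (simp add: g_def)
      then have "push (q i) = frag_cmul 2 (\<gamma> i)" using False by (simp add: q_def \<gamma>_def push_pull)
      then have "length_pairing G (push (q i)) (\<gamma> j) = 2 * length_pairing G (\<gamma> j) (\<gamma> i)"
        by (simp add: length_pairing_commute[of G "frag_cmul 2 _"] module_hom.scale[OF frag_form_length_pairing])
      then show ?thesis using False by (simp add: \<epsilon>_def length_pairing_commute[of G "\<gamma> j"])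
    qed
    ultimately show ?thesis by simp
  qed
  have prod\<epsilon>: "(\<Prod>i<g. \<epsilon> i) = 1 / 2 ^ r"
    unfolding g_def by (induction s) (simp_all add: \<epsilon>_def power_one_over)
  show "\<bar>det (mat n n (\<lambda>(i, j). ?B (k i) (\<mu> j)))\<bar> = 2 ^ r * (vol2_Jac Gt At / vol2_Jac G A)"
  proof -
    \<comment> \<open>Positivity allows the absolute value to be inserted, after which the columns
      may pass to the basis \<open>Y\<close>.\<close>
    have "vol2_Jac Gt At = \<bar>det (mat (n + g) (n + g) (\<lambda>(i, j). ?B (X i) (X j)))\<bar>"
      using vol2_Jac_eq[OF metric(1) orient_t X] vol2_Jac_pos[OF metric(1) orient_t] by simp
    also have "\<dots> = \<bar>det (mat (n + g) (n + g) (\<lambda>(i, j). ?B (X i) (Y j)))\<bar>"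
      by (rule gram_det_abs[where B = ?B, OF frag_form_length_pairing length_pairing_commute X X Y[unfolded mn], symmetric])
    also have "det (mat (n + g) (n + g) (\<lambda>(i, j). ?B (X i) (Y j))) =
        det (mat n n (\<lambda>(i, j). ?B (X i) (Y j))) * det (mat g g (\<lambda>(i, j). ?B (X (n + i)) (Y (n + j))))"
    proof (rule det_block_upper)
      fix i j assume "i < g" "j < n"
      then show "?B (X (n + i)) (Y j) = 0"
        using pairing_sat_pull_ker_push[OF rel_basisD(1)[OF q, of i] rel_basisD(1)[OF \<mu>, of j]]
        by (simp add: X_def Y_def mn)
    qed
    also have "mat n n (\<lambda>(i, j). ?B (X i) (Y j)) = mat n n (\<lambda>(i, j). ?B (k i) (\<mu> j))"
      by (rule cong_mat) (simp_all add: X_def Y_def mn)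
    also have "mat g g (\<lambda>(i, j). ?B (X (n + i)) (Y (n + j))) =
        mat g g (\<lambda>(i, j). \<epsilon> i * length_pairing G (\<gamma> i) (\<gamma> j))"
      by (rule cong_mat) (simp_all add: X_def Y_def mn q\<sigma>)
    also have "det \<dots> = 1 / 2 ^ r * vol2_Jac G A"
      unfolding det_scaled_rows prod\<epsilon> vol2_Jac_eq[OF metric(2) orient_b \<gamma>] ..
    finally have "vol2_Jac Gt At =
        \<bar>det (mat n n (\<lambda>(i, j). ?B (k i) (\<mu> j)))\<bar> * (1 / 2 ^ r * vol2_Jac G A)"
      using vol2_Jac_pos[OF metric(2) orient_b] by (simp add: abs_mult)
    then show ?thesis using vol2_Jac_pos[OF metric(2) orient_b] by (simp add: field_simps)
  qed
qed

text \<open>The definite description in \<open>vol2_Prym\<close> needs a witness. Freeness of the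
  cycles modulo \<open>sat_pull\<close> comes from embedding them by \<open>defect\<close> into the
  chains of the cover.\<close>

lemma exists_prym_bases:
  obtains n m k \<mu> where "rel_basis sat_pull T.cycles n k" "rel_basis {0} ker_push m \<mu>"
proof -
  have "Poly_Mapping.keys x \<subseteq> edges Gt" if "x \<in> ker_push" for x using that by (simp add: ker_push_def)
  from exists_basis[OF T.finite_edges subspace_ker_push this]
  obtain m \<mu> where \<mu>: "rel_basis {0} ker_push m \<mu>" by auto
  have "Poly_Mapping.keys z \<subseteq> edges Gt" if z: "z \<in> defect ` T.cycles" for z
  proof -
    obtain x where x: "x \<in> T.cycles" "z = defect x" using z by (rule imageE)
    have "defect x \<in> frag_on (edges Gt)"
      unfolding defect_def using x(1) pull_in
      by (intro frag.subspace_diff[OF subspace_frag_on] frag.subspace_scale[OF subspace_frag_on]) auto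
    then show ?thesis by (simp add: x(2))
  qed
  from exists_basis[OF T.finite_edges module_hom.subspace_image[OF frag_hom_defect T.subspace_cycles] this]
  obtain n d where d: "rel_basis {0} (defect ` T.cycles) n d" by auto
  have ker: "defect x = 0 \<longleftrightarrow> x \<in> sat_pull" if "x \<in> T.cycles" for x
    using that by (simp add: defect_def sat_pull_def)
  obtain k where "rel_basis sat_pull T.cycles n k"
    by (rule exists_rel_basis_hom[OF frag_hom_defect ker T.subspace_cycles d]) (assumption | rule that)+
  then show thesis using \<mu> by (rule that)
qed

lemma vol2_Prym_eq:
  assumes surj: "\<And>y. y \<in> B.cycles \<Longrightarrow> \<exists>x\<in>T.cycles. push x = y"
    and gd: "rel_basis {0} D.cycles r gd" and gu: "rel_basis D.cycles B.cycles s gu"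
  shows "vol2_Prym Gt G p At A = 2 ^ r * (vol2_Jac Gt At / vol2_Jac G A)"
  unfolding vol2_Prym_def
proof (rule the_equality)
  obtain n m k \<mu> where k: "rel_basis sat_pull T.cycles n k" and \<mu>: "rel_basis {0} ker_push m \<mu>"
    by (rule exists_prym_bases)
  note pd = prym_det[OF surj gd gu k \<mu>]
  have kT: "k i \<in> T.cycles" if "i < n" for i by (rule rel_basisD(1)[OF k that])
  have "zbasis (prym_K Gt G p At A) n (\<lambda>i. K_proj (k i))"
    using zbasis_prym_K_iff[of n k "\<lambda>i. K_proj (k i)", OF kT refl] k by simp
  moreover have "zbasis (prym_K' Gt G p At A) n \<mu>" using \<mu> pd(1) by (simp only: zbasis_prym_K'_iff)
  moreover have "mat n n (\<lambda>(i, j). prym_pairing Gt (K_proj (k i)) (\<mu> j)) =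
      mat n n (\<lambda>(i, j). length_pairing Gt (k i) (\<mu> j))"
    using rel_basisD(1)[OF \<mu>] pd(1) by (intro cong_mat) (simp_all add: prym_pairing_eq[OF kT])
  ultimately show "\<exists>n \<kappa> \<mu>. zbasis (prym_K Gt G p At A) n \<kappa> \<and> zbasis (prym_K' Gt G p At A) n \<mu> \<and>
      2 ^ r * (vol2_Jac Gt At / vol2_Jac G A) = \<bar>det (mat n n (\<lambda>(i, j). prym_pairing Gt (\<kappa> i) (\<mu> j)))\<bar>"
    using pd(2) by (intro exI[of _ n] exI[of _ "\<lambda>i. K_proj (k i)"] exI[of _ \<mu>]) simp
next
  fix D
  assume "\<exists>n \<kappa> \<mu>. zbasis (prym_K Gt G p At A) n \<kappa> \<and> zbasis (prym_K' Gt G p At A) n \<mu> \<and>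
      D = \<bar>det (mat n n (\<lambda>(i, j). prym_pairing Gt (\<kappa> i) (\<mu> j)))\<bar>"
  then obtain n \<kappa> \<mu> where \<kappa>: "zbasis (prym_K Gt G p At A) n \<kappa>" and "zbasis (prym_K' Gt G p At A) n \<mu>"
    and D: "D = \<bar>det (mat n n (\<lambda>(i, j). prym_pairing Gt (\<kappa> i) (\<mu> j)))\<bar>" by (elim exE conjE)
  then have \<mu>: "rel_basis {0} ker_push n \<mu>" by (simp only: zbasis_prym_K'_iff)
  \<comment> \<open>An arbitrary basis of \<open>K\<close> is lifted to cycles, so that
    \<open>prym_det\<close> also applies to it.\<close>
  define k where "k i = inv_into T.cycles K_proj (\<kappa> i)" for i
  have k: "k i \<in> T.cycles" "K_proj (k i) = \<kappa> i" if "i < n" for i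
  proof -
    have "\<kappa> i \<in> K_proj ` T.cycles" using \<kappa> that by (auto simp: zbasis_def prym_K_quotient(3))
    then show "k i \<in> T.cycles" "K_proj (k i) = \<kappa> i"
      unfolding k_def by (rule inv_into_into, rule f_inv_into_f)
  qed
  have kb: "rel_basis sat_pull T.cycles n k" using zbasis_prym_K_iff[of n k \<kappa>, OF k] \<kappa> by simp
  have "mat n n (\<lambda>(i, j). prym_pairing Gt (\<kappa> i) (\<mu> j)) = mat n n (\<lambda>(i, j). length_pairing Gt (k i) (\<mu> j))"
  proof (intro cong_mat refl)
    fix i j assume ij: "i < n" "j < n"
    show "(case (i, j) of (i, j) \<Rightarrow> prym_pairing Gt (\<kappa> i) (\<mu> j)) = (case (i, j) of (i, j) \<Rightarrow> length_pairing Gt (k i) (\<mu> j))"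
      using prym_pairing_eq[OF k(1)[OF ij(1)] rel_basisD(1)[OF \<mu> ij(2)]] k(2)[OF ij(1)] by simp
  qed
  then show "D = 2 ^ r * (vol2_Jac Gt At / vol2_Jac G A)"
    unfolding D using prym_det(2)[OF surj gd gu kb \<mu>] by simp
qed

end

theorem theorem3p11:
  fixes Gt :: "('w, 'k) mgraph" and G :: "('v, 'h) mgraph"
    and p :: "('w, 'k, 'v, 'h) cover"
    and At :: "'k set" and A :: "'h set"
  assumes "double_cover Gt G p"
    and "dilated_cover Gt G p"
    and "connected_graph G"
    and "orientation Gt At" and "orientation G A"
    and "compatible_orientations Gt p At A"
  defines "m\<^sub>d \<equiv> card (edges (dilation_subgraph Gt G p))"
    and "n\<^sub>d \<equiv> card (verts (dilation_subgraph Gt G p))"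
    and "d \<equiv> card (components (dilation_subgraph Gt G p))"
  shows "vol2_Prym Gt G p At A =
    2 powi (int m\<^sub>d - int n\<^sub>d + int d) * (vol2_Jac Gt At / vol2_Jac G A)"
proof -
  interpret oriented_cover Gt G p At A
    using assms(1,4,5,6) by unfold_locales
  obtain r s gd gu where gd: "rel_basis {0} D.cycles r gd" and gu: "rel_basis D.cycles B.cycles s gu"
    by (rule exists_adapted_basis)
  \<comment> \<open>The integer exponent is a rank, so \<open>powi\<close> reduces to an ordinary
    power.\<close>
  have "int m\<^sub>d - int n\<^sub>d + int d = int r"
    using D.betti[OF gd] unfolding m\<^sub>d_def n\<^sub>d_def d_def by linarith
  then show ?thesis
    using vol2_Prym_eq[OF push_surj[OF assms(2,3)] gd gu] by simp
qed

end
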